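(* Let $\psi\in\mathcal S(\mathbb R^n)$ with $\psi(0)=1$ and a weight $M$ be given, and put $\psi_k(\xi)=\psi(2^{-kM}\xi)$. Let $p,q\in\,]0,\infty]$ satisfy $\frac1r:=\frac1p+\frac1q\le1$. Then for $f\in L_{p,\mathrm{loc}}(\mathbb R^n)\cap\mathcal S'(\mathbb R^n)$ and $g\in L_{q,\mathrm{loc}}(\mathbb R^n)\cap\mathcal S'(\mathbb R^n)$, $$\mathcal F^{-1}(\psi_k\mathcal Ff)\cdot\mathcal F^{-1}(\psi_k\mathcal Fg)\to fg\quad\text{in }\mathcal D'(\mathbb R^n)\text{ for }k\to\infty.$$ In particular $\pi(f,g)$ is defined and $\pi(f,g)=f(x)\cdot g(x)\in L_{r,\mathrm{loc}}(\mathbb R^n)$ for such $f$ and $g$.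
   Context: A weight is $M=(m_1,\dots,m_n)$ with $m_j\ge1$ and $\min_j m_j=1$; $2^{-kM}x=(2^{-km_1}x_1,\dots,2^{-km_n}x_n)$. Convention: $1/\infty=0$. Product $\pi$ (for the given weight $M$). For $\psi\in C_0^\infty(\mathbb R^n)$ equal to $1$ in a neighbourhood of $0$, let $\psi_k(\xi)=\psi(2^{-kM}\xi)$ and, for $u,v\in\mathcal S'(\mathbb R^n)$, $\pi_\psi(u,v)=\lim_{k\to\infty}\mathcal F^{-1}(\psi_k\mathcal Fu)\cdot\mathcal F^{-1}(\psi_k\mathcal Fv)$ when the limit exists in $\mathcal D'(\mathbb R^n)$. $\pi(u,v):=\pi_\psi(u,v)$ when $\pi_\psi(u,v)$ exists for all such $\psi$ and is independent of $\psi$. *)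

theory Defs
  imports "HOL-Analysis.Analysis"
begin

section \<open>Smooth functions, test functions and Schwartz functions\<close>

primrec partials :: "'n list \<Rightarrow> (real^'n \<Rightarrow> complex) \<Rightarrow> real^'n \<Rightarrow> complex" where
  "partials [] f = f"
| "partials (j # js) f = (\<lambda>x. frechet_derivative (partials js f) (at x) (axis j 1))"

definition smooth :: "(real^'n \<Rightarrow> complex) \<Rightarrow> bool" where
  "smooth f \<longleftrightarrow> (\<forall>js x. partials js f differentiable (at x))"

definition test_functions :: "(real^'n \<Rightarrow> complex) set" where
  "test_functions = {\<phi>. smooth \<phi> \<and> compact (closure {x. \<phi> x \<noteq> 0})}"

definition schwartz :: "(real^'n \<Rightarrow> complex) set" where
  "schwartz = {\<phi>. smooth \<phi> \<and>
     (\<forall>js N. bounded (range (\<lambda>x. (1 + norm x) ^ N *\<^sub>R partials js \<phi> x)))}"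

text \<open>Partial derivatives are indexed by lists of coordinate directions; for smooth functions
  every multi-index of order at most \<open>N\<close> is represented by a list of length at most \<open>N\<close>.\<close>

definition schwartz_seminorm :: "nat \<Rightarrow> (real^'n \<Rightarrow> complex) \<Rightarrow> real" where
  "schwartz_seminorm N \<phi> =
     (\<Sum>js | length js \<le> N. SUP x. (1 + norm x) ^ N * norm (partials js \<phi> x))"

definition C_seminorm :: "nat \<Rightarrow> (real^'n \<Rightarrow> complex) \<Rightarrow> real" where
  "C_seminorm N \<phi> = (\<Sum>js | length js \<le> N. SUP x. norm (partials js \<phi> x))"


section \<open>Distributions and tempered distributions\<close>

definition linear_functional_on ::
    "(real^'n \<Rightarrow> complex) set \<Rightarrow> ((real^'n \<Rightarrow> complex) \<Rightarrow> complex) \<Rightarrow> bool" where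
  "linear_functional_on V u \<longleftrightarrow>
     (\<forall>\<phi>\<in>V. \<forall>\<eta>\<in>V. u (\<lambda>x. \<phi> x + \<eta> x) = u \<phi> + u \<eta>) \<and>
     (\<forall>c. \<forall>\<phi>\<in>V. u (\<lambda>x. c * \<phi> x) = c * u \<phi>)"

text \<open>Functionals are made extensional (\<open>undefined\<close> outside their domain), so that equality
  of distributions is equality in HOL.\<close>

definition distributions :: "((real^'n \<Rightarrow> complex) \<Rightarrow> complex) set" where
  "distributions = {u \<in> extensional test_functions. linear_functional_on test_functions u \<and>
     (\<forall>K. compact K \<longrightarrow> (\<exists>C N. \<forall>\<phi>\<in>test_functions.
        closure {x. \<phi> x \<noteq> 0} \<subseteq> K \<longrightarrow> norm (u \<phi>) \<le> C * C_seminorm N \<phi>))}"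

definition tempered_distributions :: "((real^'n \<Rightarrow> complex) \<Rightarrow> complex) set" where
  "tempered_distributions = {u \<in> extensional schwartz. linear_functional_on schwartz u \<and>
     (\<exists>C N. \<forall>\<phi>\<in>schwartz. norm (u \<phi>) \<le> C * schwartz_seminorm N \<phi>)}"

definition tendsto_distr ::
    "(nat \<Rightarrow> (real^'n \<Rightarrow> complex) \<Rightarrow> complex) \<Rightarrow> ((real^'n \<Rightarrow> complex) \<Rightarrow> complex) \<Rightarrow> bool" where
  "tendsto_distr U w \<longleftrightarrow> (\<forall>k. U k \<in> distributions) \<and> w \<in> distributions \<and>
     (\<forall>\<phi>\<in>test_functions. (\<lambda>k. U k \<phi>) \<longlonglongrightarrow> w \<phi>)"

definition regular_distr :: "(real^'n \<Rightarrow> complex) \<Rightarrow> (real^'n \<Rightarrow> complex) \<Rightarrow> complex" where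
  "regular_distr f = (\<lambda>\<phi>\<in>test_functions. LINT x|lebesgue. f x * \<phi> x)"

text \<open>The tempered distribution \<open>u\<close> is given by the function \<open>f\<close>. The integral representation
  is demanded on test functions only: for Schwartz functions it need not converge absolutely.
  Since test functions are dense in the Schwartz space, \<open>f\<close> determines \<open>u\<close>.\<close>

definition given_by ::
    "((real^'n \<Rightarrow> complex) \<Rightarrow> complex) \<Rightarrow> (real^'n \<Rightarrow> complex) \<Rightarrow> bool" where
  "given_by u f \<longleftrightarrow> u \<in> tempered_distributions \<and> restrict u test_functions = regular_distr f"

definition Lp_loc :: "ennreal \<Rightarrow> (real^'n \<Rightarrow> complex) set" where
  "Lp_loc p = {f \<in> borel_measurable lebesgue. \<forall>K. compact K \<longrightarrow>
     (if p = \<infinity> then \<exists>C. AE x in lebesgue. x \<in> K \<longrightarrow> norm (f x) \<le> C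
      else (\<integral>\<^sup>+x\<in>K. ennreal (norm (f x) powr enn2real p) \<partial>lebesgue) < \<infinity>)}"


section \<open>Fourier transform\<close>

definition fourier :: "(real^'n \<Rightarrow> complex) \<Rightarrow> real^'n \<Rightarrow> complex" where
  "fourier \<phi> \<xi> = (LINT x|lborel. exp (- \<i> * complex_of_real (x \<bullet> \<xi>)) * \<phi> x)"

definition inv_fourier :: "(real^'n \<Rightarrow> complex) \<Rightarrow> real^'n \<Rightarrow> complex" where
  "inv_fourier \<phi> x = complex_of_real (1 / (2 * pi) ^ CARD('n)) *
     (LINT \<xi>|lborel. exp (\<i> * complex_of_real (x \<bullet> \<xi>)) * \<phi> \<xi>)"

definition fourier_distr ::
    "((real^'n \<Rightarrow> complex) \<Rightarrow> complex) \<Rightarrow> (real^'n \<Rightarrow> complex) \<Rightarrow> complex" where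
  "fourier_distr u = (\<lambda>\<phi>\<in>schwartz. u (fourier \<phi>))"

definition inv_fourier_distr ::
    "((real^'n \<Rightarrow> complex) \<Rightarrow> complex) \<Rightarrow> (real^'n \<Rightarrow> complex) \<Rightarrow> complex" where
  "inv_fourier_distr u = (\<lambda>\<phi>\<in>schwartz. u (inv_fourier \<phi>))"

definition mult_distr :: "(real^'n \<Rightarrow> complex) \<Rightarrow>
    ((real^'n \<Rightarrow> complex) \<Rightarrow> complex) \<Rightarrow> (real^'n \<Rightarrow> complex) \<Rightarrow> complex" where
  "mult_distr \<psi> u = (\<lambda>\<phi>\<in>schwartz. u (\<lambda>x. \<psi> x * \<phi> x))"


section \<open>The product\<close>

definition weight :: "real^'n \<Rightarrow> bool" where
  "weight M \<longleftrightarrow> (\<forall>j. M $ j \<ge> 1) \<and> Min (range (\<lambda>j. M $ j)) = 1"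

definition dilate :: "real^'n \<Rightarrow> nat \<Rightarrow> (real^'n \<Rightarrow> complex) \<Rightarrow> real^'n \<Rightarrow> complex" where
  "dilate M k \<psi> \<xi> = \<psi> (\<chi> j. 2 powr (- real k * M $ j) * \<xi> $ j)"

definition lowpass :: "real^'n \<Rightarrow> (real^'n \<Rightarrow> complex) \<Rightarrow> nat \<Rightarrow>
    ((real^'n \<Rightarrow> complex) \<Rightarrow> complex) \<Rightarrow> (real^'n \<Rightarrow> complex) \<Rightarrow> complex" where
  "lowpass M \<psi> k u = inv_fourier_distr (mult_distr (dilate M k \<psi>) (fourier_distr u))"

text \<open>The distributions \<open>lowpass M \<psi> k u\<close> and \<open>lowpass M \<psi> k v\<close> are given by smooth functions \<open>a k\<close> and
  \<open>b k\<close>, which they determine; these are multiplied pointwise. The existence of \<open>a\<close> and \<open>b\<close> is part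
  of the predicate.\<close>

definition lowpass_product_tendsto :: "real^'n \<Rightarrow> (real^'n \<Rightarrow> complex) \<Rightarrow>
    ((real^'n \<Rightarrow> complex) \<Rightarrow> complex) \<Rightarrow> ((real^'n \<Rightarrow> complex) \<Rightarrow> complex) \<Rightarrow>
    ((real^'n \<Rightarrow> complex) \<Rightarrow> complex) \<Rightarrow> bool" where
  "lowpass_product_tendsto M \<psi> u v w \<longleftrightarrow>
     (\<exists>a b. (\<forall>k. smooth (a k) \<and> given_by (lowpass M \<psi> k u) (a k) \<and>
                 smooth (b k) \<and> given_by (lowpass M \<psi> k v) (b k)) \<and>
            tendsto_distr (\<lambda>k. regular_distr (\<lambda>x. a k x * b k x)) w)"

definition cutoff :: "(real^'n \<Rightarrow> complex) \<Rightarrow> bool" where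
  "cutoff \<psi> \<longleftrightarrow> \<psi> \<in> test_functions \<and> eventually (\<lambda>\<xi>. \<psi> \<xi> = 1) (nhds 0)"

definition product_defined :: "real^'n \<Rightarrow>
    ((real^'n \<Rightarrow> complex) \<Rightarrow> complex) \<Rightarrow> ((real^'n \<Rightarrow> complex) \<Rightarrow> complex) \<Rightarrow> bool" where
  "product_defined M u v \<longleftrightarrow> (\<exists>w. \<forall>\<psi>. cutoff \<psi> \<longrightarrow> lowpass_product_tendsto M \<psi> u v w)"

definition product :: "real^'n \<Rightarrow>
    ((real^'n \<Rightarrow> complex) \<Rightarrow> complex) \<Rightarrow> ((real^'n \<Rightarrow> complex) \<Rightarrow> complex) \<Rightarrow>
    (real^'n \<Rightarrow> complex) \<Rightarrow> complex" where
  "product M u v = (THE w. \<forall>\<psi>. cutoff \<psi> \<longrightarrow> lowpass_product_tendsto M \<psi> u v w)"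

end

theory Submission
  imports Defs "HOL-Probability.Probability"
begin

text \<open>
  Write \<open>\<eta>\<^sub>k = \<F>\<^sup>-\<^sup>1 \<psi>\<^sub>k\<close>. By Fubini, without Fourier inversion, the low-pass filter of \<open>u\<close> maps a test
  function \<open>\<phi>\<close> to \<open>u (y \<mapsto> \<integral> \<phi>(x) \<eta>\<^sub>k(x - y) dx)\<close>, hence is given by the smooth function \<open>a\<^sub>k(x) = u (\<eta>\<^sub>k(x - \<cdot>))\<close>.
  Near the support of \<open>\<phi>\<close> one splits \<open>a\<^sub>k = F * \<eta>\<^sub>k + e\<^sub>k\<close> where \<open>F\<close> is \<open>f\<close> times a cut-off; the remainder \<open>e\<^sub>k\<close>
  tends to \<open>0\<close> uniformly there, because \<open>u\<close> has finite order while the derivatives of \<open>\<eta>\<^sub>k\<close> decay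
  away from the origin faster than any power of \<open>2\<^sup>-\<^sup>k\<close>. Truncation and Young's inequality approximate \<open>F(x - y) G(x - z)\<close> in
  \<open>L\<^sub>1(dx)\<close>, uniformly in \<open>y\<close> and \<open>z\<close>, by the same expression for continuous functions with compact
  support, for which \<open>F * \<eta>\<^sub>k \<rightarrow> F\<close> uniformly. The limit is unique since a smooth function is
  determined by its regular distribution.
\<close>

section \<open>Calculus of smooth functions\<close>

text \<open>\<open>u\<close> agrees with \<open>f\<close> on test functions only, so
  \<open>f\<close> may grow so fast that its integral against a shifted kernel diverges. Whatever
  reaches beyond a ball is therefore estimated through the finite order of \<open>u\<close>, and
  \<open>f\<close> is seen only after multiplication by a cut-off. A second obstacle is the exponent
  infinity: \<open>F * \<eta>\<^sub>k\<close> need not converge to \<open>F\<close> in the essential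
  supremum norm, so the two factors cannot be treated one at a time in dual norms. The product of
  the two convolutions is a double average of \<open>F (x - y) * G (x - z)\<close> with weights
  \<open>\<eta>\<^sub>k y * \<eta>\<^sub>k z\<close>, whose total mass is at most
  \<open>S\<^sup>2\<close>; this is why an approximation uniform in both shifts passes to the
  convolutions with a loss independent of \<open>k\<close>. That \<open>\<eta>\<^sub>k\<close> has
  integral \<open>\<psi> 0 = 1\<close> is found by pairing with dilated Gaussians. Functions defined
  by an integral or by applying \<open>u\<close> are differentiated by one device: a first-order
  expansion with quadratic remainder is proved for the kernel, with decay, and carried through the
  integral or through \<open>u\<close>.\<close>

definition pd :: "'n \<Rightarrow> (real^'n \<Rightarrow> complex) \<Rightarrow> real^'n \<Rightarrow> complex" where
  "pd j f = (\<lambda>x. frechet_derivative f (at x) (axis j 1))"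

lemma partials_Cons_pd: "partials (j # js) f = pd j (partials js f)"
  by (simp add: pd_def)

lemma partials_append: "partials (js @ ks) f = partials js (partials ks f)"
  by (induction js) auto

lemma partials_snoc: "partials (js @ [j]) f = partials js (pd j f)"
  by (simp add: partials_append pd_def)

declare partials.simps(2) [simp del]
declare partials_Cons_pd [simp]

text \<open>\<open>diffble n\<close> makes statements about smooth functions accessible to induction on the order \<open>n\<close>,
  starting with the innermost derivative.\<close>

primrec diffble :: "nat \<Rightarrow> (real^'n \<Rightarrow> complex) \<Rightarrow> bool" where
  "diffble 0 f = True"
| "diffble (Suc n) f = ((\<forall>x. f differentiable (at x)) \<and> (\<forall>j. diffble n (pd j f)))"

lemma diffble_iff:
  "diffble n f \<longleftrightarrow> (\<forall>js x. length js < n \<longrightarrow> partials js f differentiable (at x))"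
proof (induction n arbitrary: f)
  case (Suc n)
  show ?case
  proof
    assume L: "diffble (Suc n) f"
    show "\<forall>js x. length js < Suc n \<longrightarrow> partials js f differentiable (at x)"
    proof (intro allI impI)
      fix js :: "'a list" and x
      assume "length js < Suc n"
      then show "partials js f differentiable (at x)"
        using L Suc by (cases js rule: rev_cases) (auto simp: partials_snoc)
    qed
  next
    assume R: "\<forall>js x. length js < Suc n \<longrightarrow> partials js f differentiable (at x)"
    have "f differentiable (at x)" for x
      using R[rule_format, of "[]"] by simp
    moreover have "partials js (pd j f) differentiable (at x)" if "length js < n" for js j x
      using R[rule_format, of "js @ [j]"] that by (simp add: partials_snoc)
    ultimately show "diffble (Suc n) f"
      using Suc by auto
  qed
qed auto

lemma smooth_iff_diffble: "smooth f \<longleftrightarrow> (\<forall>n. diffble n f)"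
  unfolding smooth_def diffble_iff by blast

lemma smooth_pd: "smooth f \<Longrightarrow> smooth (pd j f)"
  unfolding smooth_def by (metis partials_snoc)

lemma smooth_partials: "smooth f \<Longrightarrow> smooth (partials js f)"
  by (induction js) (auto intro: smooth_pd)

lemma smooth_differentiable: "smooth f \<Longrightarrow> f differentiable (at x)"
  unfolding smooth_def by (metis partials.simps(1))

lemma smooth_continuous_on: "smooth f \<Longrightarrow> continuous_on S f"
  by (meson smooth_differentiable continuous_at_imp_continuous_on differentiable_imp_continuous_within)

lemma smooth_borel [measurable]: "smooth f \<Longrightarrow> f \<in> borel_measurable borel"
  by (simp add: borel_measurable_continuous_onI smooth_continuous_on)

lemma pd_eqI: "(f has_derivative f') (at x) \<Longrightarrow> pd j f x = f' (axis j 1)"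
  unfolding pd_def by (metis frechet_derivative_at)

lemma differentiable_has_derivative:
  "f differentiable (at x) \<Longrightarrow> (f has_derivative frechet_derivative f (at x)) (at x)"
  by (simp add: frechet_derivative_works)

lemma pd_add:
  assumes "f differentiable (at x)" "g differentiable (at x)"
  shows "pd j (\<lambda>x. f x + g x) x = pd j f x + pd j g x"
  by (subst pd_eqI[OF has_derivative_add[OF assms[THEN differentiable_has_derivative]]])
     (simp add: pd_def)

lemma pd_mult:
  assumes "f differentiable (at x)" "g differentiable (at x)"
  shows "pd j (\<lambda>x. f x * g x) x = pd j f x * g x + f x * pd j g x"
  by (subst pd_eqI[OF has_derivative_mult[OF assms[THEN differentiable_has_derivative]]])
     (simp add: pd_def)

lemma pd_const: "pd j (\<lambda>x. c) = (\<lambda>x. 0)"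
  by (auto intro!: ext pd_eqI[OF has_derivative_const, THEN trans])

lemma diffble_const: "diffble n (\<lambda>x. c)"
proof (induction n arbitrary: c)
qed (auto simp: pd_const)

lemma diffble_add: "diffble n f \<Longrightarrow> diffble n g \<Longrightarrow> diffble n (\<lambda>x. f x + g x)"
proof (induction n arbitrary: f g)
  case (Suc n)
  then have "pd j (\<lambda>x. f x + g x) = (\<lambda>x. pd j f x + pd j g x)" for j
    by (auto intro!: ext pd_add)
  with Suc show ?case by auto
qed auto

lemma diffble_mono: "diffble n f \<Longrightarrow> m \<le> n \<Longrightarrow> diffble m f"
  by (auto simp: diffble_iff)

lemma diffble_mult: "diffble n f \<Longrightarrow> diffble n g \<Longrightarrow> diffble n (\<lambda>x. f x * g x)"
proof (induction n arbitrary: f g)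
  case (Suc n)
  then have "pd j (\<lambda>x. f x * g x) = (\<lambda>x. pd j f x * g x + f x * pd j g x)" for j
    by (auto intro!: ext pd_mult)
  moreover have "diffble n f" "diffble n g"
    using Suc.prems by (auto intro: diffble_mono simp del: diffble.simps)
  ultimately show ?case
    using Suc by (auto intro!: diffble_add)
qed auto

lemma smooth_const: "smooth (\<lambda>x. c)"
  by (simp add: smooth_iff_diffble diffble_const)

lemma smooth_add: "smooth f \<Longrightarrow> smooth g \<Longrightarrow> smooth (\<lambda>x. f x + g x)"
  by (simp add: smooth_iff_diffble diffble_add)

lemma smooth_mult: "smooth f \<Longrightarrow> smooth g \<Longrightarrow> smooth (\<lambda>x. f x * g x)"
  by (simp add: smooth_iff_diffble diffble_mult)

lemma smooth_cmult: "smooth f \<Longrightarrow> smooth (\<lambda>x. c * f x)"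
  by (intro smooth_mult smooth_const)

lemma smooth_diff: "smooth f \<Longrightarrow> smooth g \<Longrightarrow> smooth (\<lambda>x. f x - g x)"
  using smooth_add[OF _ smooth_cmult, of f g "-1"] by simp

lemma smooth_sum: "(\<And>i. i \<in> I \<Longrightarrow> smooth (f i)) \<Longrightarrow> smooth (\<lambda>x. \<Sum>i\<in>I. f i x)"
  by (induction I rule: infinite_finite_induct) (auto intro: smooth_const smooth_add)

lemma pd_coord: "pd j (\<lambda>x. complex_of_real (x $ i)) = (\<lambda>x. if i = j then 1 else 0)"
proof
  fix x :: "real^'a"
  have "((\<lambda>x. complex_of_real (x $ i)) has_derivative (\<lambda>h. complex_of_real (h $ i))) (at x)"
    by (intro bounded_linear_imp_has_derivative bounded_linear_compose[OF bounded_linear_of_real]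
        bounded_linear_vec_nth)
  from pd_eqI[OF this, of j] show "pd j (\<lambda>x. complex_of_real (x $ i)) x = (if i = j then 1 else 0)"
    by (auto simp: axis_def)
qed

lemma differentiable_coord: "(\<lambda>x. complex_of_real (x $ i)) differentiable (at x)"
  by (intro bounded_linear_imp_differentiable bounded_linear_compose[OF bounded_linear_of_real]
      bounded_linear_vec_nth)

lemma smooth_coord: "smooth (\<lambda>x. complex_of_real (x $ i))"
proof -
  have "diffble n (\<lambda>x. complex_of_real (x $ i))" for n
    by (cases n) (auto simp: pd_coord differentiable_coord intro!: diffble_const)
  then show ?thesis by (simp add: smooth_iff_diffble)
qed

lemma partials_add:
  "smooth f \<Longrightarrow> smooth g \<Longrightarrow> partials js (\<lambda>x. f x + g x) = (\<lambda>x. partials js f x + partials js g x)"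
proof (induction js)
  case (Cons j js)
  then show ?case
    by (auto intro!: ext pd_add smooth_differentiable smooth_partials)
qed auto

lemma pd_cmult: "smooth f \<Longrightarrow> pd j (\<lambda>x. c * f x) = (\<lambda>x. c * pd j f x)"
  by (auto intro!: ext simp: pd_mult pd_const smooth_differentiable smooth_const)

lemma partials_cmult: "smooth f \<Longrightarrow> partials js (\<lambda>x. c * f x) = (\<lambda>x. c * partials js f x)"
  by (induction js) (auto simp: pd_cmult smooth_partials)

lemma partials_diff:
  "smooth f \<Longrightarrow> smooth g \<Longrightarrow> partials js (\<lambda>x. f x - g x) = (\<lambda>x. partials js f x - partials js g x)"
  using partials_add[of f "\<lambda>x. -1 * g x" js] partials_cmult[of g js "-1"] smooth_cmult[of g "-1"]
  by simp

lemma partials_const: "partials js (\<lambda>x. c) = (\<lambda>x. if js = [] then c else 0)"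
  by (induction js) (auto simp: pd_const)

lemma partials_sum:
  "(\<And>i. i \<in> I \<Longrightarrow> smooth (f i)) \<Longrightarrow>
    partials js (\<lambda>x. \<Sum>i\<in>I. f i x) = (\<lambda>x. \<Sum>i\<in>I. partials js (f i) x)"
proof (induction I rule: infinite_finite_induct)
  case (insert i I)
  then show ?case
    using partials_add[of "f i" "\<lambda>x. \<Sum>i\<in>I. f i x" js] by (simp add: smooth_sum)
qed (auto simp: partials_const)

text \<open>A crude Leibniz rule: each differentiation doubles the number of terms. The induction
  removes the innermost derivative, because the bounds on \<open>f\<close> and \<open>g\<close> up
  to order \<open>n + 1\<close> then serve as bounds on \<open>pd j f\<close> and
  \<open>pd j g\<close> up to order \<open>n\<close>.\<close>

lemma norm_partials_mult_le:
  assumes "smooth f" "smooth g" "0 \<le> A"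
    and "\<And>ks. length ks \<le> length js \<Longrightarrow> norm (partials ks f x) \<le> A"
    and "\<And>ks. length ks \<le> length js \<Longrightarrow> norm (partials ks g x) \<le> B"
  shows "norm (partials js (\<lambda>x. f x * g x) x) \<le> 2 ^ length js * (A * B)"
  using assms
proof (induction js arbitrary: f g rule: rev_induct)
  case Nil
  have "norm (f x) \<le> A" "norm (g x) \<le> B"
    using Nil(4)[of "[]"] Nil(5)[of "[]"] by auto
  then show ?case
    using Nil by (auto simp: norm_mult intro!: mult_mono)
next
  case (snoc j js)
  have *: "pd j (\<lambda>x. f x * g x) = (\<lambda>x. pd j f x * g x + f x * pd j g x)"
    using snoc.prems by (auto intro!: ext pd_mult smooth_differentiable)
  have "norm (partials js (\<lambda>x. pd j f x * g x) x) \<le> 2 ^ length js * (A * B)"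
    using snoc.prems(4,5)[of "_ @ [j]"] snoc.prems
    by (intro snoc.IH) (auto simp: smooth_pd partials_snoc)
  moreover have "norm (partials js (\<lambda>x. f x * pd j g x) x) \<le> 2 ^ length js * (A * B)"
    using snoc.prems(4,5)[of "_ @ [j]"] snoc.prems
    by (intro snoc.IH) (auto simp: smooth_pd partials_snoc)
  ultimately have "norm (partials js (\<lambda>x. pd j f x * g x) x + partials js (\<lambda>x. f x * pd j g x) x)
      \<le> 2 ^ length js * (A * B) + 2 ^ length js * (A * B)"
    by (intro norm_triangle_le) linarith
  then show ?case
    using snoc.prems
    by (simp add: partials_snoc * partials_add smooth_mult smooth_pd algebra_simps)
qed

text \<open>One diagonal map serves for all substitutions: anisotropic dilations, and together with
  an offset \<open>z\<close> also translations (\<open>c = 1\<close>) and reflections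
  (\<open>c = - 1\<close>).\<close>

definition dil :: "real^'n \<Rightarrow> real^'n \<Rightarrow> real^'n" where
  "dil c x = (\<chi> j. c $ j * x $ j)"

lemma dil_nth [simp]: "dil c x $ j = c $ j * x $ j"
  by (simp add: dil_def)

lemma bounded_linear_dil: "bounded_linear (dil c)"
  unfolding linear_conv_bounded_linear[symmetric]
  by (rule linearI) (auto simp: vec_eq_iff algebra_simps)

lemma dil_axis: "dil c (axis j 1) = c $ j *\<^sub>R axis j 1"
  by (auto simp: vec_eq_iff axis_def)

lemma affine_has_derivative:
  assumes "w differentiable (at (z + dil c y))"
  shows "((\<lambda>y. w (z + dil c y)) has_derivative
    (\<lambda>h. frechet_derivative w (at (z + dil c y)) (dil c h))) (at y)"
proof -
  have "((\<lambda>y. z + dil c y) has_derivative dil c) (at y)"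
    by (auto intro!: derivative_eq_intros bounded_linear_imp_has_derivative bounded_linear_dil)
  from diff_chain_at[OF this differentiable_has_derivative[OF assms]]
  show ?thesis by (simp add: o_def)
qed

lemma pd_affine:
  assumes "smooth w"
  shows "pd j (\<lambda>y. w (z + dil c y)) = (\<lambda>y. of_real (c $ j) * pd j w (z + dil c y))"
proof
  fix y
  have d: "w differentiable (at (z + dil c y))"
    using assms by (rule smooth_differentiable)
  have "linear (frechet_derivative w (at (z + dil c y)))"
    using d by (rule linear_frechet_derivative)
  then show "pd j (\<lambda>y. w (z + dil c y)) y = of_real (c $ j) * pd j w (z + dil c y)"
    by (subst pd_eqI[OF affine_has_derivative[OF d]])
      (simp add: dil_axis linear_cmul pd_def scaleR_conv_of_real[where 'a = complex])
qed

lemma smooth_affine: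
  assumes "smooth w"
  shows "smooth (\<lambda>y. w (z + dil c y))"
proof -
  have "smooth w \<Longrightarrow> diffble n (\<lambda>y. w (z + dil c y))" for n
  proof (induction n arbitrary: w)
    case (Suc n)
    have "(\<lambda>y. w (z + dil c y)) differentiable (at y)" for y
      using affine_has_derivative[OF smooth_differentiable[OF Suc.prems]] differentiable_def by blast
    moreover have "diffble n (pd j (\<lambda>y. w (z + dil c y)))" for j
      using Suc by (simp add: pd_affine smooth_pd diffble_mult diffble_const)
    ultimately show ?case by simp
  qed auto
  with assms show ?thesis by (simp add: smooth_iff_diffble)
qed

lemma partials_affine:
  assumes "smooth w"
  shows "partials js (\<lambda>y. w (z + dil c y)) =
    (\<lambda>y. of_real (prod_list (map (($) c) js)) * partials js w (z + dil c y))"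
proof (induction js)
  case (Cons j js)
  have "pd j (\<lambda>y. of_real (prod_list (map (($) c) js)) * partials js w (z + dil c y)) =
      (\<lambda>y. of_real (prod_list (map (($) c) js)) * (of_real (c $ j) * pd j (partials js w) (z + dil c y)))"
    using assms by (simp add: pd_cmult smooth_affine smooth_partials pd_affine)
  with Cons show ?case by (auto simp: mult_ac)
qed auto

lemma dil_uminus_one: "dil (- 1) y = - y"
  by (simp add: vec_eq_iff)

lemma partials_reflect:
  "smooth w \<Longrightarrow> partials js (\<lambda>y. w (z - y)) = (\<lambda>y. (-1) ^ length js * partials js w (z - y))"
proof -
  have "prod_list (map (($) (- 1 :: real^'a)) js) = (-1) ^ length js"
    by (induction js) auto
  then show "smooth w \<Longrightarrow> ?thesis"
    using partials_affine[of w js z "- 1"] by (simp add: dil_uminus_one)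
qed

section \<open>Mean value and Taylor estimates\<close>

lemma frechet_derivative_sum_pd:
  assumes "f differentiable (at x)"
  shows "frechet_derivative f (at x) h = (\<Sum>j\<in>UNIV. of_real (h $ j) * pd j f x)"
proof -
  have l: "linear (frechet_derivative f (at x))"
    using assms by (rule linear_frechet_derivative)
  have "h = (\<Sum>j\<in>UNIV. h $ j *\<^sub>R axis j 1)"
    by (simp add: vec_eq_iff axis_def if_distrib cong: if_cong)
  then have "frechet_derivative f (at x) h = (\<Sum>j\<in>UNIV. h $ j *\<^sub>R frechet_derivative f (at x) (axis j 1))"
    by (metis (no_types, lifting) linear_sum[OF l] linear_cmul[OF l] sum.cong)
  then show ?thesis by (simp add: pd_def scaleR_conv_of_real)
qed

lemma has_vector_derivative_line:
  assumes "f differentiable (at (x + t *\<^sub>R h))"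
  shows "((\<lambda>t. f (x + t *\<^sub>R h)) has_vector_derivative
    (\<Sum>j\<in>UNIV. of_real (h $ j) * pd j f (x + t *\<^sub>R h))) (at t within S)"
proof -
  have "((\<lambda>t. x + t *\<^sub>R h) has_derivative (\<lambda>s. s *\<^sub>R h)) (at t within S)"
    by (auto intro!: derivative_eq_intros)
  moreover have "(f has_derivative frechet_derivative f (at (x + t *\<^sub>R h))) (at (x + t *\<^sub>R h) within ((\<lambda>t. x + t *\<^sub>R h) ` S))"
    using differentiable_has_derivative[OF assms] has_derivative_at_withinI by blast
  ultimately have "((f \<circ> (\<lambda>t. x + t *\<^sub>R h)) has_derivative
      (frechet_derivative f (at (x + t *\<^sub>R h)) \<circ> (\<lambda>s. s *\<^sub>R h))) (at t within S)"
    by (rule diff_chain_within)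
  moreover have "frechet_derivative f (at (x + t *\<^sub>R h)) \<circ> (\<lambda>s. s *\<^sub>R h) =
      (\<lambda>s. s *\<^sub>R (\<Sum>j\<in>UNIV. of_real (h $ j) * pd j f (x + t *\<^sub>R h)))"
    using assms by (auto simp: frechet_derivative_sum_pd o_def scaleR_conv_of_real[where 'a = complex] sum_distrib_left mult_ac)
  ultimately show ?thesis
    by (simp add: has_vector_derivative_def o_def)
qed

lemma sum_coords_le:
  fixes h :: "real^'n" and g :: "'n \<Rightarrow> complex" and B :: real
  assumes "\<And>j. norm (g j) \<le> B"
  shows "norm (\<Sum>j\<in>UNIV. of_real (h $ j) * g j) \<le> CARD('n) * B * norm h"
proof -
  have "norm (\<Sum>j\<in>UNIV. of_real (h $ j) * g j) \<le> (\<Sum>j\<in>(UNIV :: 'n set). norm h * B)"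
  proof (rule sum_norm_le)
    fix j
    show "norm (of_real (h $ j) * g j) \<le> norm h * B"
      unfolding norm_mult norm_of_real
      by (intro mult_mono component_le_norm_cart assms) auto
  qed
  then show ?thesis by (simp add: mult_ac)
qed

lemma mean_value_bound:
  fixes h :: "real^'n" and B :: real
  assumes "\<And>t. t \<in> {0..1} \<Longrightarrow> f differentiable (at (x + t *\<^sub>R h))"
    and "\<And>t j. t \<in> {0..1} \<Longrightarrow> norm (pd j f (x + t *\<^sub>R h)) \<le> B"
  shows "norm (f (x + h) - f x) \<le> CARD('n) * B * norm h"
proof -
  have "norm (f (x + 1 *\<^sub>R h) - f (x + 0 *\<^sub>R h)) \<le> (CARD('n) * B * norm h) * norm (1 - 0 :: real)"
  proof (rule differentiable_bound[where S = "{0..1}"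
        and f' = "\<lambda>t s. s *\<^sub>R (\<Sum>j\<in>UNIV. of_real (h $ j) * pd j f (x + t *\<^sub>R h))"])
    fix t :: real assume t: "t \<in> {0..1}"
    show "((\<lambda>t. f (x + t *\<^sub>R h)) has_derivative
        (\<lambda>s. s *\<^sub>R (\<Sum>j\<in>UNIV. of_real (h $ j) * pd j f (x + t *\<^sub>R h)))) (at t within {0..1})"
      using has_vector_derivative_line[OF assms(1)[OF t]] by (simp add: has_vector_derivative_def)
    have "norm (\<Sum>j\<in>UNIV. of_real (h $ j) * pd j f (x + t *\<^sub>R h)) \<le> CARD('n) * B * norm h"
      using assms(2)[OF t] by (rule sum_coords_le)
    then show "onorm (\<lambda>s. s *\<^sub>R (\<Sum>j\<in>UNIV. of_real (h $ j) * pd j f (x + t *\<^sub>R h))) \<le> CARD('n) * B * norm h"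
      by (intro onorm_le) (auto simp: mult.commute intro!: mult_left_mono)
  qed auto
  then show ?thesis by simp
qed

text \<open>A mean value estimate is used twice: for each \<open>pd j f\<close>, and for
  \<open>t \<mapsto> f (x + t h) - t L\<close> with \<open>L\<close> the linear term. Each use costs
  a factor \<open>CARD('n)\<close> from the sum over the coordinates of \<open>h\<close>, hence the
  square.\<close>

lemma taylor_bound:
  fixes h :: "real^'n" and B :: real
  assumes f: "smooth f"
    and B: "\<And>t i j. t \<in> {0..1} \<Longrightarrow> norm (pd i (pd j f) (x + t *\<^sub>R h)) \<le> B"
  shows "norm (f (x + h) - f x - (\<Sum>j\<in>UNIV. of_real (h $ j) * pd j f x)) \<le> (CARD('n))\<^sup>2 * B * (norm h)\<^sup>2"
proof -
  have B0: "0 \<le> B"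
    by (rule order_trans[OF norm_ge_zero B[of 0]]) simp
  define L where "L = (\<Sum>j\<in>UNIV. of_real (h $ j) * pd j f x)"
  have "norm ((f (x + 1 *\<^sub>R h) - 1 *\<^sub>R L) - (f (x + 0 *\<^sub>R h) - 0 *\<^sub>R L))
      \<le> ((CARD('n))\<^sup>2 * B * (norm h)\<^sup>2) * norm (1 - 0 :: real)"
  proof (rule differentiable_bound[where S = "{0..1}"
        and f' = "\<lambda>t s. s *\<^sub>R ((\<Sum>j\<in>UNIV. of_real (h $ j) * pd j f (x + t *\<^sub>R h)) - L)"])
    fix t :: real assume t: "t \<in> {0..1}"
    have "((\<lambda>t. f (x + t *\<^sub>R h) - t *\<^sub>R L) has_vector_derivative
        ((\<Sum>j\<in>UNIV. of_real (h $ j) * pd j f (x + t *\<^sub>R h)) - L)) (at t within {0..1})"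
      unfolding has_vector_derivative_def
      by (rule has_derivative_eq_rhs[OF has_derivative_diff[OF
            has_vector_derivative_line[OF smooth_differentiable[OF f], unfolded has_vector_derivative_def]
            bounded_linear_imp_has_derivative[OF bounded_linear_scaleR_left]]])
        (simp add: scaleR_diff_right)
    then show "((\<lambda>t. f (x + t *\<^sub>R h) - t *\<^sub>R L) has_derivative
        (\<lambda>s. s *\<^sub>R ((\<Sum>j\<in>UNIV. of_real (h $ j) * pd j f (x + t *\<^sub>R h)) - L))) (at t within {0..1})"
      by (simp add: has_vector_derivative_def)
    have "norm (pd j f (x + t *\<^sub>R h) - pd j f x) \<le> CARD('n) * B * norm h" for j
    proof -
      have "norm (pd j f (x + t *\<^sub>R h) - pd j f x) \<le> CARD('n) * B * norm (t *\<^sub>R h)"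
      proof (rule mean_value_bound)
        fix s :: real and i assume "s \<in> {0..1}"
        then have "s * t \<in> {0..1}" using t by (auto simp: mult_le_one)
        from B[OF this, of i j] show "norm (pd i (pd j f) (x + s *\<^sub>R t *\<^sub>R h)) \<le> B" by simp
      qed (use f in \<open>auto intro: smooth_differentiable smooth_pd\<close>)
      also have "\<dots> \<le> CARD('n) * B * norm h"
        using t B0 by (intro mult_left_mono) (auto simp: mult_left_le_one_le)
      finally show ?thesis .
    qed
    then have "norm (\<Sum>j\<in>UNIV. of_real (h $ j) * (pd j f (x + t *\<^sub>R h) - pd j f x))
        \<le> CARD('n) * (CARD('n) * B * norm h) * norm h"
      by (rule sum_coords_le)
    then have *: "norm ((\<Sum>j\<in>UNIV. of_real (h $ j) * pd j f (x + t *\<^sub>R h)) - L) \<le> (CARD('n))\<^sup>2 * B * (norm h)\<^sup>2"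
      by (simp add: L_def sum_subtractf right_diff_distrib power2_eq_square mult_ac)
    show "onorm (\<lambda>s. s *\<^sub>R ((\<Sum>j\<in>UNIV. of_real (h $ j) * pd j f (x + t *\<^sub>R h)) - L)) \<le> (CARD('n))\<^sup>2 * B * (norm h)\<^sup>2"
      using * by (intro onorm_le) (simp add: mult.commute mult_left_mono)
  qed auto
  then show ?thesis by (simp add: L_def algebra_simps)
qed

text \<open>The common tool for inverse Fourier transforms, \<open>convT\<close> and
  \<open>avg\<close>: for these the remainder on the left is the integral, or the image under
  \<open>u\<close>, of the Taylor remainder of a kernel, which is bounded beforehand. It yields
  differentiability and the value of the derivative at once.\<close>

lemma differentiable_by_quadratic_bound:
  fixes G :: "real^'n \<Rightarrow> complex"
  assumes "\<And>h. norm h \<le> 1 \<Longrightarrow> norm (G (x + h) - G x - (\<Sum>j\<in>UNIV. of_real (h $ j) * g j)) \<le> C * (norm h)\<^sup>2"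
  shows "G differentiable (at x)" "pd j G x = g j"
proof -
  define L where "L = (\<lambda>h::real^'n. \<Sum>j\<in>UNIV. of_real (h $ j) * g j)"
  have bl: "bounded_linear L"
    unfolding L_def
    by (intro bounded_linear_sum bounded_linear_mult_const bounded_linear_compose[OF bounded_linear_of_real]
        bounded_linear_vec_nth)
  have "((\<lambda>h. norm (G (x + h) - G x - L h) / norm h) \<longlongrightarrow> 0) (at 0)"
  proof (rule Lim_null_comparison)
    have "eventually (\<lambda>h::real^'n. h \<in> ball 0 1 - {0}) (at 0)"
      by (rule eventually_at_ball'[of 1 0 UNIV, simplified, THEN eventually_mono]) auto
    then show "eventually (\<lambda>h. norm (norm (G (x + h) - G x - L h) / norm h) \<le> C * norm h) (at 0)"
    proof (rule eventually_mono)
      fix h :: "real^'n" assume "h \<in> ball 0 1 - {0}"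
      then have "norm h \<le> 1" "norm h > 0" by auto
      from assms[OF this(1)] this(2) show "norm (norm (G (x + h) - G x - L h) / norm h) \<le> C * norm h"
        by (simp add: L_def divide_le_eq power2_eq_square mult_ac)
    qed
    show "((\<lambda>h::real^'n. C * norm h) \<longlongrightarrow> 0) (at 0)"
      by (auto intro!: tendsto_eq_intros)
  qed
  then have D: "(G has_derivative L) (at x)"
    using bl by (simp add: has_derivative_at)
  then show "G differentiable (at x)" by (auto simp: differentiable_def)
  have "L (axis j 1) = (\<Sum>i\<in>UNIV. if i = j then g i else 0)"
    unfolding L_def by (rule sum.cong) (auto simp: axis_def)
  with pd_eqI[OF D, of j] show "pd j G x = g j"
    by simp
qed

section \<open>Schwartz functions and bump functions\<close>

lemma schwartz_iff:
  "w \<in> schwartz \<longleftrightarrow> smooth w \<and> (\<forall>js N. \<exists>C. \<forall>x. norm (partials js w x) \<le> C / (1 + norm x) ^ N)"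
proof -
  have "bounded (range (\<lambda>x. (1 + norm x) ^ N *\<^sub>R partials js w x)) \<longleftrightarrow>
      (\<exists>C. \<forall>x. norm (partials js w x) \<le> C / (1 + norm x) ^ N)" for js N
  proof -
    have "norm ((1 + norm x) ^ N *\<^sub>R partials js w x) \<le> C \<longleftrightarrow> norm (partials js w x) \<le> C / (1 + norm x) ^ N"
      for x C
      by (simp add: pos_le_divide_eq mult.commute abs_of_nonneg add_pos_nonneg)
    then show ?thesis by (auto simp: bounded_iff)
  qed
  then show ?thesis by (auto simp: schwartz_def)
qed

lemma schwartz_smooth: "w \<in> schwartz \<Longrightarrow> smooth w"
  by (simp add: schwartz_iff)

lemma finite_lists_le: "finite {js :: 'n::finite list. length js \<le> L}"
  using finite_lists_length_le[of "UNIV :: 'n set" L] by simp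

lemma schwartz_bound:
  assumes "w \<in> schwartz"
  obtains C where "0 < C" "\<And>js x. length js \<le> L \<Longrightarrow> norm (partials js w x) \<le> C / (1 + norm x) ^ N"
proof -
  have "\<forall>js. \<exists>C. \<forall>x. norm (partials js w x) \<le> C / (1 + norm x) ^ N"
    using assms by (simp add: schwartz_iff)
  then obtain C where C: "\<And>js x. norm (partials js w x) \<le> C js / (1 + norm x) ^ N"
    by metis
  \<comment> \<open>Only finitely many lists have length at most \<open>L\<close>, so the sum gives
    one constant for all of them; the summand 1 makes it positive.\<close>
  define D where "D = 1 + (\<Sum>js | length js \<le> L. \<bar>C js\<bar>)"
  have "norm (partials js w x) \<le> D / (1 + norm x) ^ N" if "length js \<le> L" for js x
  proof -
    have "\<bar>C js\<bar> \<le> (\<Sum>js | length js \<le> L. \<bar>C js\<bar>)"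
      using that by (intro member_le_sum) (auto simp: finite_lists_le)
    then have "C js \<le> D" by (simp add: D_def)
    then show ?thesis
      using C[of js x] by (meson order_trans divide_right_mono norm_ge_zero add_nonneg_nonneg zero_le_one zero_le_power)
  qed
  moreover have "0 < D" unfolding D_def by (intro add_pos_nonneg sum_nonneg) auto
  ultimately show ?thesis using that by blast
qed

text \<open>The smooth multipliers of the Schwartz space, often written O_M. The growth exponent may
  depend on the derivative.\<close>

definition slow_growth :: "(real^'n \<Rightarrow> complex) \<Rightarrow> bool" where
  "slow_growth P \<longleftrightarrow> smooth P \<and> (\<forall>js. \<exists>C m. \<forall>x. norm (partials js P x) \<le> C * (1 + norm x) ^ m)"

lemma slow_growth_bound:
  assumes "slow_growth P"
  obtains C m where "0 < C" "\<And>js x. length js \<le> L \<Longrightarrow> norm (partials js P x) \<le> C * (1 + norm x) ^ m"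
proof -
  have "\<forall>js. \<exists>C m. \<forall>x. norm (partials js P x) \<le> C * (1 + norm x) ^ m"
    using assms by (simp add: slow_growth_def)
  then obtain C m where C: "\<And>js x. norm (partials js P x) \<le> C js * (1 + norm x) ^ m js"
    by metis
  define D where "D = 1 + (\<Sum>js | length js \<le> L. \<bar>C js\<bar>)"
  define k where "k = (\<Sum>js | length js \<le> L. m js)"
  have "norm (partials js P x) \<le> D * (1 + norm x) ^ k" if "length js \<le> L" for js x
  proof -
    have "\<bar>C js\<bar> \<le> (\<Sum>js | length js \<le> L. \<bar>C js\<bar>)"
      using that by (intro member_le_sum) (auto simp: finite_lists_le)
    moreover have "m js \<le> k"
      using that unfolding k_def by (intro member_le_sum) (auto simp: finite_lists_le)
    ultimately have "C js * (1 + norm x) ^ m js \<le> D * (1 + norm x) ^ k"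
      by (intro mult_mono power_increasing) (auto simp: D_def)
    with C[of js x] show ?thesis by linarith
  qed
  moreover have "0 < D" unfolding D_def by (intro add_pos_nonneg sum_nonneg) auto
  ultimately show ?thesis using that by blast
qed

lemma schwartz_slow_growth: "w \<in> schwartz \<Longrightarrow> slow_growth w"
  unfolding slow_growth_def schwartz_iff
  by (metis (no_types) div_by_1 mult.right_neutral power_0)

lemma schwartz_mult:
  fixes P w :: "real^'n \<Rightarrow> complex"
  assumes P: "slow_growth P" and w: "w \<in> schwartz"
  shows "(\<lambda>x. P x * w x) \<in> schwartz"
  unfolding schwartz_iff
proof (intro conjI allI)
  fix js :: "'n list" and N
  have sm: "smooth P" "smooth w" using P w by (auto simp: slow_growth_def schwartz_iff)
  then show "smooth (\<lambda>x. P x * w x)" by (rule smooth_mult)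
  obtain A m where A: "0 < A" "\<And>ks x. length ks \<le> length js \<Longrightarrow> norm (partials ks P x) \<le> A * (1 + norm x) ^ m"
    using slow_growth_bound[OF P] by metis
  \<comment> \<open>Of the \<open>m + N\<close> powers of decay, \<open>m\<close> compensate the
    growth of \<open>P\<close>.\<close>
  obtain B where B: "0 < B" "\<And>ks x. length ks \<le> length js \<Longrightarrow> norm (partials ks w x) \<le> B / (1 + norm x) ^ (m + N)"
    using schwartz_bound[OF w] by metis
  have "norm (partials js (\<lambda>x. P x * w x) x) \<le> (2 ^ length js * (A * B)) / (1 + norm x) ^ N" for x
  proof -
    have "norm (partials js (\<lambda>x. P x * w x) x)
        \<le> 2 ^ length js * ((A * (1 + norm x) ^ m) * (B / (1 + norm x) ^ (m + N)))"
      using A B sm by (intro norm_partials_mult_le) auto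
    also have "\<dots> = (2 ^ length js * (A * B)) / (1 + norm x) ^ N"
    proof -
      have "1 + norm x > 0" by (simp add: add_pos_nonneg)
      then show ?thesis by (simp add: power_add field_simps)
    qed
    finally show ?thesis .
  qed
  then show "\<exists>C. \<forall>x. norm (partials js (\<lambda>x. P x * w x) x) \<le> C / (1 + norm x) ^ N" by blast
qed

lemma slow_growth_const: "slow_growth (\<lambda>x::real^'n. c)"
  unfolding slow_growth_def
proof (intro conjI allI)
  fix js :: "'n::finite list"
  have "\<forall>x. norm (partials js (\<lambda>x::real^'n. c) x) \<le> norm c * (1 + norm x) ^ 0"
    by (simp add: partials_const)
  then show "\<exists>C m. \<forall>x. norm (partials js (\<lambda>x::real^'n. c) x) \<le> C * (1 + norm x) ^ m" by blast
qed (rule smooth_const)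

lemma slow_growth_coord: "slow_growth (\<lambda>x::real^'n. complex_of_real (x $ i))"
  unfolding slow_growth_def
proof (intro conjI allI)
  fix js :: "'n::finite list"
  have "\<forall>x. norm (partials js (\<lambda>x. complex_of_real (x $ i)) x) \<le> 1 * (1 + norm x) ^ 1"
  proof (cases js rule: rev_cases)
    case Nil
    then show ?thesis
      by (auto intro: order_trans[OF component_le_norm_cart])
  next
    case (snoc ks j)
    then show ?thesis
      by (auto simp: partials_snoc pd_coord partials_const)
  qed
  then show "\<exists>C m. \<forall>x. norm (partials js (\<lambda>x. complex_of_real (x $ i)) x) \<le> C * (1 + norm x) ^ m" by blast
qed (rule smooth_coord)

lemma schwartz_cmult: "w \<in> schwartz \<Longrightarrow> (\<lambda>x. c * w x) \<in> schwartz"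
  by (rule schwartz_mult[OF slow_growth_const])

lemma schwartz_add:
  assumes "v \<in> schwartz" "w \<in> schwartz"
  shows "(\<lambda>x. v x + w x) \<in> schwartz"
  unfolding schwartz_iff
proof (intro conjI allI)
  have sm: "smooth v" "smooth w" using assms by (auto simp: schwartz_iff)
  then show "smooth (\<lambda>x. v x + w x)" by (rule smooth_add)
  fix js N
  obtain A B where "\<And>x. norm (partials js v x) \<le> A / (1 + norm x) ^ N"
      "\<And>x. norm (partials js w x) \<le> B / (1 + norm x) ^ N"
    using assms by (meson schwartz_iff)
  then have "norm (partials js (\<lambda>x. v x + w x) x) \<le> (A + B) / (1 + norm x) ^ N" for x
    by (simp add: partials_add sm add_divide_distrib norm_triangle_mono)
  then show "\<exists>C. \<forall>x. norm (partials js (\<lambda>x. v x + w x) x) \<le> C / (1 + norm x) ^ N" by blast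
qed

lemma schwartz_diff: "v \<in> schwartz \<Longrightarrow> w \<in> schwartz \<Longrightarrow> (\<lambda>x. v x - w x) \<in> schwartz"
  using schwartz_add[OF _ schwartz_cmult, of v w "-1"] by simp

lemma schwartz_zero: "(\<lambda>x. 0) \<in> schwartz"
  unfolding schwartz_iff by (auto simp: smooth_const partials_const intro!: exI[of _ 0])

lemma schwartz_sum: "(\<And>i. i \<in> I \<Longrightarrow> f i \<in> schwartz) \<Longrightarrow> (\<lambda>x. \<Sum>i\<in>I. f i x) \<in> schwartz"
  by (induction I rule: infinite_finite_induct) (auto intro: schwartz_zero schwartz_add)

lemma schwartz_partials: "w \<in> schwartz \<Longrightarrow> partials js w \<in> schwartz"
  unfolding schwartz_iff by (metis partials_append smooth_partials)

lemma schwartz_pd: "w \<in> schwartz \<Longrightarrow> pd j w \<in> schwartz"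
  using schwartz_partials[of w "[j]"] by simp

lemma divide_le_scaled:
  fixes a b c e :: real
  assumes "0 < a" "0 < b" "0 \<le> c" "a \<le> e * b"
  shows "c / b \<le> c * e / a"
  using mult_left_mono[OF assms(4,3)] assms(1,2) by (simp add: field_simps)

lemma norm_dil_le: "norm (dil c x) \<le> (\<Sum>j\<in>UNIV. \<bar>c $ j\<bar>) * norm x"
proof -
  have "norm (dil c x) \<le> (\<Sum>j\<in>UNIV. \<bar>dil c x $ j\<bar>)" by (rule norm_le_l1_cart)
  also have "\<dots> \<le> (\<Sum>j\<in>UNIV. \<bar>c $ j\<bar> * norm x)"
    by (intro sum_mono) (auto simp: abs_mult intro!: mult_left_mono component_le_norm_cart)
  finally show ?thesis by (simp add: sum_distrib_right)
qed

lemma schwartz_affine: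
  assumes w: "w \<in> schwartz" and c: "\<And>j. c $ j \<noteq> 0"
  shows "(\<lambda>y. w (z + dil c y)) \<in> schwartz"
  unfolding schwartz_iff
proof (intro conjI allI)
  have sm: "smooth w" using w by (rule schwartz_smooth)
  then show "smooth (\<lambda>y. w (z + dil c y))" by (rule smooth_affine)
  fix js N
  obtain C where C: "0 < C" "\<And>x. norm (partials js w x) \<le> C / (1 + norm x) ^ N"
    using schwartz_bound[OF w, of "length js" N] by (metis order_refl)
  define K where "K = (\<Sum>j\<in>UNIV. \<bar>inverse (c $ j)\<bar>)"
  define c' where "c' = (\<chi> j. inverse (c $ j))"
  have K0: "0 \<le> K" by (auto simp: K_def intro: sum_nonneg)
  \<comment> \<open>Chosen so that \<open>1 + norm y \<le> E * (1 + norm (z + dil c y))\<close>: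
    \<open>K\<close> bounds the inverse dilation, and \<open>1 + norm z\<close> pays for the
    offset.\<close>
  define E where "E = (1 + K) * (1 + norm z)"
  have E0: "0 < E" using K0 by (auto simp: E_def intro!: mult_pos_pos add_pos_nonneg)
  have le: "1 + norm y \<le> E * (1 + norm (z + dil c y))" for y
  proof -
    have "y = dil c' (dil c y)" using c by (simp add: vec_eq_iff c'_def)
    then have "norm y \<le> K * norm (dil c y)"
      using norm_dil_le[of c' "dil c y"] by (simp add: K_def c'_def)
    also have "\<dots> \<le> K * (norm (z + dil c y) + norm z)"
      using norm_triangle_ineq4[of "z + dil c y" z] K0 by (intro mult_left_mono) auto
    finally have "norm y \<le> K * (norm (z + dil c y) + norm z)" .
    moreover have "E * (1 + norm (z + dil c y)) - (1 + K * (norm (z + dil c y) + norm z)) =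
        K + norm z + norm (z + dil c y) + norm z * norm (z + dil c y) + K * norm z * norm (z + dil c y)"
      by (simp add: E_def algebra_simps)
    moreover have "\<dots> \<ge> 0" using K0 by simp
    ultimately show ?thesis by linarith
  qed
  define D where "D = \<bar>prod_list (map (($) c) js)\<bar>"
  have "norm (partials js (\<lambda>y. w (z + dil c y)) y) \<le> (D * C * E ^ N) / (1 + norm y) ^ N" for y
  proof -
    have "norm (partials js (\<lambda>y. w (z + dil c y)) y) \<le> D * (C / (1 + norm (z + dil c y)) ^ N)"
      unfolding partials_affine[OF sm] norm_mult norm_of_real D_def
      by (intro mult_left_mono C) auto
    also have "C / (1 + norm (z + dil c y)) ^ N \<le> C * E ^ N / (1 + norm y) ^ N"
    proof (rule divide_le_scaled)
      show "(1 + norm y) ^ N \<le> E ^ N * (1 + norm (z + dil c y)) ^ N"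
        unfolding power_mult_distrib[symmetric] by (rule power_mono[OF le]) (simp add: add_nonneg_nonneg)
      show "0 \<le> C" using C(1) by simp
    qed (simp_all add: zero_less_power add_pos_nonneg)

    finally show ?thesis by (simp add: D_def mult_left_mono mult.assoc)
  qed
  then show "\<exists>C. \<forall>y. norm (partials js (\<lambda>y. w (z + dil c y)) y) \<le> C / (1 + norm y) ^ N" by blast
qed

lemma schwartz_reflect: "w \<in> schwartz \<Longrightarrow> (\<lambda>y. w (z - y)) \<in> schwartz"
  using schwartz_affine[of w "- 1" z] by (simp add: dil_uminus_one)

lemma schwartz_translate: "w \<in> schwartz \<Longrightarrow> (\<lambda>y. w (z + y)) \<in> schwartz"
  using schwartz_affine[of w 1 z] by (simp add: dil_def)

lemma partials_eq_zero_outside_support: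
  assumes "x \<notin> closure {x. f x \<noteq> 0}"
  shows "partials js f x = 0"
  using assms
proof (induction js arbitrary: x)
  case Nil
  then show ?case using closure_subset[of "{x. f x \<noteq> 0}"] by auto
next
  case (Cons j js)
  have "(partials js f has_derivative (\<lambda>h. 0)) (at x)"
  proof (rule has_derivative_transform_within_open)
    show "((\<lambda>x. 0) has_derivative (\<lambda>h. 0)) (at x)" by simp
    show "open (- closure {x. f x \<noteq> 0})" by auto
  qed (use Cons in auto)
  then show ?case by (simp add: pd_eqI)
qed

lemma test_functions_schwartz: "\<phi> \<in> test_functions \<Longrightarrow> \<phi> \<in> schwartz"
  unfolding schwartz_iff
proof (intro conjI allI)
  assume \<phi>: "\<phi> \<in> test_functions"
  then show sm: "smooth \<phi>" by (simp add: test_functions_def)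
  fix js N
  define K where "K = closure {x. \<phi> x \<noteq> 0}"
  have K: "compact K" using \<phi> by (simp add: test_functions_def K_def)
  have "compact ((\<lambda>x. (1 + norm x) ^ N *\<^sub>R partials js \<phi> x) ` K)"
    by (intro compact_continuous_image K continuous_intros smooth_continuous_on smooth_partials sm)
  then obtain C where C: "\<And>x. x \<in> K \<Longrightarrow> norm ((1 + norm x) ^ N *\<^sub>R partials js \<phi> x) \<le> C"
    by (meson bounded_iff compact_imp_bounded imageI)
  have "norm (partials js \<phi> x) \<le> \<bar>C\<bar> / (1 + norm x) ^ N" for x
  proof (cases "x \<in> K")
    case True
    with C[of x] show ?thesis
      by (simp add: pos_le_divide_eq mult.commute abs_of_nonneg add_pos_nonneg)
  next
    case False
    then show ?thesis by (simp add: partials_eq_zero_outside_support K_def)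
  qed
  then show "\<exists>C. \<forall>x. norm (partials js \<phi> x) \<le> C / (1 + norm x) ^ N" by blast
qed

lemma test_functions_mult:
  assumes "smooth P" "\<phi> \<in> test_functions"
  shows "(\<lambda>x. P x * \<phi> x) \<in> test_functions"
proof -
  have "closure {x. P x * \<phi> x \<noteq> 0} \<subseteq> closure {x. \<phi> x \<noteq> 0}"
    by (intro closure_mono) auto
  moreover have "compact (closure {x. \<phi> x \<noteq> 0} \<inter> closure {x. P x * \<phi> x \<noteq> 0})"
    using assms by (intro compact_Int_closed) (simp_all add: test_functions_def)
  ultimately have "compact (closure {x. P x * \<phi> x \<noteq> 0})"
    by (simp only: inf_absorb2)
  then show ?thesis
    using assms by (simp add: test_functions_def smooth_mult)
qed

lemma test_functionsI:
  assumes "smooth \<phi>" "\<And>x. norm x > R \<Longrightarrow> \<phi> x = 0"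
  shows "\<phi> \<in> test_functions"
proof -
  have "{x. \<phi> x \<noteq> 0} \<subseteq> cball 0 R"
    using assms(2) by (auto simp: not_less[symmetric])
  then have "closure {x. \<phi> x \<noteq> 0} \<subseteq> cball 0 R" by (simp add: closure_minimal)
  then show ?thesis
    using assms(1) bounded_subset[OF bounded_cball]
    by (auto simp: test_functions_def compact_eq_bounded_closed)
qed

section \<open>Smooth plateau functions\<close>

definition flat :: "nat \<Rightarrow> real \<Rightarrow> real" where
  "flat m t = (if t \<le> 0 then 0 else exp (- 1 / t) / t ^ m)"

text \<open>The functions \<open>exp (- 1 / t) / t ^ m\<close>, extended by 0, form a family closed
  under differentiation up to linear combinations. This turns the smoothness of all of them into a
  single induction on the order.\<close>

lemma flat_has_derivative:
  "(flat m has_real_derivative (flat (m + 2) t - real m * flat (m + 1) t)) (at t)"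
proof (cases t "0 :: real" rule: linorder_cases)
  case less
  have "(flat m has_real_derivative 0) (at t)"
    by (rule has_field_derivative_transform_within_open[where f = "\<lambda>_. 0" and S = "{..<0}"])
       (use less in \<open>auto simp: flat_def\<close>)
  with less show ?thesis by (simp add: flat_def)
next
  case greater
  have "((\<lambda>t. exp (- 1 / t) / t ^ m) has_real_derivative (flat (m + 2) t - real m * flat (m + 1) t)) (at t)"
  proof (cases m)
    case 0
    with greater show ?thesis
      by (auto intro!: derivative_eq_intros simp: flat_def power2_eq_square field_simps)
  next
    case (Suc k)
    moreover have "k \<noteq> 0 \<Longrightarrow> t * t ^ (k - Suc 0) = t ^ k" by (cases k) auto
    ultimately show ?thesis using greater
      by (cases "k = 0") (auto intro!: derivative_eq_intros simp: flat_def power2_eq_square field_simps)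
  qed
  then show ?thesis
    by (rule has_field_derivative_transform_within_open[where S = "{0<..}"])
       (use greater in \<open>auto simp: flat_def\<close>)
next
  case equal
  have "((\<lambda>t. flat m t / t) \<longlongrightarrow> 0) (at_left 0)"
  proof (rule tendsto_eventually)
    show "\<forall>\<^sub>F t in at_left 0. flat m t / t = 0"
      by (auto simp: flat_def eventually_at_left_field intro!: exI[of _ "-1"])
  qed
  \<comment> \<open>From the right, \<open>s = inverse t\<close> turns the difference quotient at 0
    into \<open>s ^ (m + 1) / exp s\<close>, which tends to 0 at infinity.\<close>
  moreover have "((\<lambda>t. flat m t / t) \<longlongrightarrow> 0) (at_right 0)"
  proof -
    have "((\<lambda>t. (inverse t) ^ (m + 1) / exp (inverse t)) \<longlongrightarrow> 0) (at_right (0::real))"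
      by (rule filterlim_compose[OF tendsto_power_div_exp_0 filterlim_inverse_at_top_right])
    moreover have "\<forall>\<^sub>F t in at_right (0::real). (inverse t) ^ (m + 1) / exp (inverse t) = flat m t / t"
      by (auto simp: flat_def eventually_at_right_field exp_minus divide_simps power_inverse intro!: exI[of _ 1])
    ultimately show ?thesis by (rule Lim_transform_eventually)
  qed
  ultimately have "((\<lambda>t. flat m t / t) \<longlongrightarrow> 0) (at 0)"
    by (simp add: filterlim_split_at_real)
  then show ?thesis using equal by (simp add: DERIV_def flat_def)
qed

text \<open>Each derivative is a combination of two members of the same family times a coordinate,
  so the induction on the order runs over all \<open>m\<close> simultaneously. The choices of
  \<open>a\<close> and \<open>b\<close> produce functions supported inside a ball as well as outside
  one.\<close>

lemma smooth_flat_quadratic: "smooth (\<lambda>x::real^'n. complex_of_real (flat m (a * (x \<bullet> x) + b)))"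
proof -
  let ?g = "\<lambda>m (x::real^'n). complex_of_real (flat m (a * (x \<bullet> x) + b))"
  have D: "(?g m has_derivative (\<lambda>h. of_real ((flat (m + 2) (a * (x \<bullet> x) + b) - real m * flat (m + 1) (a * (x \<bullet> x) + b))
      * (a * (2 * (x \<bullet> h)))))) (at x)" for m x
  proof -
    have "((\<lambda>x. a * (x \<bullet> x) + b) has_derivative (\<lambda>h. a * (2 * (x \<bullet> h)))) (at x)"
      by (auto intro!: derivative_eq_intros simp: inner_commute)
    from diff_chain_at[OF this flat_has_derivative[unfolded has_field_derivative_def]]
    have "((\<lambda>x. flat m (a * (x \<bullet> x) + b)) has_derivative
       (\<lambda>h. (flat (m + 2) (a * (x \<bullet> x) + b) - real m * flat (m + 1) (a * (x \<bullet> x) + b)) * (a * (2 * (x \<bullet> h))))) (at x)"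
      by (simp add: o_def)
    from has_derivative_of_real[OF this] show ?thesis by simp
  qed
  have pd: "pd j (?g m) = (\<lambda>x. (?g (m + 2) x + (- of_nat m) * ?g (m + 1) x) * (of_real (2 * a) * of_real (x $ j)))" for j m
    by (rule ext, subst pd_eqI[OF D]) (simp add: inner_axis algebra_simps)
  have "diffble n (?g m)" for n m
  proof (induction n arbitrary: m)
    case (Suc n)
    have "?g m differentiable (at x)" for x
      using D differentiable_def by blast
    moreover have "diffble n (\<lambda>x::real^'n. complex_of_real (x $ j))" for j
      using smooth_coord[of j] by (simp add: smooth_iff_diffble)
    then have "diffble n (pd j (?g m))" for j
      unfolding pd by (intro diffble_mult diffble_add diffble_const Suc)
    ultimately show ?case by simp
  qed auto
  then show ?thesis by (simp add: smooth_iff_diffble)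
qed

text \<open>The derivative is again composed of the inverse and a derivative of \<open>q\<close>, so
  the order of differentiability rises by one at each step.\<close>

lemma smooth_inverse:
  assumes "smooth q" "\<And>x. q x \<noteq> 0"
  shows "smooth (\<lambda>x. inverse (q x))"
proof -
  have D: "((\<lambda>x. inverse (q x)) has_derivative
      (\<lambda>h. - (inverse (q x) * frechet_derivative q (at x) h * inverse (q x)))) (at x)" for x
    using assms by (intro Deriv.has_derivative_inverse differentiable_has_derivative smooth_differentiable) auto
  have pd: "pd j (\<lambda>x. inverse (q x)) = (\<lambda>x. (-1) * (inverse (q x) * pd j q x * inverse (q x)))" for j
    by (rule ext, subst pd_eqI[OF D]) (simp add: pd_def)
  have "diffble n (\<lambda>x. inverse (q x))" for n
  proof (induction n)
    case (Suc n)
    have "(\<lambda>x. inverse (q x)) differentiable (at x)" for x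
      using D differentiable_def by blast
    moreover have "diffble n (pd j q)" for j
      using smooth_pd[OF assms(1)] by (simp add: smooth_iff_diffble)
    then have "diffble n (pd j (\<lambda>x. inverse (q x)))" for j
      unfolding pd by (intro diffble_mult diffble_const Suc)
    ultimately show ?case by simp
  qed auto
  then show ?thesis by (simp add: smooth_iff_diffble)
qed

text \<open>The usual quotient for a plateau: 1 on the unit ball and 0 beyond radius 2. The
  denominator cannot vanish because, for \<open>s = x \<bullet> x\<close>, the numbers
  \<open>4 - s\<close> and \<open>s - 1\<close> are never both nonpositive. The real version is kept
  because its bounds 0 and 1 are used later.\<close>

definition bump_profile :: "real^'n \<Rightarrow> real" where
  "bump_profile x = flat 0 (4 - x \<bullet> x) / (flat 0 (4 - x \<bullet> x) + flat 0 (x \<bullet> x - 1))"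

definition bump :: "real^'n \<Rightarrow> complex" where
  "bump x = of_real (bump_profile x)"

lemma flat_pos: "t > 0 \<Longrightarrow> flat m t > 0"
  and flat_nonneg: "flat m t \<ge> 0"
  by (auto simp: flat_def)

lemma bump_denominator_pos: "flat 0 (4 - t) + flat 0 (t - 1) > 0"
proof (cases "t < 4")
  case True
  then show ?thesis by (intro add_pos_nonneg flat_pos flat_nonneg) auto
next
  case False
  then show ?thesis by (intro add_nonneg_pos flat_pos flat_nonneg) auto
qed

lemma bump_profile_bounds: "0 \<le> bump_profile x" "bump_profile x \<le> 1"
  using flat_nonneg[of 0 "4 - x \<bullet> x"] flat_nonneg[of 0 "x \<bullet> x - 1"] bump_denominator_pos[of "x \<bullet> x"]
  by (auto simp: bump_profile_def)

lemma bump_eq_1: "norm x \<le> 1 \<Longrightarrow> bump x = 1"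
  using bump_denominator_pos[of "x \<bullet> x"]
  by (auto simp: bump_def bump_profile_def dot_square_norm flat_def power_le_one)

lemma bump_eq_0:
  assumes "norm x \<ge> 2" shows "bump x = 0"
proof -
  have "x \<bullet> x \<ge> 4" using power_mono[OF assms, of 2] by (simp add: dot_square_norm)
  then show ?thesis by (simp add: bump_def bump_profile_def flat_def)
qed

lemma smooth_bump: "smooth bump"
proof -
  let ?p = "\<lambda>x::real^'a. complex_of_real (flat 0 (4 - x \<bullet> x))"
  let ?q = "\<lambda>x::real^'a. complex_of_real (flat 0 (x \<bullet> x - 1))"
  have p: "smooth ?p" using smooth_flat_quadratic[of 0 "-1" 4] by simp
  have q: "smooth ?q" using smooth_flat_quadratic[of 0 1 "-1"] by simp
  have "?p x + ?q x \<noteq> 0" for x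
    using bump_denominator_pos[of "x \<bullet> x"] by (metis of_real_add of_real_eq_0_iff less_irrefl)
  then have "smooth (\<lambda>x. ?p x * inverse (?p x + ?q x))"
    by (intro smooth_mult smooth_inverse smooth_add p q)
  then show ?thesis by (simp add: bump_def[abs_def] bump_profile_def divide_inverse)
qed

lemma bump_test_function: "bump \<in> test_functions"
  by (rule test_functionsI[of _ 2]) (auto intro: smooth_bump bump_eq_0)

section \<open>Integration and the inverse Fourier transform\<close>

lemma one_plus_norm_power_pos [simp]: "0 < (1 + norm x) ^ N"
  by (simp add: zero_less_power add_pos_nonneg)

text \<open>The exponent is two for each coordinate: \<open>(1 + norm x)\<^sup>2\<close> dominates
  every \<open>1 + (x \<bullet> b)\<^sup>2\<close>, so the function lies below a product of the
  one-dimensional functions \<open>1 / (1 + t\<^sup>2)\<close>, each of finite integral.\<close>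

lemma integrable_decay:
  "integrable lborel (\<lambda>x::real^'n. 1 / (1 + norm x) ^ (2 * CARD('n)))"
proof (rule Bochner_Integration.integrable_bound)
  let ?f = "\<lambda>t::real. inverse (1 + t\<^sup>2)"
  have 1: "integrable lborel ?f"
    using integrable_inverse_1_plus_square by (simp add: set_integrable_def einterval_def)
  then have fin: "(\<integral>\<^sup>+t. ?f t \<partial>lborel) < \<infinity>"
    by (simp add: integrable_iff_bounded)
  show "integrable lborel (\<lambda>x::real^'n. \<Prod>b\<in>Basis. ?f (x \<bullet> b))"
    unfolding integrable_iff_bounded
  proof
    have "(\<integral>\<^sup>+x. ennreal (norm (\<Prod>b\<in>Basis. ?f ((x::real^'n) \<bullet> b))) \<partial>lborel)
        = (\<integral>\<^sup>+x. (\<Prod>b\<in>Basis. ennreal (?f ((x::real^'n) \<bullet> b))) \<partial>lborel)"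
      by (simp add: prod_nonneg prod_ennreal)
    also have "\<dots> = (\<Prod>b\<in>(Basis::(real^'n) set). (\<integral>\<^sup>+t. ?f t \<partial>lborel))"
      by (rule nn_integral_lborel_prod[where f = "\<lambda>_ t. ennreal (?f t)"]) auto
    also have "\<dots> < \<infinity>"
      using fin by (simp add: less_top[symmetric] ennreal_prod_eq_top power_eq_top_ennreal)
    finally show "(\<integral>\<^sup>+x. ennreal (norm (\<Prod>b\<in>Basis. ?f ((x::real^'n) \<bullet> b))) \<partial>lborel) < \<infinity>" .
  qed measurable
  show "AE x::real^'n in lborel. norm (1 / (1 + norm x) ^ (2 * CARD('n))) \<le> norm (\<Prod>b\<in>Basis. ?f (x \<bullet> b))"
  proof (intro AE_I2)
    fix x :: "real^'n"
    have "(\<Prod>b\<in>(Basis::(real^'n) set). inverse ((1 + norm x)\<^sup>2)) \<le> (\<Prod>b\<in>Basis. ?f (x \<bullet> b))"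
    proof (rule prod_mono, intro conjI)
      fix b :: "real^'n" assume "b \<in> Basis"
      then have "\<bar>x \<bullet> b\<bar> \<le> norm x" by (rule Basis_le_norm)
      then have "(x \<bullet> b)\<^sup>2 \<le> (norm x)\<^sup>2" by (simp add: abs_le_square_iff[symmetric])
      then have "1 + (x \<bullet> b)\<^sup>2 \<le> (1 + norm x)\<^sup>2"
        unfolding power2_sum using norm_ge_zero[of x] by (simp only: power_one mult_1_right)
      then show "inverse ((1 + norm x)\<^sup>2) \<le> ?f (x \<bullet> b)"
        by (intro le_imp_inverse_le) (simp_all add: add_pos_nonneg)
    qed auto
    then show "norm (1 / (1 + norm x) ^ (2 * CARD('n))) \<le> norm (\<Prod>b\<in>Basis. ?f (x \<bullet> b))"
      by (simp add: power_mult power_inverse[symmetric] inverse_eq_divide prod_nonneg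
          abs_of_nonneg power_one_over)
  qed
qed measurable

lemma integrable_of_decay:
  fixes f :: "real^'n \<Rightarrow> complex"
  assumes "f \<in> borel_measurable borel" "\<And>x. norm (f x) \<le> C / (1 + norm x) ^ (2 * CARD('n))"
  shows "integrable lborel f"
proof (rule Bochner_Integration.integrable_bound)
  show "integrable lborel (\<lambda>x::real^'n. C * (1 / (1 + norm x) ^ (2 * CARD('n))))"
    by (intro integrable_mult_right integrable_decay)
  show "AE x in lborel. norm (f x) \<le> norm (C * (1 / (1 + norm x) ^ (2 * CARD('n))))"
    using assms(2) by (intro AE_I2) (metis abs_ge_self mult.right_neutral order_trans real_norm_def times_divide_eq_right)
qed (use assms(1) in simp)

lemma schwartz_borel: "w \<in> schwartz \<Longrightarrow> w \<in> borel_measurable borel"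
  using schwartz_smooth smooth_borel by blast

lemma schwartz_integrable: "w \<in> schwartz \<Longrightarrow> integrable lborel w"
proof -
  assume w: "w \<in> schwartz"
  then obtain C where "\<And>x. norm (partials [] w x) \<le> C / (1 + norm x) ^ (2 * CARD('a))"
    unfolding schwartz_iff by metis
  with schwartz_borel[OF w] show ?thesis
    by (intro integrable_of_decay[of w C]) auto
qed

section \<open>Diagonal changes of variables in Lebesgue integrals\<close>

lemma prod_Basis_cart:
  fixes f :: "real^'n \<Rightarrow> real"
  shows "(\<Prod>b\<in>Basis. f b) = (\<Prod>j\<in>UNIV. f (axis j 1))"
proof -
  have inj: "inj_on (\<lambda>j::'n. axis j (1::real)) UNIV" by (auto simp: inj_on_def axis_eq_axis)
  have B: "(Basis :: (real^'n) set) = (\<lambda>j. axis j 1) ` UNIV" by (auto simp: Basis_vec_def)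
  show ?thesis unfolding B by (subst prod.reindex[OF inj]) (simp add: o_def)
qed

definition jac :: "real^'n \<Rightarrow> real" where
  "jac c = (\<Prod>j\<in>UNIV. \<bar>c $ j\<bar>)"

lemma jac_pos: "(\<And>j. c $ j \<noteq> 0) \<Longrightarrow> 0 < jac c"
  by (auto simp: jac_def intro!: prod_pos)

lemma lborel_dil:
  fixes c z :: "real^'n"
  assumes "\<And>j. c $ j \<noteq> 0"
  shows "lborel = density (distr lborel borel (\<lambda>x. z + dil c x)) (\<lambda>_. ennreal (jac c))"
proof -
  have "dil c x = (\<Sum>b\<in>Basis. ((c \<bullet> b) * (x \<bullet> b)) *\<^sub>R b)" for x
    by (subst euclidean_representation[of "dil c x", symmetric], intro sum.cong refl)
       (auto simp: Basis_vec_def inner_axis)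
  moreover have "c \<bullet> b \<noteq> 0" if "b \<in> Basis" for b
    using that assms by (auto simp: Basis_vec_def inner_axis)
  ultimately show ?thesis
    using lborel_affine_euclidean[of "\<lambda>b. c \<bullet> b" z]
    by (simp add: jac_def prod_Basis_cart inner_axis)
qed

lemma dil_measurable [measurable]: "(\<lambda>x. z + dil c x) \<in> borel_measurable borel"
  by (intro borel_measurable_continuous_onI continuous_intros
      linear_continuous_on[OF bounded_linear_dil])

lemma integral_dil:
  fixes g :: "real^'n \<Rightarrow> complex"
  assumes "\<And>j. c $ j \<noteq> 0" "g \<in> borel_measurable borel"
  shows "(LINT x|lborel. g x) = of_real (jac c) * (LINT x|lborel. g (z + dil c x))"
proof -
  have j: "0 \<le> jac c" using jac_pos[OF assms(1)] by simp
  have "(LINT x|lborel. g x) = (LINT x|density (distr lborel borel (\<lambda>x. z + dil c x)) (\<lambda>_. ennreal (jac c)). g x)"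
    using lborel_dil[OF assms(1), of z] by simp
  also have "\<dots> = (LINT x|distr lborel borel (\<lambda>x. z + dil c x). jac c *\<^sub>R g x)"
    using assms j by (subst integral_density) auto
  also have "\<dots> = (LINT x|lborel. jac c *\<^sub>R g (z + dil c x))"
    using assms by (subst integral_distr) auto
  finally show ?thesis by (simp add: scaleR_conv_of_real)
qed

lemma nn_integral_dil:
  fixes g :: "real^'n \<Rightarrow> ennreal"
  assumes "\<And>j. c $ j \<noteq> 0" "g \<in> borel_measurable borel"
  shows "(\<integral>\<^sup>+x. g x \<partial>lborel) = ennreal (jac c) * (\<integral>\<^sup>+x. g (z + dil c x) \<partial>lborel)"
proof -
  have "(\<integral>\<^sup>+x. g x \<partial>lborel) = (\<integral>\<^sup>+x. g x \<partial>density (distr lborel borel (\<lambda>x. z + dil c x)) (\<lambda>_. ennreal (jac c)))"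
    using lborel_dil[OF assms(1), of z] by simp
  also have "\<dots> = (\<integral>\<^sup>+x. ennreal (jac c) * g (z + dil c x) \<partial>lborel)"
    using assms by (subst nn_integral_density) (auto simp: nn_integral_distr)
  finally show ?thesis using assms by (simp add: nn_integral_cmult)
qed

lemma jac_one [simp]: "jac 1 = 1" "jac (- 1) = 1"
  by (auto simp: jac_def)

lemma dil_one [simp]: "dil 1 x = x"
  by (simp add: vec_eq_iff)

lemma integral_translate:
  "(g :: real^'n \<Rightarrow> complex) \<in> borel_measurable borel \<Longrightarrow> (LINT x|lborel. g (z + x)) = (LINT x|lborel. g x)"
  using integral_dil[of 1 g z] by simp

lemma nn_integral_translate:
  "(g :: real^'n \<Rightarrow> ennreal) \<in> borel_measurable borel \<Longrightarrow> (\<integral>\<^sup>+x. g (x - z) \<partial>lborel) = (\<integral>\<^sup>+x. g x \<partial>lborel)"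
  using nn_integral_dil[of 1 g "- z"] by simp

lemma nn_integral_reflect:
  "(g :: real^'n \<Rightarrow> ennreal) \<in> borel_measurable borel \<Longrightarrow> (\<integral>\<^sup>+x. g (z - x) \<partial>lborel) = (\<integral>\<^sup>+x. g x \<partial>lborel)"
  using nn_integral_dil[of "- 1" g z] by (simp add: dil_uminus_one)

lemma integral_reflect:
  "(g :: real^'n \<Rightarrow> complex) \<in> borel_measurable borel \<Longrightarrow> (LINT x|lborel. g (z - x)) = (LINT x|lborel. g x)"
  using integral_dil[of "- 1" g z] by (simp add: dil_uminus_one)

text \<open>The remainder inherits the decay of the second derivatives at \<open>x + t h\<close>.
  Since \<open>norm h \<le> 1\<close>, that decay is comparable with decay at
  \<open>x\<close>.\<close>

lemma schwartz_taylor: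
  fixes w :: "real^'n \<Rightarrow> complex"
  assumes w: "w \<in> schwartz"
  obtains C where "0 \<le> C" "\<And>x h. norm h \<le> 1 \<Longrightarrow>
    norm (w (x + h) - w x - (\<Sum>j\<in>UNIV. of_real (h $ j) * pd j w x)) \<le> C * (norm h)\<^sup>2 / (1 + norm x) ^ N"
proof -
  obtain B where B: "0 < B" "\<And>js x. length js \<le> 2 \<Longrightarrow> norm (partials js w x) \<le> B / (1 + norm x) ^ N"
    by (rule schwartz_bound[OF w, where L = 2 and N = N]) (rule that)
  have "norm (w (x + h) - w x - (\<Sum>j\<in>UNIV. of_real (h $ j) * pd j w x))
      \<le> ((CARD('n))\<^sup>2 * (B * 2 ^ N)) * (norm h)\<^sup>2 / (1 + norm x) ^ N"
    if h: "norm h \<le> 1" for x h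
  proof -
    have "norm (w (x + h) - w x - (\<Sum>j\<in>UNIV. of_real (h $ j) * pd j w x))
      \<le> (CARD('n))\<^sup>2 * (B * 2 ^ N / (1 + norm x) ^ N) * (norm h)\<^sup>2"
    proof (rule taylor_bound[OF schwartz_smooth[OF w]])
      fix t :: real and i j assume t: "t \<in> {0..1}"
      define A where "A = norm (x + t *\<^sub>R h)"
      have "norm (t *\<^sub>R h) \<le> 1" using t h by (simp add: mult_le_one)
      moreover have "norm x \<le> A + norm (t *\<^sub>R h)"
        using norm_triangle_ineq4[of "x + t *\<^sub>R h" "t *\<^sub>R h"] by (simp add: A_def)
      moreover have "0 \<le> A" by (simp add: A_def)
      \<comment> \<open>The factor 2 here is the origin of \<open>2 ^ N\<close> in the
        constant.\<close>
      ultimately have "1 + norm x \<le> 2 * (1 + A)" by argo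
      then have "(1 + norm x) ^ N \<le> 2 ^ N * (1 + norm (x + t *\<^sub>R h)) ^ N"
        unfolding A_def power_mult_distrib[symmetric] by (rule power_mono) auto
      then have "B / (1 + norm (x + t *\<^sub>R h)) ^ N \<le> B * 2 ^ N / (1 + norm x) ^ N"
        by (rule divide_le_scaled[OF one_plus_norm_power_pos one_plus_norm_power_pos less_imp_le[OF B(1)]])
      then show "norm (pd i (pd j w) (x + t *\<^sub>R h)) \<le> B * 2 ^ N / (1 + norm x) ^ N"
        using B(2)[of "[i, j]" "x + t *\<^sub>R h"] by simp
    qed
    then show ?thesis by (simp add: mult_ac)
  qed
  moreover have "0 \<le> (CARD('n))\<^sup>2 * (B * 2 ^ N)" using B(1) by simp
  ultimately show ?thesis using that by blast
qed

text \<open>Lebesgue measure is translation invariant, so the increment of \<open>w\<close> under a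
  shift by \<open>t\<close> along axis \<open>j\<close> has integral 0. The Taylor remainder then
  shows that \<open>t\<close> times the integral of \<open>pd j w\<close> is of order
  \<open>t\<^sup>2\<close>; division by \<open>t\<close> and \<open>t \<rightarrow> 0\<close> finish
  the argument.\<close>

lemma integral_pd_schwartz:
  fixes w :: "real^'n \<Rightarrow> complex"
  assumes w: "w \<in> schwartz"
  shows "(LINT x|lborel. pd j w x) = 0"
proof -
  let ?L = "2 * CARD('n)"
  let ?D = "\<lambda>x::real^'n. 1 / (1 + norm x) ^ ?L"
  define I where "I = (LINT x|lborel. pd j w x)"
  obtain C where C: "0 \<le> C" "\<And>x h. norm h \<le> 1 \<Longrightarrow>
    norm (w (x + h) - w x - (\<Sum>j\<in>UNIV. of_real (h $ j) * pd j w x)) \<le> C * (norm h)\<^sup>2 / (1 + norm x) ^ ?L"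
    by (rule schwartz_taylor[OF w, where N = ?L]) (rule that)
  have i1: "integrable lborel w" and i2: "integrable lborel (pd j w)"
    using w by (auto intro: schwartz_integrable schwartz_pd)
  have key: "t * norm I \<le> C * t\<^sup>2 * (LINT x|lborel. ?D x)" if t: "0 < t" "t \<le> 1" for t
  proof -
    define h where "h = axis j t"
    have nh: "norm h = t" using t by (simp add: h_def norm_eq_sqrt_inner inner_axis_axis)
    have "(\<lambda>x. w (h + x)) \<in> schwartz" using w by (rule schwartz_translate)
    then have i3: "integrable lborel (\<lambda>x. w (h + x))" by (rule schwartz_integrable)
    have "(LINT x|lborel. w (h + x) - w x - of_real t * pd j w x) = - of_real t * I"
      using i1 i2 i3 integral_translate[OF schwartz_borel[OF w], of h] by (simp add: I_def)
    then have "t * norm I = norm (LINT x|lborel. w (h + x) - w x - of_real t * pd j w x)"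
      using t by (simp add: norm_mult)
    also have "\<dots> \<le> (LINT x|lborel. C * t\<^sup>2 * ?D x)"
    proof (rule Bochner_Integration.integral_norm_bound_integral)
      show "integrable lborel (\<lambda>x. w (h + x) - w x - of_real t * pd j w x)"
        using i1 i2 i3 by simp
      show "integrable lborel (\<lambda>x::real^'n. C * t\<^sup>2 * ?D x)"
        by (intro integrable_mult_right integrable_decay)
      fix x
      have "(\<Sum>i\<in>UNIV. of_real (h $ i) * pd i w x) = (\<Sum>i\<in>UNIV. if i = j then of_real t * pd i w x else 0)"
        by (rule sum.cong) (auto simp: h_def axis_def)
      with C(2)[of h x] t nh show "norm (w (h + x) - w x - of_real t * pd j w x) \<le> C * t\<^sup>2 * ?D x"
        by (simp add: add.commute)
    qed
    finally show ?thesis by (simp only: integral_mult_right_zero)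
  qed
  have "norm I \<le> C * (LINT x|lborel. ?D x) * t" if "0 < t" "t \<le> 1" for t
    using key[OF that] that by (simp add: power2_eq_square mult_ac)
  moreover have "((\<lambda>t. C * (LINT x|lborel. ?D x) * t) \<longlongrightarrow> C * (LINT x|lborel. ?D x) * 0) (at_right 0)"
    by (intro tendsto_intros)
  ultimately have "norm I \<le> C * (LINT x|lborel. ?D x) * 0"
    by (intro tendsto_lowerbound[where F = "at_right (0::real)"])
       (auto simp: eventually_at_right_field intro!: exI[of _ 1])
  then show ?thesis by (simp add: I_def)
qed

section \<open>Inverse Fourier transforms of Schwartz functions\<close>

definition osc :: "real^'n \<Rightarrow> real^'n \<Rightarrow> complex" where
  "osc x \<xi> = exp (\<i> * complex_of_real (x \<bullet> \<xi>))"

lemma norm_osc [simp]: "norm (osc x \<xi>) = 1"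
  by (simp add: osc_def)

lemma osc_measurable [measurable]:
  assumes "f \<in> borel_measurable M" "g \<in> borel_measurable M"
  shows "(\<lambda>z. osc (f z) (g z)) \<in> borel_measurable M"
  unfolding osc_def using assms by measurable

lemma osc_has_derivative:
  "(osc x has_derivative (\<lambda>h. \<i> * of_real (x \<bullet> h) * osc x \<xi>)) (at \<xi>)"
proof -
  have "((\<lambda>\<xi>. \<i> * complex_of_real (x \<bullet> \<xi>)) has_derivative (\<lambda>h. \<i> * of_real (x \<bullet> h))) (at \<xi>)"
    by (intro has_derivative_mult_right has_derivative_of_real has_derivative_inner_right has_derivative_ident)
  moreover have "(exp has_derivative (\<lambda>y. exp (\<i> * complex_of_real (x \<bullet> \<xi>)) * y)) (at (\<i> * complex_of_real (x \<bullet> \<xi>)))"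
    using DERIV_exp[of "\<i> * complex_of_real (x \<bullet> \<xi>)"] by (simp add: has_field_derivative_def)
  ultimately have "((exp \<circ> (\<lambda>\<xi>. \<i> * complex_of_real (x \<bullet> \<xi>))) has_derivative
     ((\<lambda>y. exp (\<i> * complex_of_real (x \<bullet> \<xi>)) * y) \<circ> (\<lambda>h. \<i> * of_real (x \<bullet> h)))) (at \<xi>)"
    by (rule diff_chain_at)
  moreover have "exp \<circ> (\<lambda>\<xi>. \<i> * complex_of_real (x \<bullet> \<xi>)) = osc x"
    by (auto simp: osc_def)
  ultimately show ?thesis by (simp add: o_def osc_def mult_ac)
qed

lemma pd_osc: "pd j (osc x) = (\<lambda>\<xi>. (\<i> * of_real (x $ j)) * osc x \<xi>)"
  by (rule ext, subst pd_eqI[OF osc_has_derivative]) (simp add: inner_axis)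

lemma smooth_osc: "smooth (osc x)"
proof -
  have "diffble n (osc x)" for n
  proof (induction n)
    case (Suc n)
    have "osc x differentiable (at \<xi>)" for \<xi>
      using osc_has_derivative differentiable_def by blast
    then show ?case by (auto simp: pd_osc intro!: diffble_mult diffble_const Suc)
  qed auto
  then show ?thesis by (simp add: smooth_iff_diffble)
qed

lemma slow_growth_osc: "slow_growth (osc x)"
  unfolding slow_growth_def
proof (intro conjI allI)
  fix js
  have "partials js (osc x) = (\<lambda>\<xi>. prod_list (map (\<lambda>j. \<i> * of_real (x $ j)) js) * osc x \<xi>)"
  proof (induction js)
    case (Cons j js)
    then show ?case
      by (simp only: partials_Cons_pd pd_cmult[OF smooth_osc] pd_osc) (simp add: mult_ac)
  qed simp
  then have "norm (partials js (osc x) \<xi>) \<le> norm (prod_list (map (\<lambda>j. \<i> * of_real (x $ j)) js)) * (1 + norm \<xi>) ^ 0" for \<xi>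
    by (simp add: norm_mult)
  then show "\<exists>C m. \<forall>\<xi>. norm (partials js (osc x) \<xi>) \<le> C * (1 + norm \<xi>) ^ m" by blast
qed (rule smooth_osc)

definition fconst :: "'n::finite itself \<Rightarrow> complex" where
  "fconst _ = complex_of_real (1 / (2 * pi) ^ CARD('n))"

lemma inv_fourier_eq:
  "inv_fourier h (x::real^'n) = fconst TYPE('n) * (LINT \<xi>|lborel. osc x \<xi> * h \<xi>)"
  by (simp add: inv_fourier_def osc_def fconst_def)

lemma osc_schwartz: "h \<in> schwartz \<Longrightarrow> (\<lambda>\<xi>. osc x \<xi> * h \<xi>) \<in> schwartz"
  by (rule schwartz_mult[OF slow_growth_osc])

lemma osc_taylor: "norm (osc (x + k) \<xi> - osc x \<xi> - \<i> * of_real (k \<bullet> \<xi>) * osc x \<xi>) \<le> (norm k * norm \<xi>)\<^sup>2"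
proof -
  let ?t = "k \<bullet> \<xi>"
  have "osc (x + k) \<xi> - osc x \<xi> - \<i> * of_real ?t * osc x \<xi> = osc x \<xi> * (iexp ?t - 1 - \<i> * ?t)"
    by (simp add: osc_def inner_add_left ring_distribs exp_add mult_ac)
  also have "norm \<dots> = norm (iexp ?t - 1 - \<i> * ?t)" by (simp add: norm_mult)
  also have "\<dots> \<le> \<bar>?t\<bar>\<^sup>2"
  proof -
    have "norm (iexp ?t - (\<Sum>k\<le>1. (\<i> * ?t) ^ k / fact k)) \<le> \<bar>?t\<bar> ^ Suc 1 / fact (Suc 1)"
      by (rule iexp_approx1)
    then have "norm (iexp ?t - 1 - \<i> * ?t) \<le> \<bar>?t\<bar>\<^sup>2 / 2"
      by (simp add: diff_diff_eq power2_eq_square)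
    then show ?thesis by (rule order_trans) simp
  qed
  also have "\<dots> \<le> (norm k * norm \<xi>)\<^sup>2"
    by (intro power_mono Cauchy_Schwarz_ineq2) auto
  finally show ?thesis .
qed

lemma inv_fourier_pd:
  fixes h :: "real^'n \<Rightarrow> complex"
  assumes h: "h \<in> schwartz"
  shows "inv_fourier h differentiable (at x)"
    and "pd j (inv_fourier h) x = inv_fourier (\<lambda>\<xi>. \<i> * of_real (\<xi> $ j) * h \<xi>) x"
proof -
  let ?g = "\<lambda>j. inv_fourier (\<lambda>\<xi>. \<i> * of_real (\<xi> $ j) * h \<xi>) x"
  have hj: "(\<lambda>\<xi>. \<i> * of_real (\<xi> $ j) * h \<xi>) \<in> schwartz" for j
    using schwartz_cmult[OF schwartz_mult[OF slow_growth_coord h]] by (simp add: mult.assoc)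
  have int: "integrable lborel (\<lambda>\<xi>. osc x \<xi> * v \<xi>)" if "v \<in> schwartz" for v x
    by (intro schwartz_integrable osc_schwartz that)
  \<comment> \<open>Two powers of decay absorb the factor \<open>(norm \<xi>)\<^sup>2\<close> from
    \<open>osc_taylor\<close>; the other \<open>2 * CARD('n)\<close> leave an integrable
    bound.\<close>
  obtain B where B: "0 < B" "\<And>js x. length js \<le> 0 \<Longrightarrow> norm (partials js h x) \<le> B / (1 + norm x) ^ (2 + 2 * CARD('n))"
    by (rule schwartz_bound[OF h, where L = 0 and N = "2 + 2 * CARD('n)"]) (rule that)
  have B: "norm (h \<xi>) \<le> B / (1 + norm \<xi>) ^ (2 + 2 * CARD('n))" for \<xi>
    using B(2)[of "[]"] by simp
  let ?I = "LINT \<xi>|lborel. (B / (1 + norm (\<xi>::real^'n)) ^ (2 * CARD('n)))"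
  have bound: "norm (inv_fourier h (x + k) - inv_fourier h x - (\<Sum>j\<in>UNIV. of_real (k $ j) * ?g j))
      \<le> (norm (fconst TYPE('n)) * ?I) * (norm k)\<^sup>2" for k
  proof -
    have "(\<Sum>j\<in>UNIV. of_real (k $ j) * ?g j) = fconst TYPE('n) *
        (LINT \<xi>|lborel. (\<Sum>j\<in>UNIV. of_real (k $ j) * (osc x \<xi> * (\<i> * of_real (\<xi> $ j) * h \<xi>))))"
    proof -
      have "(LINT \<xi>|lborel. (\<Sum>j\<in>UNIV. of_real (k $ j) * (osc x \<xi> * (\<i> * of_real (\<xi> $ j) * h \<xi>)))) =
          (\<Sum>j\<in>UNIV. of_real (k $ j) * (LINT \<xi>|lborel. osc x \<xi> * (\<i> * of_real (\<xi> $ j) * h \<xi>)))"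
        by (subst Bochner_Integration.integral_sum) (auto intro!: int[OF hj])
      then show ?thesis
        by (simp only: inv_fourier_eq sum_distrib_left) (simp only: mult_ac)
    qed
    also have "(\<lambda>\<xi>. (\<Sum>j\<in>UNIV. of_real (k $ j) * (osc x \<xi> * (\<i> * of_real (\<xi> $ j) * h \<xi>)))) =
        (\<lambda>\<xi>. \<i> * of_real (k \<bullet> \<xi>) * osc x \<xi> * h \<xi>)"
      by (auto simp: inner_vec_def sum_distrib_left sum_distrib_right mult_ac)
    finally have S: "(\<Sum>j\<in>UNIV. of_real (k $ j) * ?g j) =
        fconst TYPE('n) * (LINT \<xi>|lborel. \<i> * of_real (k \<bullet> \<xi>) * osc x \<xi> * h \<xi>)" .
    have i3: "integrable lborel (\<lambda>\<xi>. \<i> * of_real (k \<bullet> \<xi>) * osc x \<xi> * h \<xi>)"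
    proof -
      have "(\<lambda>\<xi>. \<Sum>j\<in>UNIV. of_real (k $ j) * (\<i> * of_real (\<xi> $ j) * h \<xi>)) \<in> schwartz"
        by (intro schwartz_sum schwartz_cmult hj)
      from int[OF this, of x] show ?thesis
        by (simp add: inner_vec_def sum_distrib_left sum_distrib_right mult_ac)
    qed
    have "inv_fourier h (x + k) - inv_fourier h x - (\<Sum>j\<in>UNIV. of_real (k $ j) * ?g j) =
        fconst TYPE('n) * (LINT \<xi>|lborel. osc (x + k) \<xi> * h \<xi> - osc x \<xi> * h \<xi> - \<i> * of_real (k \<bullet> \<xi>) * osc x \<xi> * h \<xi>)"
      unfolding S using int[OF h] i3 by (simp add: inv_fourier_eq right_diff_distrib)
    also have "norm \<dots> \<le> norm (fconst TYPE('n)) * (LINT \<xi>|lborel. (norm k)\<^sup>2 * (B / (1 + norm (\<xi>::real^'n)) ^ (2 * CARD('n))))"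
      unfolding norm_mult
    proof (intro mult_left_mono Bochner_Integration.integral_norm_bound_integral)
      show "integrable lborel (\<lambda>\<xi>. osc (x + k) \<xi> * h \<xi> - osc x \<xi> * h \<xi> - \<i> * of_real (k \<bullet> \<xi>) * osc x \<xi> * h \<xi>)"
        using int[OF h] i3 by simp
      show "integrable lborel (\<lambda>\<xi>::real^'n. (norm k)\<^sup>2 * (B / (1 + norm \<xi>) ^ (2 * CARD('n))))"
        using integrable_mult_right[OF integrable_decay, of "(norm k)\<^sup>2 * B"] by simp
      fix \<xi> :: "real^'n"
      have "norm (osc (x + k) \<xi> * h \<xi> - osc x \<xi> * h \<xi> - \<i> * of_real (k \<bullet> \<xi>) * osc x \<xi> * h \<xi>) =
          norm (osc (x + k) \<xi> - osc x \<xi> - \<i> * of_real (k \<bullet> \<xi>) * osc x \<xi>) * norm (h \<xi>)"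
        by (simp add: norm_mult[symmetric] left_diff_distrib)
      also have "\<dots> \<le> (norm k * norm \<xi>)\<^sup>2 * (B / (1 + norm \<xi>) ^ (2 + 2 * CARD('n)))"
        by (intro mult_mono osc_taylor B) auto
      also have "\<dots> \<le> (norm k * (1 + norm \<xi>))\<^sup>2 * (B / (1 + norm \<xi>) ^ (2 + 2 * CARD('n)))"
        using norm_ge_zero[THEN order_trans, OF B[of 0]] \<open>0 < B\<close>
        by (intro mult_right_mono power_mono mult_left_mono) auto
      also have "\<dots> = (norm k)\<^sup>2 * (B / (1 + norm \<xi>) ^ (2 * CARD('n)))"
      proof -
        have "1 + norm \<xi> \<noteq> 0" using norm_ge_zero[of \<xi>] by linarith
        then show ?thesis unfolding power_add power_mult_distrib by simp
      qed
      finally show "norm (osc (x + k) \<xi> * h \<xi> - osc x \<xi> * h \<xi> - \<i> * of_real (k \<bullet> \<xi>) * osc x \<xi> * h \<xi>)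
          \<le> (norm k)\<^sup>2 * (B / (1 + norm \<xi>) ^ (2 * CARD('n)))" .
    qed auto
    also have "\<dots> = (norm (fconst TYPE('n)) * ?I) * (norm k)\<^sup>2"
      by (subst integral_mult_right_zero) (simp only: mult_ac)
    finally show ?thesis .
  qed
  show "inv_fourier h differentiable (at x)" "pd j (inv_fourier h) x = ?g j"
    by (rule differentiable_by_quadratic_bound[where g = ?g], rule bound)+
qed

lemma smooth_inv_fourier:
  assumes "h \<in> schwartz"
  shows "smooth (inv_fourier h)"
proof -
  have "h \<in> schwartz \<Longrightarrow> diffble n (inv_fourier h)" for n
  proof (induction n arbitrary: h)
    case (Suc n)
    have "(\<lambda>\<xi>. \<i> * of_real (\<xi> $ j) * h \<xi>) \<in> schwartz" for j
      using schwartz_cmult[OF schwartz_mult[OF slow_growth_coord Suc.prems]] by (simp add: mult.assoc)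
    moreover have "pd j (inv_fourier h) = inv_fourier (\<lambda>\<xi>. \<i> * of_real (\<xi> $ j) * h \<xi>)" for j
      using inv_fourier_pd(2)[OF Suc.prems] by auto
    ultimately show ?case using Suc inv_fourier_pd(1) by auto
  qed auto
  with assms show ?thesis by (simp add: smooth_iff_diffble)
qed

text \<open>Integration by parts: the function \<open>\<lambda>\<xi>. osc x \<xi> * h \<xi>\<close>
  is Schwartz, so the integral of its derivative vanishes, and the product rule gives the two
  sides.\<close>

lemma inv_fourier_mult_coord:
  assumes h: "h \<in> schwartz"
  shows "of_real (x $ j) * inv_fourier h x = \<i> * inv_fourier (pd j h) x"
proof -
  have "pd j (\<lambda>\<xi>. osc x \<xi> * h \<xi>) = (\<lambda>\<xi>. \<i> * of_real (x $ j) * (osc x \<xi> * h \<xi>) + osc x \<xi> * pd j h \<xi>)"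
    using h by (auto intro!: ext simp: pd_mult smooth_differentiable smooth_osc schwartz_smooth pd_osc mult_ac)
  moreover have "(LINT \<xi>|lborel. pd j (\<lambda>\<xi>. osc x \<xi> * h \<xi>) \<xi>) = 0"
    by (intro integral_pd_schwartz osc_schwartz h)
  ultimately have "\<i> * of_real (x $ j) * (LINT \<xi>|lborel. osc x \<xi> * h \<xi>) + (LINT \<xi>|lborel. osc x \<xi> * pd j h \<xi>) = 0"
    using h by (simp add: schwartz_integrable osc_schwartz schwartz_pd)
  then have "(LINT \<xi>|lborel. osc x \<xi> * pd j h \<xi>) = - (\<i> * of_real (x $ j) * (LINT \<xi>|lborel. osc x \<xi> * h \<xi>))"
    by (simp add: eq_neg_iff_add_eq_0 add.commute)
  then show ?thesis by (simp add: inv_fourier_eq mult_ac)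
qed

text \<open>One power of \<open>1 + norm x\<close> is traded for one derivative of \<open>h\<close>:
  the norm is bounded by the sum of the absolute coordinates, and each coordinate is absorbed by
  \<open>inv_fourier_mult_coord\<close>. Hence the induction must range over all
  \<open>h\<close>.\<close>

lemma inv_fourier_decay:
  fixes h :: "real^'n \<Rightarrow> complex"
  assumes "h \<in> schwartz"
  shows "\<exists>C. \<forall>x. (1 + norm x) ^ N * norm (inv_fourier h x) \<le> C"
  using assms
proof (induction N arbitrary: h)
  case 0
  have "norm (inv_fourier h x) \<le> norm (fconst TYPE('n)) * (LINT \<xi>|lborel. norm (h \<xi>))" for x
  proof -
    have "norm (LINT \<xi>|lborel. osc x \<xi> * h \<xi>) \<le> (LINT \<xi>|lborel. norm (osc x \<xi> * h \<xi>))"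
      by (rule integral_norm_bound)
    then show ?thesis
      unfolding inv_fourier_eq norm_mult by (intro mult_left_mono) (auto simp: norm_mult)
  qed
  then show ?case by auto
next
  case (Suc N)
  have "\<forall>j. \<exists>C. \<forall>x. (1 + norm x) ^ N * norm (inv_fourier (pd j h) x) \<le> C"
    using Suc by (auto intro: schwartz_pd)
  then obtain C where C: "\<And>j x. (1 + norm x) ^ N * norm (inv_fourier (pd j h) x) \<le> C j"
    by metis
  obtain D where D: "\<And>x. (1 + norm x) ^ N * norm (inv_fourier h x) \<le> D"
    using Suc by metis
  have "(1 + norm x) ^ Suc N * norm (inv_fourier h x) \<le> D + (\<Sum>j\<in>UNIV. C j)" for x
  proof -
    have "(1 + norm x) * norm (inv_fourier h x) \<le> (1 + (\<Sum>j\<in>UNIV. \<bar>x $ j\<bar>)) * norm (inv_fourier h x)"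
      by (intro mult_right_mono add_left_mono norm_le_l1_cart) auto
    also have "\<dots> = norm (inv_fourier h x) + (\<Sum>j\<in>UNIV. norm (of_real (x $ j) * inv_fourier h x))"
      by (simp add: norm_mult distrib_right sum_distrib_right)
    also have "\<dots> = norm (inv_fourier h x) + (\<Sum>j\<in>UNIV. norm (inv_fourier (pd j h) x))"
      using Suc.prems by (simp add: inv_fourier_mult_coord norm_mult)
    finally have "(1 + norm x) ^ N * ((1 + norm x) * norm (inv_fourier h x))
        \<le> (1 + norm x) ^ N * (norm (inv_fourier h x) + (\<Sum>j\<in>UNIV. norm (inv_fourier (pd j h) x)))"
      by (intro mult_left_mono) auto
    also have "\<dots> \<le> D + (\<Sum>j\<in>UNIV. C j)"
      unfolding distrib_left sum_distrib_left by (intro add_mono sum_mono C D)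
    finally show ?thesis by (simp add: mult_ac)
  qed
  then show ?case by blast
qed

lemma partials_inv_fourier:
  "h \<in> schwartz \<Longrightarrow> \<exists>h'\<in>schwartz. partials js (inv_fourier h) = inv_fourier h'"
proof (induction js arbitrary: h rule: rev_induct)
  case (snoc j js)
  have "(\<lambda>\<xi>. \<i> * of_real (\<xi> $ j) * h \<xi>) \<in> schwartz"
    using schwartz_cmult[OF schwartz_mult[OF slow_growth_coord snoc.prems]] by (simp add: mult.assoc)
  moreover have "pd j (inv_fourier h) = inv_fourier (\<lambda>\<xi>. \<i> * of_real (\<xi> $ j) * h \<xi>)"
    using inv_fourier_pd(2)[OF snoc.prems] by auto
  ultimately show ?case using snoc.IH by (simp add: partials_snoc)
qed auto

theorem inv_fourier_schwartz:
  fixes h :: "real^'n \<Rightarrow> complex"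
  assumes "h \<in> schwartz"
  shows "inv_fourier h \<in> schwartz"
  unfolding schwartz_iff
proof (intro conjI allI)
  fix js :: "'n list" and N
  obtain h' where "h' \<in> schwartz" "partials js (inv_fourier h) = inv_fourier h'"
    using partials_inv_fourier[OF assms] by blast
  then obtain C where "\<And>x. (1 + norm x) ^ N * norm (partials js (inv_fourier h) x) \<le> C"
    using inv_fourier_decay by metis
  then have "norm (partials js (inv_fourier h) x) \<le> C / (1 + norm x) ^ N" for x
    by (simp add: pos_le_divide_eq mult.commute)
  then show "\<exists>C. \<forall>x. norm (partials js (inv_fourier h) x) \<le> C / (1 + norm x) ^ N" by blast
qed (rule smooth_inv_fourier[OF assms])

lemma integrable_pair_bound:
  fixes F :: "'a::euclidean_space \<Rightarrow> complex" and G :: "'b::euclidean_space \<Rightarrow> complex"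
    and H :: "'a \<times> 'b \<Rightarrow> complex"
  assumes F: "integrable lborel F" and G: "integrable lborel G"
    and H: "H \<in> borel_measurable (lborel \<Otimes>\<^sub>M lborel)"
    and le: "\<And>x y. norm (H (x, y)) \<le> K * (norm (F x) * norm (G y))"
  shows "integrable (lborel \<Otimes>\<^sub>M lborel) H"
proof (rule integrableI_bounded[OF H])
  note [measurable] = borel_measurable_integrable[OF F] borel_measurable_integrable[OF G] H
  have "(\<integral>\<^sup>+ z. norm (H z) \<partial>(lborel \<Otimes>\<^sub>M lborel)) = (\<integral>\<^sup>+ x. (\<integral>\<^sup>+ y. norm (H (x, y)) \<partial>lborel) \<partial>lborel)"
    by (subst lborel.nn_integral_fst[symmetric]) auto
  also have "\<dots> \<le> (\<integral>\<^sup>+ x. (\<integral>\<^sup>+ y. ennreal \<bar>K\<bar> * (ennreal (norm (F x)) * ennreal (norm (G y))) \<partial>lborel) \<partial>lborel)"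
  proof (intro nn_integral_mono)
    fix x y
    have "norm (H (x, y)) \<le> \<bar>K\<bar> * (norm (F x) * norm (G y))"
      using le[of x y] by (meson abs_ge_self mult_nonneg_nonneg mult_right_mono norm_ge_zero order_trans)
    then show "ennreal (norm (H (x, y))) \<le> ennreal \<bar>K\<bar> * (ennreal (norm (F x)) * ennreal (norm (G y)))"
      by (simp add: ennreal_mult[symmetric] ennreal_leI)
  qed
  also have "\<dots> = ennreal \<bar>K\<bar> * ((\<integral>\<^sup>+ x. norm (F x) \<partial>lborel) * (\<integral>\<^sup>+ y. norm (G y) \<partial>lborel))"
    by (simp add: nn_integral_cmult nn_integral_multc)
  also have "\<dots> < \<infinity>"
    using F G by (simp add: integrable_iff_bounded ennreal_mult_less_top)
  finally show "(\<integral>\<^sup>+ z. norm (H z) \<partial>(lborel \<Otimes>\<^sub>M lborel)) < \<infinity>" .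
qed

section \<open>Gaussians and the total integral of an inverse Fourier transform\<close>

lemma lborel_integral_prod:
  fixes f :: "'a::euclidean_space \<Rightarrow> real \<Rightarrow> complex"
  assumes "\<And>b. b \<in> Basis \<Longrightarrow> integrable lborel (f b)"
  shows "integrable lborel (\<lambda>x::'a. \<Prod>b\<in>Basis. f b (x \<bullet> b))"
    and "(LINT x|lborel. (\<Prod>b\<in>Basis. f b (x \<bullet> b))) = (\<Prod>b\<in>Basis. (LINT t|lborel. f b t))"
proof -
  interpret product_sigma_finite "\<lambda>_::'a. lborel :: real measure" by standard
  let ?P = "Pi\<^sub>M Basis (\<lambda>_::'a. lborel :: real measure)"
  let ?T = "\<lambda>w. \<Sum>b\<in>Basis. w b *\<^sub>R b :: 'a"
  have eq: "(lborel :: 'a measure) = distr ?P borel ?T" by (rule lborel_eq)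
  have T[measurable]: "?T \<in> ?P \<rightarrow>\<^sub>M borel" by measurable
  have [measurable]: "f b \<in> borel_measurable borel" if "b \<in> Basis" for b
    using borel_measurable_integrable[OF assms[OF that]] by simp
  have m: "(\<lambda>x::'a. \<Prod>b\<in>Basis. f b (x \<bullet> b)) \<in> borel_measurable borel" by measurable
  have s: "(\<Prod>b\<in>Basis. f b (?T w \<bullet> b)) = (\<Prod>b\<in>Basis. f b (w b))" for w
    by (rule prod.cong) auto
  have "integrable ?P (\<lambda>w. \<Prod>b\<in>Basis. f b (w b))"
    by (rule product_integrable_prod) (use assms in auto)
  then have "integrable (distr ?P borel ?T) (\<lambda>x::'a. \<Prod>b\<in>Basis. f b (x \<bullet> b))"
    by (subst integrable_distr_eq[OF T m]) (simp only: s)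
  then show "integrable lborel (\<lambda>x::'a. \<Prod>b\<in>Basis. f b (x \<bullet> b))"
    by (simp only: eq[symmetric])
  have "integral\<^sup>L (distr ?P borel ?T) (\<lambda>x::'a. \<Prod>b\<in>Basis. f b (x \<bullet> b)) =
      (\<Prod>b\<in>Basis. (LINT t|lborel. f b t))"
    by (subst integral_distr[OF T m], simp only: s, rule product_integral_prod) (use assms in auto)
  then show "(LINT x|lborel. (\<Prod>b\<in>Basis. f b (x \<bullet> b))) = (\<Prod>b\<in>Basis. (LINT t|lborel. f b t))"
    by (simp only: eq[symmetric])
qed

lemma std_normal_fourier:
  "integrable lborel (\<lambda>x. complex_of_real (std_normal_density x) * iexp (t * x))"
  "(LINT x|lborel. complex_of_real (std_normal_density x) * iexp (t * x)) = of_real (exp (- t\<^sup>2 / 2))"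
proof -
  have "integrable lborel std_normal_density"
    using integrable_std_normal_moment[of 0] by simp
  then show "integrable lborel (\<lambda>x. complex_of_real (std_normal_density x) * iexp (t * x))"
    by (rule Bochner_Integration.integrable_bound) (auto simp: norm_mult)
  have "char std_normal_distribution t = (LINT x|lborel. std_normal_density x *\<^sub>R iexp (t * x))"
    unfolding char_def by (subst integral_density) auto
  then show "(LINT x|lborel. complex_of_real (std_normal_density x) * iexp (t * x)) = of_real (exp (- t\<^sup>2 / 2))"
    by (simp add: char_std_normal_distribution scaleR_conv_of_real)
qed

definition gauss :: "real^'n \<Rightarrow> real" where
  "gauss x = exp (- (x \<bullet> x) / 2)"

text \<open>The factor \<open>(2 * pi)\<close> to the power \<open>- n / 2\<close> that gives
  \<open>gauss\<close> total mass 1. Its square is the constant of the inverse Fourier transform, so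
  that the constants match in \<open>integral_inv_fourier\<close>.\<close>

definition gconst :: "'n::finite itself \<Rightarrow> real" where
  "gconst _ = (1 / sqrt (2 * pi)) ^ CARD('n)"

lemma gconst_pos: "0 < gconst TYPE('n::finite)"
  by (simp add: gconst_def)

lemma gconst_square: "complex_of_real (gconst TYPE('n::finite)) * of_real (gconst TYPE('n)) = fconst TYPE('n)"
proof -
  have "gconst TYPE('n) * gconst TYPE('n) = ((1 / sqrt (2 * pi)) * (1 / sqrt (2 * pi))) ^ CARD('n)"
    by (simp only: gconst_def power_mult_distrib)
  also have "\<dots> = 1 / (2 * pi) ^ CARD('n)"
    by (simp add: power_divide real_sqrt_mult[symmetric] power_one_over)
  finally show ?thesis by (simp add: fconst_def of_real_mult[symmetric] del: of_real_mult)
qed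

lemma gauss_le_1: "gauss x \<le> 1" and gauss_nonneg: "0 \<le> gauss x"
  by (auto simp: gauss_def)

lemma gauss_measurable [measurable]: "gauss \<in> borel_measurable borel"
  unfolding gauss_def[abs_def] by measurable

lemma gauss_fourier:
  fixes \<xi> :: "real^'n"
  shows "integrable lborel (\<lambda>x. osc \<xi> x * of_real (gauss x))"
    and "(LINT x|lborel. osc \<xi> x * of_real (gconst TYPE('n) * gauss x)) = of_real (gauss \<xi>)"
proof -
  let ?f = "\<lambda>b t. complex_of_real (std_normal_density t) * iexp ((\<xi> \<bullet> b) * t)"
  have inner: "(\<Sum>b\<in>Basis. (x \<bullet> b) * (y \<bullet> b)) = x \<bullet> y" for x y :: "real^'n"
    by (simp add: euclidean_inner[symmetric])
  have P: "(\<Prod>b\<in>Basis. ?f b (x \<bullet> b)) = osc \<xi> x * of_real (gconst TYPE('n) * gauss x)" for x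
  proof -
    have "(\<Prod>b\<in>Basis. std_normal_density (x \<bullet> b)) =
        (1 / sqrt (2 * pi)) ^ CARD('n) * exp (\<Sum>b\<in>Basis. - (x \<bullet> b)\<^sup>2 / 2)"
      unfolding std_normal_density_def prod.distrib by (simp add: exp_sum)
    also have "(\<Sum>b\<in>Basis. - (x \<bullet> b)\<^sup>2 / 2) = - (\<Sum>b\<in>Basis. (x \<bullet> b) * (x \<bullet> b)) / 2"
      by (simp add: sum_divide_distrib[symmetric] sum_negf power2_eq_square)
    finally have A: "(\<Prod>b\<in>Basis. std_normal_density (x \<bullet> b)) = gconst TYPE('n) * gauss x"
      by (simp add: gconst_def gauss_def inner)
    have "(\<Prod>b\<in>Basis. iexp ((\<xi> \<bullet> b) * (x \<bullet> b))) = exp (\<Sum>b\<in>Basis. \<i> * complex_of_real ((\<xi> \<bullet> b) * (x \<bullet> b)))"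
      by (simp add: exp_sum)
    also have "(\<Sum>b\<in>Basis. \<i> * complex_of_real ((\<xi> \<bullet> b) * (x \<bullet> b))) = \<i> * of_real (\<Sum>b\<in>Basis. (\<xi> \<bullet> b) * (x \<bullet> b))"
      by (simp add: sum_distrib_left)
    finally have B: "(\<Prod>b\<in>Basis. iexp ((\<xi> \<bullet> b) * (x \<bullet> b))) = osc \<xi> x"
      by (simp only: inner osc_def)
    have "(\<Prod>b\<in>Basis. ?f b (x \<bullet> b)) =
        of_real (\<Prod>b\<in>Basis. std_normal_density (x \<bullet> b)) * (\<Prod>b\<in>Basis. iexp ((\<xi> \<bullet> b) * (x \<bullet> b)))"
      by (simp only: prod.distrib of_real_prod)
    then show ?thesis unfolding A B by (simp only: mult.commute)
  qed
  have "integrable lborel (\<lambda>x. \<Prod>b\<in>Basis. ?f b (x \<bullet> b))"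
    by (rule lborel_integral_prod) (rule std_normal_fourier)
  then have "integrable lborel (\<lambda>x. of_real (inverse (gconst TYPE('n))) * (osc \<xi> x * of_real (gconst TYPE('n) * gauss x)))"
    unfolding P by (rule integrable_mult_right)
  moreover have "of_real (inverse (gconst TYPE('n))) * (osc \<xi> x * of_real (gconst TYPE('n) * gauss x)) =
      osc \<xi> x * of_real (gauss x)" for x
    using gconst_pos[where 'n = 'n] by (simp add: field_simps)
  ultimately show "integrable lborel (\<lambda>x. osc \<xi> x * of_real (gauss x))"
    by (simp only:)
  have "(LINT x|lborel. (\<Prod>b\<in>Basis. ?f b (x \<bullet> b))) = (\<Prod>b\<in>Basis. (LINT t|lborel. ?f b t))"
    by (rule lborel_integral_prod) (rule std_normal_fourier)
  also have "\<dots> = of_real (\<Prod>b\<in>(Basis::(real^'n) set). exp (- (\<xi> \<bullet> b)\<^sup>2 / 2))"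
    by (simp only: std_normal_fourier of_real_prod)
  also have "(\<Prod>b\<in>(Basis::(real^'n) set). exp (- (\<xi> \<bullet> b)\<^sup>2 / 2)) = exp (- (\<Sum>b\<in>Basis. (\<xi> \<bullet> b) * (\<xi> \<bullet> b)) / 2)"
    by (simp add: exp_sum[symmetric] sum_divide_distrib[symmetric] sum_negf power2_eq_square)
  finally show "(LINT x|lborel. osc \<xi> x * of_real (gconst TYPE('n) * gauss x)) = of_real (gauss \<xi>)"
    unfolding P by (simp only: inner gauss_def)
qed

lemma osc_commute: "osc x y = osc y x"
  by (simp add: osc_def inner_commute)

lemma osc_zero [simp]: "osc 0 x = 1"
  by (simp add: osc_def)

lemma gauss_integrable: "integrable lborel (\<lambda>x::real^'n. complex_of_real (gauss x))"
  using gauss_fourier(1)[of 0] by simp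

lemma integral_gauss: "complex_of_real (gconst TYPE('n)) * (LINT x::real^'n|lborel. of_real (gauss x)) = 1"
  using gauss_fourier(2)[of "0::real^'n"] gauss_integrable by (simp add: gauss_def[of 0])

text \<open>The multiplication formula of Fourier analysis with a Gaussian as one of the functions:
  by Fubini the transform moves from \<open>\<psi>\<close> to the Gaussian, which is its own
  transform up to the constant.\<close>

lemma inv_fourier_gauss_pairing:
  fixes \<psi> :: "real^'n \<Rightarrow> complex"
  assumes \<psi>: "\<psi> \<in> schwartz"
  shows "(LINT x|lborel. inv_fourier \<psi> x * of_real (gconst TYPE('n) * gauss x)) =
    fconst TYPE('n) * (LINT \<xi>|lborel. \<psi> \<xi> * of_real (gauss \<xi>))"
proof -
  let ?a = "gconst TYPE('n)"
  let ?H = "\<lambda>x \<xi>. osc x \<xi> * \<psi> \<xi> * of_real (?a * gauss x)"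
  note [measurable] = schwartz_borel[OF \<psi>]
  have "integrable (lborel \<Otimes>\<^sub>M lborel) (case_prod ?H)"
  proof (rule integrable_pair_bound[OF gauss_integrable schwartz_integrable[OF \<psi>], where K = ?a])
    show "norm (case (x, \<xi>) of (x, \<xi>) \<Rightarrow> ?H x \<xi>) \<le> ?a * (norm (complex_of_real (gauss x)) * norm (\<psi> \<xi>))" for x \<xi>
      using gconst_pos[where 'n = 'n] by (simp add: norm_mult abs_mult)
  qed measurable
  from lborel_pair.Fubini_integral[OF this]
  have "(LINT \<xi>|lborel. (LINT x|lborel. ?H x \<xi>)) = (LINT x|lborel. (LINT \<xi>|lborel. ?H x \<xi>))" .
  moreover have "(LINT \<xi>|lborel. ?H x \<xi>) = (LINT \<xi>|lborel. osc x \<xi> * \<psi> \<xi>) * of_real (?a * gauss x)" for x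
    by (rule integral_mult_left_zero)
  moreover have "(LINT x|lborel. ?H x \<xi>) = \<psi> \<xi> * of_real (gauss \<xi>)" for \<xi>
  proof -
    have "?H x \<xi> = \<psi> \<xi> * (osc \<xi> x * of_real (?a * gauss x))" for x
      by (simp only: osc_commute[of x \<xi>] mult_ac)
    then have "(LINT x|lborel. ?H x \<xi>) = \<psi> \<xi> * (LINT x|lborel. osc \<xi> x * of_real (?a * gauss x))"
      by (simp only: integral_mult_right_zero)
    then show ?thesis by (simp only: gauss_fourier)
  qed
  ultimately have "(LINT x|lborel. (LINT \<xi>|lborel. osc x \<xi> * \<psi> \<xi>) * of_real (?a * gauss x)) =
      (LINT \<xi>|lborel. \<psi> \<xi> * of_real (gauss \<xi>))"
    by simp
  moreover have "inv_fourier \<psi> x * of_real (?a * gauss x) =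
      fconst TYPE('n) * ((LINT \<xi>|lborel. osc x \<xi> * \<psi> \<xi>) * of_real (?a * gauss x))" for x
    by (simp only: inv_fourier_eq mult.assoc)
  ultimately show ?thesis by (simp only: integral_mult_right_zero)
qed

lemma inner_dil: "dil c x \<bullet> y = x \<bullet> dil c y"
  by (simp add: inner_vec_def mult_ac)

lemma inv_fourier_dil:
  fixes \<psi> :: "real^'n \<Rightarrow> complex"
  assumes \<psi>: "\<psi> \<in> schwartz" and c: "\<And>j. c $ j \<noteq> 0"
  shows "inv_fourier (\<lambda>\<xi>. \<psi> (dil c \<xi>)) (dil c x) = of_real (inverse (jac c)) * inv_fourier \<psi> x"
proof -
  note [measurable] = schwartz_borel[OF \<psi>]
  have "(LINT \<xi>|lborel. osc x \<xi> * \<psi> \<xi>) = of_real (jac c) * (LINT \<xi>|lborel. osc x (0 + dil c \<xi>) * \<psi> (0 + dil c \<xi>))"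
    by (rule integral_dil[OF c]) measurable
  then have "(LINT \<xi>|lborel. osc x \<xi> * \<psi> \<xi>) = of_real (jac c) * (LINT \<xi>|lborel. osc (dil c x) \<xi> * \<psi> (dil c \<xi>))"
    by (simp add: osc_def inner_dil)
  then show ?thesis using jac_pos[OF c] by (simp add: inv_fourier_eq)
qed

text \<open>Both sides of the pairing with the Gaussian are rescaled, so that the Gaussian becomes constant
  on one side while \<open>\<psi>\<close> becomes constant on the other.\<close>

theorem integral_inv_fourier:
  fixes \<psi> :: "real^'n \<Rightarrow> complex"
  assumes \<psi>: "\<psi> \<in> schwartz"
  shows "(LINT x|lborel. inv_fourier \<psi> x) = \<psi> 0"
proof -
  let ?a = "complex_of_real (gconst TYPE('n))"
  \<comment> \<open>Isotropic dilations shrinking to 0, independent of any weight;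
    \<open>Suc k\<close> keeps all factors nonzero.\<close>
  define c :: "nat \<Rightarrow> real^'n" where "c k = (\<chi> j. inverse (real (Suc k)))" for k
  have c0: "c k $ j \<noteq> 0" for k j by (simp add: c_def)
  have dc: "dil (c k) x = inverse (real (Suc k)) *\<^sub>R x" for k x by (simp add: c_def vec_eq_iff)
  have lim: "(\<lambda>k. dil (c k) x) \<longlonglongrightarrow> 0" for x
    unfolding dc using tendsto_scaleR[OF LIMSEQ_inverse_real_of_nat tendsto_const[of x]] by simp
  have gcont: "isCont gauss x" for x :: "real^'n"
    unfolding gauss_def[abs_def] by (intro continuous_intros) simp
  have \<psi>k: "(\<lambda>\<xi>. \<psi> (dil (c k) \<xi>)) \<in> schwartz" for k
    using schwartz_affine[OF \<psi> c0[of k], where z = 0] by simp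
  note [measurable] = schwartz_borel[OF \<psi>] schwartz_borel[OF inv_fourier_schwartz[OF \<psi>]]
    schwartz_borel[OF \<psi>k] schwartz_borel[OF inv_fourier_schwartz[OF \<psi>k]]
  have dm[measurable]: "dil (c k) \<in> borel_measurable borel" for k
    using dil_measurable[of 0 "c k"] by simp
  \<comment> \<open>The Jacobian of the substitution cancels the factor from
    \<open>inv_fourier_dil\<close>. The dilation thereby sits on the Gaussian at the left and on
    \<open>\<psi>\<close> at the right, and both tend to a constant.\<close>
  have eq: "(LINT y|lborel. inv_fourier \<psi> y * of_real (gconst TYPE('n) * gauss (dil (c k) y))) =
      fconst TYPE('n) * (LINT \<xi>|lborel. \<psi> (dil (c k) \<xi>) * of_real (gauss \<xi>))" for k
  proof -
    let ?h = "inv_fourier (\<lambda>\<xi>. \<psi> (dil (c k) \<xi>))"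
    have "(LINT x|lborel. ?h x * of_real (gconst TYPE('n) * gauss x)) =
       of_real (jac (c k)) * (LINT y|lborel. ?h (0 + dil (c k) y) * of_real (gconst TYPE('n) * gauss (0 + dil (c k) y)))"
      by (rule integral_dil[OF c0]) measurable
    also have "\<dots> = of_real (jac (c k)) * (LINT y|lborel. of_real (inverse (jac (c k))) *
        (inv_fourier \<psi> y * of_real (gconst TYPE('n) * gauss (dil (c k) y))))"
      by (simp only: add_0 inv_fourier_dil[OF \<psi> c0] mult.assoc)
    also have "\<dots> = (LINT y|lborel. inv_fourier \<psi> y * of_real (gconst TYPE('n) * gauss (dil (c k) y)))"
      using jac_pos[OF c0, of k] by (subst integral_mult_right_zero) simp
    finally show ?thesis using inv_fourier_gauss_pairing[OF \<psi>k, of k] by simp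
  qed
  have L: "(\<lambda>k. LINT y|lborel. inv_fourier \<psi> y * of_real (gconst TYPE('n) * gauss (dil (c k) y)))
      \<longlonglongrightarrow> (LINT y|lborel. inv_fourier \<psi> y * ?a)"
  proof (rule integral_dominated_convergence[where w = "\<lambda>y. gconst TYPE('n) * norm (inv_fourier \<psi> y)"])
    show "integrable lborel (\<lambda>y. gconst TYPE('n) * norm (inv_fourier \<psi> y))"
      by (intro integrable_mult_right integrable_norm schwartz_integrable inv_fourier_schwartz \<psi>)
    show "AE y in lborel. (\<lambda>k. inv_fourier \<psi> y * of_real (gconst TYPE('n) * gauss (dil (c k) y)))
        \<longlonglongrightarrow> inv_fourier \<psi> y * ?a"
    proof (intro AE_I2)
      fix y :: "real^'n"
      have "(\<lambda>k. gauss (dil (c k) y)) \<longlonglongrightarrow> gauss (0::real^'n)"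
        by (rule isCont_tendsto_compose[OF gcont lim])
      then have "(\<lambda>k. inv_fourier \<psi> y * of_real (gconst TYPE('n) * gauss (dil (c k) y)))
          \<longlonglongrightarrow> inv_fourier \<psi> y * of_real (gconst TYPE('n) * gauss (0::real^'n))"
        by (intro tendsto_intros)
      then show "(\<lambda>k. inv_fourier \<psi> y * of_real (gconst TYPE('n) * gauss (dil (c k) y)))
          \<longlonglongrightarrow> inv_fourier \<psi> y * ?a"
        by (simp add: gauss_def[of 0])
    qed
    show "AE y in lborel. norm (inv_fourier \<psi> y * of_real (gconst TYPE('n) * gauss (dil (c k) y)))
        \<le> gconst TYPE('n) * norm (inv_fourier \<psi> y)" for k
    proof (intro AE_I2)
      fix y :: "real^'n"
      have "\<bar>gconst TYPE('n) * gauss (dil (c k) y)\<bar> \<le> gconst TYPE('n)"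
        using gconst_pos[where 'n = 'n] by (simp add: abs_mult gauss_nonneg mult_left_le gauss_le_1)
      from mult_left_mono[OF this norm_ge_zero[of "inv_fourier \<psi> y"]]
      show "norm (inv_fourier \<psi> y * of_real (gconst TYPE('n) * gauss (dil (c k) y))) \<le> gconst TYPE('n) * norm (inv_fourier \<psi> y)"
        unfolding norm_mult norm_of_real by (simp only: mult.commute[of "gconst TYPE('n)" "norm (inv_fourier \<psi> y)"])
    qed
  qed measurable
  obtain B where B: "0 < B" "\<And>js x. length js \<le> 0 \<Longrightarrow> norm (partials js \<psi> x) \<le> B / (1 + norm x) ^ 0"
    by (rule schwartz_bound[OF \<psi>, where L = 0 and N = 0]) (rule that)
  have B': "norm (\<psi> x) \<le> B" for x using B(2)[of "[]" x] by simp
  have R: "(\<lambda>k. LINT \<xi>|lborel. \<psi> (dil (c k) \<xi>) * of_real (gauss \<xi>)) \<longlonglongrightarrow> (LINT \<xi>|lborel. \<psi> 0 * of_real (gauss (\<xi>::real^'n)))"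
  proof (rule integral_dominated_convergence[where w = "\<lambda>\<xi>. B * norm (complex_of_real (gauss \<xi>))"])
    show "integrable lborel (\<lambda>\<xi>::real^'n. B * norm (complex_of_real (gauss \<xi>)))"
      by (intro integrable_mult_right integrable_norm gauss_integrable)
    have "isCont \<psi> 0"
      using smooth_differentiable[OF schwartz_smooth[OF \<psi>]] differentiable_imp_continuous_within by blast
    then have "(\<lambda>k. \<psi> (dil (c k) \<xi>)) \<longlonglongrightarrow> \<psi> 0" for \<xi>
      by (rule isCont_tendsto_compose[OF _ lim])
    then show "AE \<xi> in lborel. (\<lambda>k. \<psi> (dil (c k) \<xi>) * of_real (gauss \<xi>)) \<longlonglongrightarrow> \<psi> 0 * of_real (gauss \<xi>)"
      by (intro AE_I2 tendsto_intros)
    show "AE \<xi> in lborel. norm (\<psi> (dil (c k) \<xi>) * of_real (gauss \<xi>)) \<le> B * norm (complex_of_real (gauss \<xi>))" for k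
      using B' by (intro AE_I2) (auto simp: norm_mult intro!: mult_right_mono)
  qed measurable
  have "(\<lambda>k. fconst TYPE('n) * (LINT \<xi>|lborel. \<psi> (dil (c k) \<xi>) * of_real (gauss \<xi>)))
      \<longlonglongrightarrow> fconst TYPE('n) * (LINT \<xi>|lborel. \<psi> 0 * of_real (gauss (\<xi>::real^'n)))"
    by (intro tendsto_mult tendsto_const R)
  from LIMSEQ_unique[OF L[unfolded eq] this]
  have "(LINT y|lborel. inv_fourier \<psi> y) * ?a = fconst TYPE('n) * (\<psi> 0 * (LINT \<xi>::real^'n|lborel. of_real (gauss \<xi>)))"
    by (simp only: integral_mult_left_zero integral_mult_right_zero)
  \<comment> \<open>One of the two factors \<open>?a\<close> contained in \<open>fconst\<close>
    normalises the Gaussian; the other cancels against the left-hand side.\<close>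
  also have "\<dots> = (?a * \<psi> 0) * (?a * (LINT \<xi>::real^'n|lborel. of_real (gauss \<xi>)))"
    unfolding gconst_square[symmetric] by (simp only: mult_ac)
  also have "\<dots> = \<psi> 0 * ?a" unfolding integral_gauss by simp
  finally show ?thesis using gconst_pos[where 'n = 'n] by simp
qed

text \<open>The two phases combine to \<open>osc (x - y) \<xi>\<close>. After Fubini the integral
  over \<open>\<xi>\<close> is therefore the inverse transform of \<open>\<psi>\<close> at
  \<open>x - y\<close>.\<close>

lemma fourier_mult_inv_fourier:
  fixes \<phi> \<psi> :: "real^'n \<Rightarrow> complex"
  assumes \<phi>: "\<phi> \<in> schwartz" and \<psi>: "\<psi> \<in> schwartz"
  shows "fourier (\<lambda>\<xi>. \<psi> \<xi> * inv_fourier \<phi> \<xi>) y = (LINT x|lborel. \<phi> x * inv_fourier \<psi> (x - y))"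
proof -
  let ?H = "\<lambda>\<xi> x. osc (x - y) \<xi> * \<psi> \<xi> * \<phi> x"
  note [measurable] = schwartz_borel[OF \<psi>] schwartz_borel[OF \<phi>]
  have o: "exp (- \<i> * complex_of_real (\<xi> \<bullet> y)) * osc \<xi> x = osc (x - y) \<xi>" for \<xi> x
    by (simp add: osc_def inner_diff_left inner_commute exp_add[symmetric] algebra_simps)
  have "integrable (lborel \<Otimes>\<^sub>M lborel) (case_prod ?H)"
  proof (rule integrable_pair_bound[OF schwartz_integrable[OF \<psi>] schwartz_integrable[OF \<phi>], where K = 1])
    show "norm (case (\<xi>, x) of (\<xi>, x) \<Rightarrow> ?H \<xi> x) \<le> 1 * (norm (\<psi> \<xi>) * norm (\<phi> x))" for x \<xi>
      by (simp add: norm_mult)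
  qed measurable
  from lborel_pair.Fubini_integral[OF this]
  have F: "(LINT x|lborel. (LINT \<xi>|lborel. ?H \<xi> x)) = (LINT \<xi>|lborel. (LINT x|lborel. ?H \<xi> x))" .
  have "exp (- \<i> * complex_of_real (\<xi> \<bullet> y)) * (\<psi> \<xi> * inv_fourier \<phi> \<xi>) =
      fconst TYPE('n) * (LINT x|lborel. ?H \<xi> x)" for \<xi>
  proof -
    have "?H \<xi> x = (exp (- \<i> * complex_of_real (\<xi> \<bullet> y)) * \<psi> \<xi>) * (osc \<xi> x * \<phi> x)" for x
      unfolding o[symmetric] by (simp only: mult_ac)
    then have "(LINT x|lborel. ?H \<xi> x) = (exp (- \<i> * complex_of_real (\<xi> \<bullet> y)) * \<psi> \<xi>) * (LINT x|lborel. osc \<xi> x * \<phi> x)"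
      by (simp only: integral_mult_right_zero)
    then show ?thesis by (simp only: inv_fourier_eq mult_ac)
  qed
  then have "fourier (\<lambda>\<xi>. \<psi> \<xi> * inv_fourier \<phi> \<xi>) y = fconst TYPE('n) * (LINT \<xi>|lborel. (LINT x|lborel. ?H \<xi> x))"
    unfolding fourier_def by (simp only: integral_mult_right_zero)
  also have "\<dots> = fconst TYPE('n) * (LINT x|lborel. \<phi> x * (LINT \<xi>|lborel. osc (x - y) \<xi> * \<psi> \<xi>))"
    unfolding F[symmetric] by (subst integral_mult_left_zero) (simp only: mult.commute)
  also have "\<dots> = (LINT x|lborel. \<phi> x * inv_fourier \<psi> (x - y))"
    by (subst integral_mult_right_zero[symmetric]) (simp only: inv_fourier_eq mult_ac)
  finally show ?thesis .
qed

section \<open>Low-pass filtering of tempered distributions\<close>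

text \<open>The transpose of convolution with \<open>\<eta>\<close>.\<close>

definition convT :: "(real^'n \<Rightarrow> complex) \<Rightarrow> (real^'n \<Rightarrow> complex) \<Rightarrow> real^'n \<Rightarrow> complex" where
  "convT \<eta> \<phi> y = (LINT x|lborel. \<phi> x * \<eta> (x - y))"

lemma norm_bounded_schwartz:
  assumes "w \<in> schwartz"
  obtains C where "0 < C" "\<And>x. norm (w x) \<le> C"
proof -
  obtain C where "0 < C" "\<And>js x. length js \<le> 0 \<Longrightarrow> norm (partials js w x) \<le> C / (1 + norm x) ^ 0"
    by (rule schwartz_bound[OF assms, where L = 0 and N = 0]) (rule that)
  from this(1) this(2)[of "[]"] show ?thesis by (intro that[of C]) auto
qed

lemma integrable_mult_shift:
  assumes \<phi>: "integrable lborel \<phi>" and w: "w \<in> schwartz"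
  shows "integrable lborel (\<lambda>x::real^'n. \<phi> x * w (x - y))"
proof -
  obtain C where C: "0 < C" "\<And>x. norm (w x) \<le> C" by (rule norm_bounded_schwartz[OF w]) (rule that)
  note [measurable] = schwartz_borel[OF w] borel_measurable_integrable[OF \<phi>]
  show ?thesis
  proof (rule Bochner_Integration.integrable_bound)
    show "integrable lborel (\<lambda>x. of_real C * \<phi> x)" using \<phi> by (rule integrable_mult_right)
    show "AE x in lborel. norm (\<phi> x * w (x - y)) \<le> norm (of_real C * \<phi> x)"
    proof (intro AE_I2)
      fix x
      from mult_left_mono[OF C(2) norm_ge_zero[of "\<phi> x"]]
      show "norm (\<phi> x * w (x - y)) \<le> norm (of_real C * \<phi> x)"
        using C(1) by (simp add: norm_mult mult.commute)
    qed
  qed measurable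
qed

text \<open>All derivatives fall on \<open>\<eta>\<close>, so that \<open>\<phi>\<close> may be any
  integrable function. In this generality the result also yields the smoothness of
  \<open>conv F \<eta>\<close> for integrable \<open>F\<close>.\<close>

lemma convT_pd:
  fixes \<eta> \<phi> :: "real^'n \<Rightarrow> complex"
  assumes \<phi>: "integrable lborel \<phi>" and \<eta>: "\<eta> \<in> schwartz"
  shows "convT \<eta> \<phi> differentiable (at y)" "pd j (convT \<eta> \<phi>) y = - convT (pd j \<eta>) \<phi> y"
proof -
  obtain C where C: "0 \<le> C" "\<And>x h. norm h \<le> 1 \<Longrightarrow>
    norm (\<eta> (x + h) - \<eta> x - (\<Sum>j\<in>UNIV. of_real (h $ j) * pd j \<eta> x)) \<le> C * (norm h)\<^sup>2 / (1 + norm x) ^ 0"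
    by (rule schwartz_taylor[OF \<eta>, where N = 0]) (rule that)
  note int = integrable_mult_shift[OF \<phi> \<eta>] integrable_mult_shift[OF \<phi> schwartz_pd[OF \<eta>]]
  have B: "norm (convT \<eta> \<phi> (y + h) - convT \<eta> \<phi> y - (\<Sum>j\<in>UNIV. of_real (h $ j) * (- convT (pd j \<eta>) \<phi> y)))
      \<le> (C * (LINT x|lborel. norm (\<phi> x))) * (norm h)\<^sup>2" if h: "norm h \<le> 1" for h
  proof -
    \<comment> \<open>Raising \<open>y\<close> by \<open>h\<close> moves \<open>x - y\<close> by
      \<open>- h\<close>, which accounts for the signs here and in the derivative.\<close>
    let ?R = "\<lambda>x. \<eta> (x - y + - h) - \<eta> (x - y) - (\<Sum>j\<in>UNIV. of_real ((- h) $ j) * pd j \<eta> (x - y))"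
    have i: "integrable lborel (\<lambda>x. \<Sum>j\<in>UNIV. of_real (h $ j) * (\<phi> x * pd j \<eta> (x - y)))"
      by (intro Bochner_Integration.integrable_sum integrable_mult_right int)
    have "(LINT x|lborel. (\<Sum>j\<in>UNIV. of_real (h $ j) * (\<phi> x * pd j \<eta> (x - y)))) =
        (\<Sum>j\<in>UNIV. of_real (h $ j) * convT (pd j \<eta>) \<phi> y)"
      unfolding convT_def by (subst Bochner_Integration.integral_sum) (simp_all add: int)
    then have "convT \<eta> \<phi> (y + h) - convT \<eta> \<phi> y - (\<Sum>j\<in>UNIV. of_real (h $ j) * (- convT (pd j \<eta>) \<phi> y)) =
       (LINT x|lborel. \<phi> x * \<eta> (x - (y + h)) - \<phi> x * \<eta> (x - y) + (\<Sum>j\<in>UNIV. of_real (h $ j) * (\<phi> x * pd j \<eta> (x - y))))"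
      using int i by (simp add: convT_def sum_negf)
    also have "\<dots> = (LINT x|lborel. \<phi> x * ?R x)"
    proof (rule Bochner_Integration.integral_cong[OF refl])
      fix x
      have "x - (y + h) = x - y + - h" by simp
      then show "\<phi> x * \<eta> (x - (y + h)) - \<phi> x * \<eta> (x - y) + (\<Sum>j\<in>UNIV. of_real (h $ j) * (\<phi> x * pd j \<eta> (x - y))) = \<phi> x * ?R x"
        by (simp add: sum_negf algebra_simps sum_distrib_left)
    qed
    also have "norm \<dots> \<le> (LINT x|lborel. C * (norm h)\<^sup>2 * norm (\<phi> x))"
    proof (rule Bochner_Integration.integral_norm_bound_integral)
      have "(\<lambda>x. \<phi> x * ?R x) = (\<lambda>x. \<phi> x * \<eta> (x - (y + h)) - \<phi> x * \<eta> (x - y) + (\<Sum>j\<in>UNIV. of_real (h $ j) * (\<phi> x * pd j \<eta> (x - y))))"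
        by (simp add: sum_negf algebra_simps sum_distrib_left diff_diff_eq)
      then show "integrable lborel (\<lambda>x. \<phi> x * ?R x)"
        by (simp only:) (intro Bochner_Integration.integrable_add Bochner_Integration.integrable_diff int i)
      show "integrable lborel (\<lambda>x. C * (norm h)\<^sup>2 * norm (\<phi> x))"
        by (intro integrable_mult_right integrable_norm \<phi>)
      fix x
      have "norm (?R x) \<le> C * (norm h)\<^sup>2" using C(2)[of "- h" "x - y"] h by simp
      from mult_left_mono[OF this norm_ge_zero[of "\<phi> x"]]
      show "norm (\<phi> x * ?R x) \<le> C * (norm h)\<^sup>2 * norm (\<phi> x)"
        unfolding norm_mult by (simp only: mult.commute)
    qed
    also have "\<dots> = (C * (LINT x|lborel. norm (\<phi> x))) * (norm h)\<^sup>2"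
      by (subst integral_mult_right_zero) (simp only: mult_ac)
    finally show ?thesis .
  qed
  show "convT \<eta> \<phi> differentiable (at y)" "pd j (convT \<eta> \<phi>) y = - convT (pd j \<eta>) \<phi> y"
    by (rule differentiable_by_quadratic_bound[where g = "\<lambda>j. - convT (pd j \<eta>) \<phi> y"], rule B, assumption)+
qed

lemma smooth_convT:
  assumes \<phi>: "integrable lborel \<phi>" and \<eta>: "\<eta> \<in> schwartz"
  shows "smooth (convT \<eta> \<phi>)"
proof -
  have "\<eta> \<in> schwartz \<Longrightarrow> diffble n (convT \<eta> \<phi>)" for n
  proof (induction n arbitrary: \<eta>)
    case (Suc n)
    have "pd j (convT \<eta> \<phi>) = (\<lambda>y. (-1) * convT (pd j \<eta>) \<phi> y)" for j
      using convT_pd(2)[OF \<phi> Suc.prems] by auto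
    moreover have "diffble n (\<lambda>y. (-1) * convT (pd j \<eta>) \<phi> y)" for j
      using Suc.IH[OF schwartz_pd[OF Suc.prems]] by (intro diffble_mult diffble_const)
    ultimately show ?case using convT_pd(1)[OF \<phi> Suc.prems] by simp
  qed auto
  with \<eta> show ?thesis by (simp add: smooth_iff_diffble)
qed

lemma partials_convT:
  assumes \<phi>: "integrable lborel \<phi>" and \<eta>: "\<eta> \<in> schwartz"
  shows "partials js (convT \<eta> \<phi>) = (\<lambda>y. (-1) ^ length js * convT (partials js \<eta>) \<phi> y)"
proof (induction js)
  case (Cons j js)
  have "pd j (\<lambda>y. (-1) ^ length js * convT (partials js \<eta>) \<phi> y) =
      (\<lambda>y. (-1) ^ length js * pd j (convT (partials js \<eta>) \<phi>) y)"
    by (intro pd_cmult smooth_convT \<phi> schwartz_partials \<eta>)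
  with Cons show ?case
    by (simp add: convT_pd(2)[OF \<phi> schwartz_partials[OF \<eta>]])
qed simp

text \<open>Peetre's inequality. Through \<open>decay_shift\<close> it converts decay in
  \<open>x - y\<close> into decay in \<open>y\<close>, at the price of growth in
  \<open>x\<close>.\<close>

lemma one_plus_norm_mult: "1 + norm (y::real^'n) \<le> (1 + norm x) * (1 + norm (x - y))"
proof -
  have "norm y \<le> norm x + norm (x - y)"
    using norm_triangle_ineq4[of x "x - y"] by simp
  moreover have "(1 + norm x) * (1 + norm (x - y)) = 1 + norm x + norm (x - y) + norm x * norm (x - y)"
    by (simp add: algebra_simps)
  moreover have "0 \<le> norm x * norm (x - y)" by simp
  ultimately show ?thesis by linarith
qed

lemma decay_shift:
  assumes "0 \<le> C"
  shows "C / (1 + norm (x - y)) ^ N \<le> C * (1 + norm x) ^ N / (1 + norm (y::real^'n)) ^ N"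
proof (rule divide_le_scaled[OF one_plus_norm_power_pos one_plus_norm_power_pos assms])
  show "(1 + norm y) ^ N \<le> (1 + norm x) ^ N * (1 + norm (x - y)) ^ N"
    unfolding power_mult_distrib[symmetric] by (rule power_mono[OF one_plus_norm_mult]) simp
qed

text \<open>The constant depends on \<open>\<eta>\<close> and \<open>N\<close> but not on
  \<open>\<phi>\<close>, so the estimate expresses continuity in the Schwartz seminorms. Of the
  decay required of \<open>\<phi>\<close>, \<open>N\<close> powers pay for Peetre's inequality and
  \<open>2 * CARD('n)\<close> for the integration over \<open>x\<close>.\<close>

lemma convT_bound:
  fixes \<eta> :: "real^'n \<Rightarrow> complex"
  assumes \<eta>: "\<eta> \<in> schwartz"
  shows "\<exists>C\<ge>0. \<forall>\<phi> B js y. \<phi> \<in> borel_measurable borel \<longrightarrow>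
    (\<forall>x. norm (\<phi> x) \<le> B / (1 + norm x) ^ (N + 2 * CARD('n))) \<longrightarrow> length js \<le> N \<longrightarrow>
    norm (partials js (convT \<eta> \<phi>) y) \<le> C * B / (1 + norm y) ^ N"
proof -
  let ?L = "2 * CARD('n)"
  let ?I = "LINT x::real^'n|lborel. 1 / (1 + norm x) ^ ?L"
  obtain C where C: "0 < C" "\<And>js x. length js \<le> N \<Longrightarrow> norm (partials js \<eta> x) \<le> C / (1 + norm x) ^ N"
    by (rule schwartz_bound[OF \<eta>, where L = N and N = N]) (rule that)
  have "norm (partials js (convT \<eta> \<phi>) y) \<le> (C * ?I) * B / (1 + norm y) ^ N"
    if \<phi>: "\<phi> \<in> borel_measurable borel" and B: "\<And>x. norm (\<phi> x) \<le> B / (1 + norm x) ^ (N + ?L)"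
      and js: "length js \<le> N" for \<phi> B js y
  proof -
    have B0: "0 \<le> B" using norm_ge_zero[THEN order_trans, OF B[of 0]] by simp
    have int: "integrable lborel \<phi>"
    proof (rule integrable_of_decay[OF \<phi>])
      fix x :: "real^'n"
      have "(1 + norm x) ^ ?L \<le> (1 + norm x) ^ (N + ?L)" by (intro power_increasing) auto
      then have "B / (1 + norm x) ^ (N + ?L) \<le> B / (1 + norm x) ^ ?L"
        using B0 by (intro divide_left_mono mult_pos_pos one_plus_norm_power_pos)
      with B[of x] show "norm (\<phi> x) \<le> B / (1 + norm x) ^ ?L" by linarith
    qed
    have "norm (partials js (convT \<eta> \<phi>) y) = norm (LINT x|lborel. \<phi> x * partials js \<eta> (x - y))"
      unfolding partials_convT[OF int \<eta>] convT_def by (simp add: norm_mult norm_power)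
    also have "\<dots> \<le> (LINT x::real^'n|lborel. (C * B / (1 + norm y) ^ N) * (1 / (1 + norm x) ^ ?L))"
    proof (rule Bochner_Integration.integral_norm_bound_integral)
      show "integrable lborel (\<lambda>x. \<phi> x * partials js \<eta> (x - y))"
        by (intro integrable_mult_shift int schwartz_partials \<eta>)
      show "integrable lborel (\<lambda>x::real^'n. (C * B / (1 + norm y) ^ N) * (1 / (1 + norm x) ^ ?L))"
        by (intro integrable_mult_right integrable_decay)
      fix x
      have "norm (partials js \<eta> (x - y)) \<le> C * (1 + norm x) ^ N / (1 + norm y) ^ N"
        using C(2)[OF js, of "x - y"] decay_shift[of C x y N] C(1) by linarith
      then have "norm (\<phi> x * partials js \<eta> (x - y)) \<le>
          (B / (1 + norm x) ^ (N + ?L)) * (C * (1 + norm x) ^ N / (1 + norm y) ^ N)"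
        unfolding norm_mult using B0 by (intro mult_mono B) auto
      also have "\<dots> = (C * B / (1 + norm y) ^ N) * (1 / (1 + norm x) ^ ?L)"
        using one_plus_norm_power_pos[of x N] by (simp add: power_add mult_ac)
      finally show "norm (\<phi> x * partials js \<eta> (x - y)) \<le> (C * B / (1 + norm y) ^ N) * (1 / (1 + norm x) ^ ?L)" .
    qed
    also have "\<dots> = (C * ?I) * B / (1 + norm y) ^ N"
      by (subst integral_mult_right_zero) simp
    finally show ?thesis .
  qed
  moreover have "0 \<le> C * ?I"
    using C(1) by (intro mult_nonneg_nonneg Bochner_Integration.integral_nonneg) auto
  ultimately show ?thesis by blast
qed

lemma convT_schwartz:
  fixes \<eta> \<phi> :: "real^'n \<Rightarrow> complex"
  assumes \<phi>: "\<phi> \<in> schwartz" and \<eta>: "\<eta> \<in> schwartz"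
  shows "convT \<eta> \<phi> \<in> schwartz"
  unfolding schwartz_iff
proof (intro conjI allI)
  show "smooth (convT \<eta> \<phi>)" by (intro smooth_convT schwartz_integrable \<phi> \<eta>)
  fix js :: "'n list" and N
  \<comment> \<open>\<open>convT_bound\<close> uses one index for the order of differentiation and
    for the decay; the maximum covers both.\<close>
  let ?K = "max N (length js)"
  obtain C where C: "0 \<le> C" "\<forall>\<phi> B js y. \<phi> \<in> borel_measurable borel \<longrightarrow>
    (\<forall>x. norm (\<phi> x) \<le> B / (1 + norm x) ^ (?K + 2 * CARD('n))) \<longrightarrow> length js \<le> ?K \<longrightarrow>
    norm (partials js (convT \<eta> \<phi>) y) \<le> C * B / (1 + norm y) ^ ?K"
    using convT_bound[OF \<eta>, of ?K] by blast
  obtain B where B: "0 < B" "\<And>js x. length js \<le> 0 \<Longrightarrow> norm (partials js \<phi> x) \<le> B / (1 + norm x) ^ (?K + 2 * CARD('n))"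
    by (rule schwartz_bound[OF \<phi>, where L = 0 and N = "?K + 2 * CARD('n)"]) (rule that)
  have "norm (partials js (convT \<eta> \<phi>) y) \<le> C * B / (1 + norm y) ^ N" for y
  proof -
    have "norm (partials js (convT \<eta> \<phi>) y) \<le> C * B / (1 + norm y) ^ ?K"
      using C(2)[rule_format, OF schwartz_borel[OF \<phi>], of B js y] B(2)[of "[]"] by simp
    moreover have "C * B / (1 + norm y) ^ ?K \<le> C * B / (1 + norm y) ^ N"
      using C(1) B(1) by (intro divide_left_mono mult_pos_pos one_plus_norm_power_pos power_increasing) auto
    ultimately show ?thesis by linarith
  qed
  then show "\<exists>C. \<forall>y. norm (partials js (convT \<eta> \<phi>) y) \<le> C / (1 + norm y) ^ N" by blast
qed

text \<open>The finite order of \<open>u\<close>, phrased with pointwise bounds in place of suprema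
  and sums. Estimates of derivatives can then be inserted directly.\<close>

definition tempered_bound :: "((real^'n \<Rightarrow> complex) \<Rightarrow> complex) \<Rightarrow> real \<Rightarrow> nat \<Rightarrow> bool" where
  "tempered_bound u C N \<longleftrightarrow> 0 \<le> C \<and> (\<forall>\<phi>\<in>schwartz. \<forall>B.
     (\<forall>js x. length js \<le> N \<longrightarrow> norm (partials js \<phi> x) \<le> B / (1 + norm x) ^ N) \<longrightarrow> norm (u \<phi>) \<le> C * B)"

lemma tempered_bound_exists:
  fixes u :: "(real^'n \<Rightarrow> complex) \<Rightarrow> complex"
  assumes "u \<in> tempered_distributions"
  obtains C N where "tempered_bound u C N"
proof -
  from assms obtain C N where C: "\<And>\<phi>. \<phi> \<in> schwartz \<Longrightarrow> norm (u \<phi>) \<le> C * schwartz_seminorm N \<phi>"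
    by (auto simp: tempered_distributions_def)
  define m where "m = real (card {js :: 'n list. length js \<le> N})"
  have "norm (u \<phi>) \<le> (\<bar>C\<bar> * m) * B"
    if \<phi>: "\<phi> \<in> schwartz" and B: "\<And>js x. length js \<le> N \<Longrightarrow> norm (partials js \<phi> x) \<le> B / (1 + norm x) ^ N" for \<phi> B
  proof -
    have "schwartz_seminorm N \<phi> \<le> (\<Sum>js :: 'n list | length js \<le> N. B)"
      unfolding schwartz_seminorm_def
    proof (intro sum_mono cSUP_least)
      fix js :: "'n list" and x :: "real^'n" assume "js \<in> {js. length js \<le> N}"
      then show "(1 + norm x) ^ N * norm (partials js \<phi> x) \<le> B"
        using B[of js x] by (simp add: pos_le_divide_eq mult.commute)
    qed auto
    then have le: "schwartz_seminorm N \<phi> \<le> m * B" by (simp add: m_def)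
    have "0 \<le> schwartz_seminorm N \<phi>"
      unfolding schwartz_seminorm_def
    proof (intro sum_nonneg)
      fix js :: "'n list" assume "js \<in> {js. length js \<le> N}"
      then have bdd: "bdd_above (range (\<lambda>x. (1 + norm x) ^ N * norm (partials js \<phi> x)))"
        using B[of js] by (auto intro!: bdd_aboveI[of _ B] simp: pos_le_divide_eq mult.commute)
      show "0 \<le> (SUP x. (1 + norm x) ^ N * norm (partials js \<phi> x))"
        by (rule cSUP_upper2[OF bdd, of 0]) auto
    qed
    then have "C * schwartz_seminorm N \<phi> \<le> \<bar>C\<bar> * (m * B)"
      using le by (intro mult_mono) auto
    with C[OF \<phi>] show ?thesis by (simp add: mult.assoc)
  qed
  then have "tempered_bound u (\<bar>C\<bar> * m) N"
    unfolding tempered_bound_def by (auto simp: m_def)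
  then show ?thesis using that by blast
qed

lemma schwartz_seminorm_ge:
  assumes \<phi>: "\<phi> \<in> schwartz" and js: "length js \<le> N"
  shows "norm (partials js \<phi> x) \<le> schwartz_seminorm N \<phi> / (1 + norm (x::real^'n)) ^ N"
proof -
  obtain C where C: "0 < C" "\<And>js x. length js \<le> N \<Longrightarrow> norm (partials js \<phi> x) \<le> C / (1 + norm x) ^ N"
    by (rule schwartz_bound[OF \<phi>, where L = N and N = N]) (rule that)
  let ?s = "\<lambda>js. SUP x. (1 + norm x) ^ N * norm (partials js \<phi> x)"
  have bdd: "bdd_above (range (\<lambda>x. (1 + norm x) ^ N * norm (partials js \<phi> x)))" if "length js \<le> N" for js
    using C(2)[OF that] by (auto intro!: bdd_aboveI[of _ C] simp: pos_le_divide_eq mult.commute)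
  have "(1 + norm x) ^ N * norm (partials js \<phi> x) \<le> ?s js"
    by (rule cSUP_upper[OF _ bdd[OF js]]) simp
  also have "\<dots> \<le> (\<Sum>js | length js \<le> N. ?s js)"
  proof (rule member_le_sum)
    fix ks :: "'n list" assume "ks \<in> {js. length js \<le> N} - {js}"
    then have "length ks \<le> N" by simp
    from bdd[OF this] show "0 \<le> ?s ks" by (rule cSUP_upper2[of _ _ 0]) auto
  qed (use js in \<open>auto simp: finite_lists_le\<close>)
  finally show ?thesis
    by (simp add: schwartz_seminorm_def pos_le_divide_eq mult.commute)
qed

lemma tempered_add:
  "u \<in> tempered_distributions \<Longrightarrow> \<phi> \<in> schwartz \<Longrightarrow> \<eta> \<in> schwartz \<Longrightarrow> u (\<lambda>x. \<phi> x + \<eta> x) = u \<phi> + u \<eta>"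
  by (simp add: tempered_distributions_def linear_functional_on_def)

lemma tempered_cmult:
  "u \<in> tempered_distributions \<Longrightarrow> \<phi> \<in> schwartz \<Longrightarrow> u (\<lambda>x. c * \<phi> x) = c * u \<phi>"
  by (simp add: tempered_distributions_def linear_functional_on_def)

lemma tempered_diff:
  "u \<in> tempered_distributions \<Longrightarrow> \<phi> \<in> schwartz \<Longrightarrow> \<eta> \<in> schwartz \<Longrightarrow> u (\<lambda>x. \<phi> x - \<eta> x) = u \<phi> - u \<eta>"
  using tempered_add[of u \<phi> "\<lambda>x. -1 * \<eta> x"] tempered_cmult[of u \<eta> "-1"] schwartz_cmult[of \<eta> "-1"] by simp

lemma tempered_sum:
  assumes "u \<in> tempered_distributions" "\<And>i. i \<in> I \<Longrightarrow> f i \<in> schwartz"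
  shows "u (\<lambda>x. \<Sum>i\<in>I. f i x) = (\<Sum>i\<in>I. u (f i))"
  using assms(2)
proof (induction I rule: infinite_finite_induct)
  case (insert i I)
  then show ?case
    using tempered_add[OF assms(1), of "f i" "\<lambda>x. \<Sum>i\<in>I. f i x"] by (simp add: schwartz_sum)
qed (use tempered_cmult[OF assms(1) schwartz_zero, of 0] in auto)

lemma dilate_eq_dil: "dilate M k \<psi> = (\<lambda>\<xi>. \<psi> (dil (\<chi> j. 2 powr (- real k * M $ j)) \<xi>))"
  by (simp add: dilate_def[abs_def] dil_def)

lemma dilate_schwartz: "\<psi> \<in> schwartz \<Longrightarrow> dilate M k \<psi> \<in> schwartz"
  unfolding dilate_eq_dil
  using schwartz_affine[of \<psi> "\<chi> j. 2 powr (- real k * M $ j)" 0] by simp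

definition kern :: "real^'n \<Rightarrow> (real^'n \<Rightarrow> complex) \<Rightarrow> nat \<Rightarrow> real^'n \<Rightarrow> complex" where
  "kern M \<psi> k = inv_fourier (dilate M k \<psi>)"

lemma kern_schwartz: "\<psi> \<in> schwartz \<Longrightarrow> kern M \<psi> k \<in> schwartz"
  unfolding kern_def by (intro inv_fourier_schwartz dilate_schwartz)

lemma lowpass_eq_convT:
  assumes "\<psi> \<in> schwartz" "\<phi> \<in> schwartz"
  shows "lowpass M \<psi> k u \<phi> = u (convT (kern M \<psi> k) \<phi>)"
proof -
  have "(\<lambda>x. dilate M k \<psi> x * inv_fourier \<phi> x) \<in> schwartz"
    using assms by (intro schwartz_mult schwartz_slow_growth dilate_schwartz inv_fourier_schwartz)
  moreover have "fourier (\<lambda>x. dilate M k \<psi> x * inv_fourier \<phi> x) = convT (kern M \<psi> k) \<phi>"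
    using fourier_mult_inv_fourier[OF assms(2) dilate_schwartz[OF assms(1)]]
    by (auto simp: convT_def kern_def)
  ultimately show ?thesis
    using assms by (simp add: lowpass_def inv_fourier_distr_def mult_distr_def fourier_distr_def inv_fourier_schwartz)
qed

lemma convT_add:
  assumes "integrable lborel \<phi>" "integrable lborel \<theta>" "\<eta> \<in> schwartz"
  shows "convT \<eta> (\<lambda>x. \<phi> x + \<theta> x) = (\<lambda>y. convT \<eta> \<phi> y + convT \<eta> \<theta> y)"
  using integrable_mult_shift[OF assms(1,3)] integrable_mult_shift[OF assms(2,3)]
  by (auto simp: convT_def distrib_right)

lemma convT_cmult: "convT \<eta> (\<lambda>x. c * \<phi> x) = (\<lambda>y. c * convT \<eta> \<phi> y)"
  by (auto simp: convT_def mult.assoc)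

text \<open>Required because \<open>given_by\<close> includes temperedness. Continuity comes from
  \<open>convT_bound\<close>, and the order grows from \<open>N\<close> to
  \<open>N + 2 * CARD('n)\<close>.\<close>

lemma lowpass_tempered:
  fixes u :: "(real^'n \<Rightarrow> complex) \<Rightarrow> complex"
  assumes u: "u \<in> tempered_distributions" and \<psi>: "\<psi> \<in> schwartz"
  shows "lowpass M \<psi> k u \<in> tempered_distributions"
proof -
  let ?\<eta> = "kern M \<psi> k" and ?v = "lowpass M \<psi> k u"
  have \<eta>: "?\<eta> \<in> schwartz" using \<psi> by (rule kern_schwartz)
  have ext: "?v \<in> extensional schwartz"
    by (simp add: lowpass_def inv_fourier_distr_def)
  have lin: "linear_functional_on schwartz ?v"
    unfolding linear_functional_on_def
  proof (intro conjI ballI allI)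
    fix \<phi> \<theta> :: "real^'n \<Rightarrow> complex" assume S: "\<phi> \<in> schwartz" "\<theta> \<in> schwartz"
    then have "?v (\<lambda>x. \<phi> x + \<theta> x) = u (\<lambda>y. convT ?\<eta> \<phi> y + convT ?\<eta> \<theta> y)"
      using \<psi> by (simp add: lowpass_eq_convT schwartz_add convT_add schwartz_integrable \<eta>)
    then show "?v (\<lambda>x. \<phi> x + \<theta> x) = ?v \<phi> + ?v \<theta>"
      using tempered_add[OF u convT_schwartz[OF S(1) \<eta>] convT_schwartz[OF S(2) \<eta>]]
      by (simp add: lowpass_eq_convT \<psi> S)
  next
    fix c and \<phi> :: "real^'n \<Rightarrow> complex" assume S: "\<phi> \<in> schwartz"
    then show "?v (\<lambda>x. c * \<phi> x) = c * ?v \<phi>"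
      using tempered_cmult[OF u convT_schwartz[OF S \<eta>]]
      by (simp add: lowpass_eq_convT \<psi> schwartz_cmult convT_cmult)
  qed
  obtain C N where u_bound: "tempered_bound u C N" by (rule tempered_bound_exists[OF u])
  let ?K = "N + 2 * CARD('n)"
  obtain D where D: "0 \<le> D" "\<forall>\<phi> B js y. \<phi> \<in> borel_measurable borel \<longrightarrow>
    (\<forall>x. norm (\<phi> x) \<le> B / (1 + norm x) ^ ?K) \<longrightarrow> length js \<le> N \<longrightarrow>
    norm (partials js (convT ?\<eta> \<phi>) y) \<le> D * B / (1 + norm y) ^ N"
    using convT_bound[OF \<eta>, of N] by blast
  have "norm (?v \<phi>) \<le> (C * D) * schwartz_seminorm ?K \<phi>" if \<phi>: "\<phi> \<in> schwartz" for \<phi>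
  proof -
    have "norm (\<phi> x) \<le> schwartz_seminorm ?K \<phi> / (1 + norm x) ^ ?K" for x
      using schwartz_seminorm_ge[OF \<phi>, of "[]" ?K x] by simp
    then have "norm (partials js (convT ?\<eta> \<phi>) y) \<le> D * schwartz_seminorm ?K \<phi> / (1 + norm y) ^ N"
      if "length js \<le> N" for js y
      using that by (intro D(2)[rule_format] schwartz_borel \<phi>)
    then have "norm (u (convT ?\<eta> \<phi>)) \<le> C * (D * schwartz_seminorm ?K \<phi>)"
      using u_bound convT_schwartz[OF \<phi> \<eta>] by (simp add: tempered_bound_def)
    then show ?thesis by (simp add: lowpass_eq_convT \<psi> \<phi> mult.assoc)
  qed
  with ext lin show ?thesis unfolding tempered_distributions_def by blast
qed

section \<open>Regularisation of a tempered distribution by convolution with a Schwartz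
  function\<close>

definition avg :: "((real^'n \<Rightarrow> complex) \<Rightarrow> complex) \<Rightarrow> (real^'n \<Rightarrow> complex) \<Rightarrow> real^'n \<Rightarrow> complex" where
  "avg u \<eta> x = u (\<lambda>y. \<eta> (x - y))"

lemma pd_inv_fourier:
  assumes "h \<in> schwartz"
  shows "pd j (inv_fourier h) = inv_fourier (\<lambda>\<xi>. \<i> * of_real (\<xi> $ j) * h \<xi>)"
  using inv_fourier_pd(2)[OF assms] by auto

lemma mult_coord_schwartz: "h \<in> schwartz \<Longrightarrow> (\<lambda>\<xi>. \<i> * of_real (\<xi> $ j) * h \<xi>) \<in> schwartz"
  using schwartz_cmult[OF schwartz_mult[OF slow_growth_coord]] by (simp add: mult.assoc)

text \<open>For inverse Fourier transforms the symmetry of mixed partial derivatives is evident on the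
  Fourier side.\<close>

lemma partials_pd_inv_fourier:
  "h \<in> schwartz \<Longrightarrow> partials js (pd j (inv_fourier h)) = pd j (partials js (inv_fourier h))"
proof (induction js arbitrary: h rule: rev_induct)
  case (snoc i js)
  have "pd i (pd j (inv_fourier h)) = pd j (pd i (inv_fourier h))"
    unfolding pd_inv_fourier[OF snoc.prems] pd_inv_fourier[OF mult_coord_schwartz[OF snoc.prems]]
    by (simp only: mult_ac)
  then have "partials (js @ [i]) (pd j (inv_fourier h)) = partials js (pd j (inv_fourier (\<lambda>\<xi>. \<i> * of_real (\<xi> $ i) * h \<xi>)))"
    using snoc.prems by (simp add: partials_snoc pd_inv_fourier)
  also have "\<dots> = pd j (partials js (inv_fourier (\<lambda>\<xi>. \<i> * of_real (\<xi> $ i) * h \<xi>)))"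
    by (rule snoc.IH[OF mult_coord_schwartz[OF snoc.prems]])
  finally show ?case using snoc.prems by (simp add: partials_snoc pd_inv_fourier)
qed simp

text \<open>By linearity the remainder of the average is \<open>u\<close> applied to a Taylor
  remainder of the kernel. Finite order demands bounds on the \<open>y\<close>-derivatives of that
  remainder up to order \<open>N\<close>. These are Taylor remainders of
  \<open>partials js ?\<eta>\<close> provided \<open>partials js\<close> commutes with
  \<open>pd j\<close>, which is why the kernel is taken as an inverse Fourier transform.\<close>

lemma avg_inv_fourier_pd:
  fixes h :: "real^'n \<Rightarrow> complex"
  assumes u: "u \<in> tempered_distributions" and h: "h \<in> schwartz"
  shows "avg u (inv_fourier h) differentiable (at x)"
    and "pd j (avg u (inv_fourier h)) x = avg u (pd j (inv_fourier h)) x"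
proof -
  let ?\<eta> = "inv_fourier h"
  obtain C N where bnd: "tempered_bound u C N" by (rule tempered_bound_exists[OF u])
  have \<eta>: "?\<eta> \<in> schwartz" using h by (rule inv_fourier_schwartz)
  have "\<exists>D. \<forall>js. 0 \<le> D js \<and> (\<forall>z k. norm k \<le> 1 \<longrightarrow> norm (partials js ?\<eta> (z + k) - partials js ?\<eta> z -
      (\<Sum>j\<in>UNIV. of_real (k $ j) * pd j (partials js ?\<eta>) z)) \<le> D js * (norm k)\<^sup>2 / (1 + norm z) ^ N)"
    (is "\<exists>D. \<forall>js. ?P js (D js)")
  proof (intro choice allI)
    fix js
    obtain D where D: "0 \<le> D" "\<And>z k. norm k \<le> 1 \<Longrightarrow> norm (partials js ?\<eta> (z + k) - partials js ?\<eta> z -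
      (\<Sum>j\<in>UNIV. of_real (k $ j) * pd j (partials js ?\<eta>) z)) \<le> D * (norm k)\<^sup>2 / (1 + norm z) ^ N"
      by (rule schwartz_taylor[OF schwartz_partials[OF \<eta>, of js], where N = N]) (rule that)
    show "\<exists>D. ?P js D" by (intro exI[of _ D] conjI allI impI D)
  qed
  then obtain D where D': "\<forall>js. ?P js (D js)" by (rule exE)
  have D: "\<And>js. 0 \<le> D js" "\<And>js z k. norm k \<le> 1 \<Longrightarrow> norm (partials js ?\<eta> (z + k) - partials js ?\<eta> z -
      (\<Sum>j\<in>UNIV. of_real (k $ j) * pd j (partials js ?\<eta>) z)) \<le> D js * (norm k)\<^sup>2 / (1 + norm z) ^ N"
    using D' by simp_all
  \<comment> \<open>One constant for the Taylor remainders of all derivatives up to the order of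
    \<open>u\<close>.\<close>
  define E where "E = (\<Sum>js :: 'n list | length js \<le> N. D js)"
  have bound: "norm (avg u ?\<eta> (x + k) - avg u ?\<eta> x - (\<Sum>j\<in>UNIV. of_real (k $ j) * avg u (pd j ?\<eta>) x))
      \<le> (C * (E * (1 + norm x) ^ N)) * (norm k)\<^sup>2" if k: "norm k \<le> 1" for k
  proof -
    define w where "w = (\<lambda>y. ?\<eta> (x + k - y) - ?\<eta> (x - y) - (\<Sum>j\<in>UNIV. of_real (k $ j) * pd j ?\<eta> (x - y)))"
    have S: "(\<lambda>y. ?\<eta> (z - y)) \<in> schwartz" "(\<lambda>y. pd j ?\<eta> (z - y)) \<in> schwartz" for z j
      by (intro schwartz_reflect schwartz_pd \<eta>)+
    have S3: "(\<lambda>y. \<Sum>j\<in>UNIV. of_real (k $ j) * pd j ?\<eta> (x - y)) \<in> schwartz"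
      by (intro schwartz_sum schwartz_cmult S)
    have w: "w \<in> schwartz" unfolding w_def by (intro schwartz_diff S S3)
    have "u w = u (\<lambda>y. ?\<eta> (x + k - y)) - u (\<lambda>y. ?\<eta> (x - y)) - (\<Sum>j\<in>UNIV. of_real (k $ j) * u (\<lambda>y. pd j ?\<eta> (x - y)))"
      unfolding w_def
      by (simp add: tempered_diff[OF u] tempered_sum[OF u] tempered_cmult[OF u] S S3 schwartz_diff schwartz_cmult)
    then have uw: "avg u ?\<eta> (x + k) - avg u ?\<eta> x - (\<Sum>j\<in>UNIV. of_real (k $ j) * avg u (pd j ?\<eta>) x) = u w"
      by (simp add: avg_def)
    have "norm (partials js w y) \<le> (E * (1 + norm x) ^ N * (norm k)\<^sup>2) / (1 + norm y) ^ N" if js: "length js \<le> N" for js y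
    proof -
      have sm: "smooth (\<lambda>y. ?\<eta> (z - y))" "smooth (\<lambda>y. pd j ?\<eta> (z - y))" for z j
        using S schwartz_smooth by blast+
      have "partials js w y = (-1) ^ length js * (partials js ?\<eta> (x + k - y) - partials js ?\<eta> (x - y) -
          (\<Sum>j\<in>UNIV. of_real (k $ j) * partials js (pd j ?\<eta>) (x - y)))"
        unfolding w_def
        by (simp add: partials_diff partials_sum partials_cmult sm smooth_sum smooth_cmult smooth_diff
            partials_reflect schwartz_smooth \<eta> schwartz_pd right_diff_distrib sum_distrib_left mult_ac)
      also have "x + k - y = (x - y) + k" by simp
      finally have "norm (partials js w y) = norm (partials js ?\<eta> ((x - y) + k) - partials js ?\<eta> (x - y) -
          (\<Sum>j\<in>UNIV. of_real (k $ j) * pd j (partials js ?\<eta>) (x - y)))"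
        by (simp add: norm_mult norm_power partials_pd_inv_fourier h)
      also have "\<dots> \<le> D js * (norm k)\<^sup>2 / (1 + norm (x - y)) ^ N" by (rule D(2)[OF k])
      also have "\<dots> \<le> D js * (norm k)\<^sup>2 * (1 + norm x) ^ N / (1 + norm y) ^ N"
        by (rule decay_shift) (simp add: D)
      also have "\<dots> \<le> (E * (1 + norm x) ^ N * (norm k)\<^sup>2) / (1 + norm y) ^ N"
      proof -
        have "D js \<le> E" unfolding E_def using js D(1) by (intro member_le_sum) (auto simp: finite_lists_le)
        then have "D js * ((norm k)\<^sup>2 * (1 + norm x) ^ N) \<le> E * ((norm k)\<^sup>2 * (1 + norm x) ^ N)"
          by (rule mult_right_mono) simp
        then show ?thesis by (intro divide_right_mono less_imp_le[OF one_plus_norm_power_pos]) (simp only: mult_ac)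
      qed
      finally show ?thesis .
    qed
    then have "norm (u w) \<le> C * (E * (1 + norm x) ^ N * (norm k)\<^sup>2)"
      using bnd w by (simp add: tempered_bound_def)
    then show ?thesis unfolding uw by (simp only: mult_ac)
  qed
  show "avg u ?\<eta> differentiable (at x)" "pd j (avg u ?\<eta>) x = avg u (pd j ?\<eta>) x"
    by (rule differentiable_by_quadratic_bound[where g = "\<lambda>j. avg u (pd j ?\<eta>) x"], rule bound, assumption)+
qed

lemma smooth_avg_inv_fourier:
  assumes u: "u \<in> tempered_distributions" and h: "h \<in> schwartz"
  shows "smooth (avg u (inv_fourier h))"
proof -
  have "h \<in> schwartz \<Longrightarrow> diffble n (avg u (inv_fourier h))" for n
  proof (induction n arbitrary: h)
    case (Suc n)
    have "pd j (avg u (inv_fourier h)) = avg u (inv_fourier (\<lambda>\<xi>. \<i> * of_real (\<xi> $ j) * h \<xi>))" for j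
      using avg_inv_fourier_pd(2)[OF u Suc.prems] pd_inv_fourier[OF Suc.prems] by auto
    with Suc.IH[OF mult_coord_schwartz[OF Suc.prems]] avg_inv_fourier_pd(1)[OF u Suc.prems]
    show ?case by simp
  qed auto
  with h show ?thesis by (simp add: smooth_iff_diffble)
qed

section \<open>Locally integrable functions, cut-offs and the remainder at infinity\<close>

definition loc_int :: "(real^'n \<Rightarrow> complex) \<Rightarrow> bool" where
  "loc_int f \<longleftrightarrow> f \<in> borel_measurable borel \<and> (\<forall>R. integrable lborel (\<lambda>x. indicator (cball 0 R) x *\<^sub>R f x))"

lemma loc_int_borel: "loc_int f \<Longrightarrow> f \<in> borel_measurable borel"
  by (simp add: loc_int_def)

lemma loc_int_mult:
  fixes f w :: "real^'n \<Rightarrow> complex"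
  assumes f: "loc_int f" and w: "w \<in> borel_measurable borel"
    and C: "\<And>x. norm (w x) \<le> C" and R: "\<And>x. norm x > R \<Longrightarrow> w x = 0"
  shows "integrable lborel (\<lambda>x. f x * w x)"
proof (rule Bochner_Integration.integrable_bound)
  show "integrable lborel (\<lambda>x. of_real C * (indicator (cball 0 R) x *\<^sub>R f x))"
    using f by (intro integrable_mult_right) (simp add: loc_int_def)
  show "AE x in lborel. norm (f x * w x) \<le> norm (of_real C * (indicator (cball 0 R) x *\<^sub>R f x))"
  proof (intro AE_I2)
    fix x
    have "norm (w x) \<le> \<bar>C\<bar>" using C[of x] by linarith
    from mult_right_mono[OF this norm_ge_zero[of "f x"]]
    show "norm (f x * w x) \<le> norm (of_real C * (indicator (cball 0 R) x *\<^sub>R f x))"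
      using R[of x] by (auto simp: norm_mult indicator_def mult.commute)
  qed
qed (use f w in \<open>simp add: loc_int_def borel_measurable_times\<close>)

lemma test_function_support:
  assumes "\<phi> \<in> test_functions"
  obtains R where "0 < R" "\<And>x. norm x > R \<Longrightarrow> \<phi> x = 0"
proof -
  have "bounded (closure {x. \<phi> x \<noteq> 0})"
    using assms by (auto simp: test_functions_def intro: compact_imp_bounded)
  then obtain R where R: "\<And>x. x \<in> closure {x. \<phi> x \<noteq> 0} \<Longrightarrow> norm x \<le> R"
    by (auto simp: bounded_iff)
  have "norm x \<le> R" if "\<phi> x \<noteq> 0" for x
    by (rule R, rule subsetD[OF closure_subset]) (use that in simp)
  then show ?thesis by (intro that[of "max 1 R"]) force+
qed

lemma loc_int_test:
  assumes "loc_int f" "\<phi> \<in> test_functions"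
  shows "integrable lborel (\<lambda>x. f x * \<phi> x)"
proof -
  obtain R where R: "0 < R" "\<And>x. norm x > R \<Longrightarrow> \<phi> x = 0"
    by (rule test_function_support[OF assms(2)]) (rule that)
  obtain C where C: "0 < C" "\<And>x. norm (\<phi> x) \<le> C"
    by (rule norm_bounded_schwartz[OF test_functions_schwartz[OF assms(2)]]) (rule that)
  show ?thesis
    by (rule loc_int_mult[OF assms(1) schwartz_borel[OF test_functions_schwartz[OF assms(2)]] C(2) R(2)])
qed

lemma regular_distr_borel:
  assumes "f \<in> borel_measurable borel" "\<phi> \<in> test_functions"
  shows "regular_distr f \<phi> = (LINT x|lborel. f x * \<phi> x)"
  using assms schwartz_borel[OF test_functions_schwartz[OF assms(2)]]
  by (simp add: regular_distr_def integral_completion)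

lemma given_by_test:
  assumes "given_by u f" "f \<in> borel_measurable borel" "\<phi> \<in> test_functions"
  shows "u \<phi> = (LINT x|lborel. f x * \<phi> x)"
proof -
  have "restrict u test_functions \<phi> = regular_distr f \<phi>"
    using assms(1) by (simp add: given_by_def)
  with assms show ?thesis by (simp add: regular_distr_borel)
qed

text \<open>The product vanishes with all its derivatives off the closed support of
  \<open>P\<close>, so \<open>w\<close> has to be controlled only there. With
  \<open>P = 1 - cut R\<close> this restricts attention to \<open>norm y \<ge> R\<close>, where the
  smallness of \<open>w\<close> lies.\<close>

lemma tempered_mult_bound:
  assumes u: "tempered_bound u C N" and P: "smooth P" and w: "smooth w"
    and S: "(\<lambda>y. P y * w y) \<in> schwartz" and AB: "0 \<le> A" "0 \<le> B"
    and A: "\<And>js y. length js \<le> N \<Longrightarrow> norm (partials js P y) \<le> A"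
    and B: "\<And>js y. y \<in> closure {y. P y \<noteq> 0} \<Longrightarrow> length js \<le> N \<Longrightarrow> norm (partials js w y) \<le> B / (1 + norm y) ^ N"
  shows "norm (u (\<lambda>y. P y * w y)) \<le> C * (2 ^ N * (A * B))"
proof -
  have "norm (partials js (\<lambda>y. P y * w y) y) \<le> (2 ^ N * (A * B)) / (1 + norm y) ^ N" if js: "length js \<le> N" for js y
  proof (cases "y \<in> closure {y. P y \<noteq> 0}")
    case True
    have "norm (partials js (\<lambda>y. P y * w y) y) \<le> 2 ^ length js * (A * (B / (1 + norm y) ^ N))"
      using A B True js by (intro norm_partials_mult_le P w AB) auto
    also have "\<dots> \<le> 2 ^ N * (A * (B / (1 + norm y) ^ N))"
      using js AB by (intro mult_right_mono power_increasing mult_nonneg_nonneg divide_nonneg_pos one_plus_norm_power_pos) auto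
    finally show ?thesis by simp
  next
    case False
    have "closure {y. P y * w y \<noteq> 0} \<subseteq> closure {y. P y \<noteq> 0}" by (intro closure_mono) auto
    with False have "partials js (\<lambda>y. P y * w y) y = 0"
      by (intro partials_eq_zero_outside_support) auto
    then show ?thesis using AB by (simp add: divide_nonneg_pos)
  qed
  then show ?thesis using u S by (simp add: tempered_bound_def)
qed

text \<open>For positive \<open>R\<close>: 1 on the ball of radius \<open>R\<close> and 0 beyond
  \<open>2 * R\<close>. The offset 0 puts it into the shape to which \<open>smooth_affine\<close>
  and \<open>partials_affine\<close> apply directly.\<close>

definition cut :: "real \<Rightarrow> real^'n \<Rightarrow> complex" where
  "cut R y = bump (0 + dil (\<chi> j. 1 / R) y)"

lemma dil_const: "dil (\<chi> j. a) y = a *\<^sub>R y"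
  by (simp add: vec_eq_iff)

lemma cut_eq_1: "0 < R \<Longrightarrow> norm y \<le> R \<Longrightarrow> cut R y = 1"
  by (simp add: cut_def dil_const bump_eq_1)

lemma cut_eq_0: "0 < R \<Longrightarrow> norm y \<ge> 2 * R \<Longrightarrow> cut R y = 0"
  by (simp add: cut_def dil_const bump_eq_0 pos_le_divide_eq)

lemma norm_cut_le: "norm (cut R y) \<le> 1"
  using bump_profile_bounds[of "dil (\<chi> j. 1 / R) y"] by (simp add: cut_def bump_def)

lemma smooth_cut: "smooth (cut R)"
  unfolding cut_def[abs_def] by (intro smooth_affine smooth_bump)

lemma cut_test_function: "0 < R \<Longrightarrow> cut R \<in> test_functions"
  by (rule test_functionsI[of _ "2 * R"]) (auto intro: smooth_cut cut_eq_0)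

text \<open>Every derivative of the dilated bump brings a factor \<open>1 / R \<le> 1\<close>, which
  makes the bound uniform in \<open>R\<close>.\<close>

lemma partials_cut_bound:
  obtains A where "0 < A" "\<And>R js y. 1 \<le> R \<Longrightarrow> length js \<le> N \<Longrightarrow> norm (partials js (cut R) (y::real^'n)) \<le> A"
proof -
  obtain A where A: "0 < A" "\<And>js x. length js \<le> N \<Longrightarrow> norm (partials js bump (x::real^'n)) \<le> A / (1 + norm x) ^ 0"
    by (rule schwartz_bound[OF test_functions_schwartz[OF bump_test_function], where L = N and N = 0]) (rule that)
  have "norm (partials js (cut R) (y::real^'n)) \<le> A" if R: "1 \<le> R" and js: "length js \<le> N" for R js y
  proof -
    let ?c = "(\<chi> j. 1 / R) :: real^'n"
    have "prod_list (map (($) ?c) js) = (1 / R) ^ length js"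
      by (induction js) auto
    moreover have "(1 / R) ^ length js \<le> 1" using R by (intro power_le_one) auto
    ultimately have "\<bar>prod_list (map (($) ?c) js)\<bar> \<le> 1" using R by simp
    then have "\<bar>prod_list (map (($) ?c) js)\<bar> * norm (partials js bump (0 + dil ?c y)) \<le> 1 * A"
      using A(2)[OF js] A(1) by (intro mult_mono) auto
    then show ?thesis
      unfolding cut_def[abs_def] partials_affine[OF smooth_bump] by (simp add: norm_mult)
  qed
  with A(1) show ?thesis using that by blast
qed

lemma partials_one_minus_bound:
  assumes "smooth P" "norm (partials js P y) \<le> A"
  shows "norm (partials js (\<lambda>y. 1 - P y) y) \<le> 1 + A"
  using assms norm_triangle_ineq4[of "partials js (\<lambda>y. 1) y" "partials js P y"]
  by (simp add: partials_diff smooth_const partials_const split: if_splits)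

lemma one_minus_cut_support:
  assumes "0 < R" shows "closure {y. 1 - cut R y \<noteq> 0} \<subseteq> {y :: real^'n. R \<le> norm y}"
proof (rule closure_minimal)
  show "{y. 1 - cut R y \<noteq> 0} \<subseteq> {y :: real^'n. R \<le> norm y}"
    using cut_eq_1[OF assms] by force
  show "closed {y :: real^'n. R \<le> norm y}"
    by (intro closed_Collect_le continuous_intros)
qed

text \<open>Where \<open>1 - cut R\<close> lives one has \<open>R \<le> norm y\<close>. One power of
  decay beyond the order of \<open>u\<close>, hence \<open>Suc N\<close>, therefore becomes the
  factor \<open>1 / R\<close>. The constants depend on \<open>u\<close> alone, which permits
  application to a whole family of \<open>w\<close>.\<close>

lemma cut_remainder_bound:
  fixes u :: "(real^'n \<Rightarrow> complex) \<Rightarrow> complex"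
  assumes u: "u \<in> tempered_distributions"
  shows "\<exists>K\<ge>0. \<exists>N. \<forall>w\<in>schwartz. \<forall>B\<ge>0. \<forall>R\<ge>1.
    (\<forall>js y. length js \<le> N \<longrightarrow> norm (partials js w y) \<le> B / (1 + norm y) ^ Suc N) \<longrightarrow>
    norm (u w - u (\<lambda>y. cut R y * w y)) \<le> K * B / R"
proof -
  obtain C N where bnd: "tempered_bound u C N" by (rule tempered_bound_exists[OF u])
  obtain A where A: "0 < A" "\<And>R js y. 1 \<le> R \<Longrightarrow> length js \<le> N \<Longrightarrow> norm (partials js (cut R) (y::real^'n)) \<le> A"
    by (rule partials_cut_bound[where N = N]) (rule that)
  have "norm (u w - u (\<lambda>y. cut R y * w y)) \<le> (C * (2 ^ N * (1 + A))) * B / R"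
    if w: "w \<in> schwartz" and B: "0 \<le> B" and R: "1 \<le> R"
      and le: "\<And>js y. length js \<le> N \<Longrightarrow> norm (partials js w y) \<le> B / (1 + norm y) ^ Suc N" for w B R
  proof -
    have R0: "0 < R" using R by simp
    have S1: "(\<lambda>y. cut R y * w y) \<in> schwartz"
      by (intro schwartz_mult schwartz_slow_growth test_functions_schwartz cut_test_function R0 w)
    have eq: "(\<lambda>y. (1 - cut R y) * w y) = (\<lambda>y. w y - cut R y * w y)" by (simp add: left_diff_distrib)
    have S2: "(\<lambda>y. (1 - cut R y) * w y) \<in> schwartz" unfolding eq by (intro schwartz_diff w S1)
    have "norm (u (\<lambda>y. (1 - cut R y) * w y)) \<le> C * (2 ^ N * ((1 + A) * (B / R)))"
    proof (rule tempered_mult_bound[OF bnd _ schwartz_smooth[OF w] S2])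
      show "smooth (\<lambda>y. 1 - cut R y)" by (intro smooth_diff smooth_const smooth_cut)
      fix js :: "'n list" and y :: "real^'n" assume js: "length js \<le> N"
      show "norm (partials js (\<lambda>y. 1 - cut R y) y) \<le> 1 + A"
        by (intro partials_one_minus_bound smooth_cut A(2) R js)
      assume "y \<in> closure {y. 1 - cut R y \<noteq> 0}"
      then have y: "R \<le> norm y" using one_minus_cut_support[OF R0] by blast
      have "B / (1 + norm y) ^ Suc N \<le> B / (R * (1 + norm y) ^ N)"
        using B R0 y by (intro divide_left_mono) (auto intro!: mult_right_mono mult_pos_pos)
      with le[OF js, of y] show "norm (partials js w y) \<le> B / R / (1 + norm y) ^ N"
        by (simp add: divide_divide_eq_left)
    qed (use A B R in auto)
    then show ?thesis
      unfolding eq by (simp add: tempered_diff[OF u w S1] mult.assoc)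
  qed
  moreover have "0 \<le> C * (2 ^ N * (1 + A))"
    using bnd A(1) by (simp add: tempered_bound_def)
  ultimately show ?thesis by blast
qed

lemma reflect_uniform_bound:
  fixes \<eta> :: "real^'n \<Rightarrow> complex"
  assumes \<eta>: "\<eta> \<in> schwartz"
  shows "\<exists>B\<ge>0. \<forall>x js y. norm x \<le> r \<longrightarrow> length js \<le> L \<longrightarrow>
    norm (partials js (\<lambda>y. \<eta> (x - y)) y) \<le> B / (1 + norm y) ^ N"
proof -
  obtain B where B: "0 < B" "\<And>js x. length js \<le> L \<Longrightarrow> norm (partials js \<eta> x) \<le> B / (1 + norm x) ^ N"
    by (rule schwartz_bound[OF \<eta>, where L = L and N = N]) (rule that)
  have "norm (partials js (\<lambda>y. \<eta> (x - y)) y) \<le> (B * (1 + \<bar>r\<bar>) ^ N) / (1 + norm y) ^ N"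
    if x: "norm x \<le> r" and js: "length js \<le> L" for x js y
  proof -
    have "norm (partials js (\<lambda>y. \<eta> (x - y)) y) \<le> B / (1 + norm (x - y)) ^ N"
      using B(2)[OF js, of "x - y"] by (simp add: partials_reflect schwartz_smooth \<eta> norm_mult norm_power)
    also have "\<dots> \<le> B * (1 + norm x) ^ N / (1 + norm y) ^ N"
      by (rule decay_shift) (use B in simp)
    also have "\<dots> \<le> (B * (1 + \<bar>r\<bar>) ^ N) / (1 + norm y) ^ N"
      using x B by (intro divide_right_mono mult_left_mono power_mono less_imp_le[OF one_plus_norm_power_pos]) auto
    finally show ?thesis .
  qed
  then show ?thesis using B by (intro exI[of _ "B * (1 + \<bar>r\<bar>) ^ N"]) auto
qed

text \<open>Since \<open>u\<close> is an integral against \<open>f\<close> on test functions only, Fubini's theorem is applied to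
  \<open>y \<mapsto> cut R y * \<eta>(x - y)\<close>, and the error made is \<open>O(1/R)\<close> uniformly for \<open>x\<close> in the support of \<open>\<phi>\<close>.\<close>

theorem tempered_convT_exchange:
  fixes f \<phi> h :: "real^'n \<Rightarrow> complex"
  assumes u: "given_by u f" and f: "loc_int f" and h: "h \<in> schwartz" and \<phi>: "\<phi> \<in> test_functions"
  shows "u (convT (inv_fourier h) \<phi>) = (LINT x|lborel. avg u (inv_fourier h) x * \<phi> x)"
proof -
  let ?\<eta> = "inv_fourier h"
  have ut: "u \<in> tempered_distributions" using u by (simp add: given_by_def)
  have \<eta>: "?\<eta> \<in> schwartz" using h by (rule inv_fourier_schwartz)
  have \<phi>S: "\<phi> \<in> schwartz" using \<phi> by (rule test_functions_schwartz)
  have T: "convT ?\<eta> \<phi> \<in> schwartz" by (intro convT_schwartz \<phi>S \<eta>)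
  note [measurable] = schwartz_borel[OF \<phi>S] schwartz_borel[OF \<eta>] loc_int_borel[OF f]
  obtain r where r: "0 < r" "\<And>x. norm x > r \<Longrightarrow> \<phi> x = 0"
    by (rule test_function_support[OF \<phi>]) (rule that)
  obtain K N where K: "0 \<le> K" and KN: "\<forall>w\<in>schwartz. \<forall>B\<ge>0. \<forall>R\<ge>1.
    (\<forall>js y. length js \<le> N \<longrightarrow> norm (partials js w y) \<le> B / (1 + norm y) ^ Suc N) \<longrightarrow>
    norm (u w - u (\<lambda>y. cut R y * w y)) \<le> K * B / R"
    using cut_remainder_bound[OF ut] by blast
  obtain B where B: "0 \<le> B" "\<forall>x js y. norm x \<le> r \<longrightarrow> length js \<le> N \<longrightarrow>
    norm (partials js (\<lambda>y. ?\<eta> (x - y)) y) \<le> B / (1 + norm y) ^ Suc N"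
    using reflect_uniform_bound[OF \<eta>] by blast
  obtain B' where B': "0 < B'" "\<And>js y. length js \<le> N \<Longrightarrow> norm (partials js (convT ?\<eta> \<phi>) y) \<le> B' / (1 + norm y) ^ Suc N"
    by (rule schwartz_bound[OF T, where L = N and N = "Suc N"]) (rule that)
  obtain C where C: "0 < C" "\<And>x. norm (?\<eta> x) \<le> C"
    by (rule norm_bounded_schwartz[OF \<eta>]) (rule that)
  let ?lhs = "u (convT ?\<eta> \<phi>)" and ?rhs = "LINT x|lborel. avg u ?\<eta> x * \<phi> x"
  let ?I = "LINT x|lborel. norm (\<phi> x)"
  have i\<phi>: "integrable lborel \<phi>" using \<phi>S by (rule schwartz_integrable)
  have ia: "integrable lborel (\<lambda>x. avg u ?\<eta> x * \<phi> x)"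
    by (intro schwartz_integrable test_functions_schwartz test_functions_mult smooth_avg_inv_fourier ut h \<phi>)
  have main: "norm (?lhs - ?rhs) \<le> (K * B' + K * B * ?I) / R" if R: "1 \<le> R" for R
  proof -
    have R0: "0 < R" using R by simp
    \<comment> \<open>The counterpart of \<open>avg u ?\<eta>\<close> with the argument of
      \<open>u\<close> cut off to a test function. For it \<open>u\<close> is an integral against
      \<open>f\<close>, and Fubini applies.\<close>
    define b where "b x = u (\<lambda>y. cut R y * ?\<eta> (x - y))" for x
    let ?H = "\<lambda>y x. (f y * cut R y) * (\<phi> x * ?\<eta> (x - y))"
    have ct: "(\<lambda>y. cut R y * w y) \<in> test_functions" if "w \<in> schwartz" for w
      using test_functions_mult[OF schwartz_smooth[OF that] cut_test_function[OF R0]] by (simp add: mult.commute)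
    note [measurable] = smooth_borel[OF smooth_cut, of R]
    have iF: "integrable lborel (\<lambda>y. f y * cut R y)"
      by (intro loc_int_test f cut_test_function R0)
    have iH: "integrable (lborel \<Otimes>\<^sub>M lborel) (case_prod ?H)"
    proof (rule integrable_pair_bound[OF iF i\<phi>, where K = C])
      fix y x
      have "norm (?\<eta> (x - y)) \<le> C" by (rule C)
      then have "(norm (f y * cut R y) * norm (\<phi> x)) * norm (?\<eta> (x - y)) \<le> (norm (f y * cut R y) * norm (\<phi> x)) * C"
        by (rule mult_left_mono) simp
      then show "norm (case (y, x) of (y, x) \<Rightarrow> ?H y x) \<le> C * (norm (f y * cut R y) * norm (\<phi> x))"
        by (simp add: norm_mult mult_ac)
    qed measurable
    have b: "(LINT y|lborel. ?H y x) = b x * \<phi> x" for x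
    proof -
      have "b x = (LINT y|lborel. f y * (cut R y * ?\<eta> (x - y)))"
        unfolding b_def by (intro given_by_test[OF u] ct schwartz_reflect \<eta>) measurable
      moreover have "?H y x = f y * (cut R y * ?\<eta> (x - y)) * \<phi> x" for y by (simp only: mult_ac)
      ultimately show ?thesis by (simp only: integral_mult_left_zero)
    qed
    \<comment> \<open>Measurability and integrability of \<open>b\<close> times
      \<open>\<phi>\<close> are delivered by Fubini's theorem along with the exchange.\<close>
    have ib: "integrable lborel (\<lambda>x. b x * \<phi> x)"
      using lborel_pair.integrable_snd[OF iH] by (simp only: b)
    have "u (\<lambda>y. cut R y * convT ?\<eta> \<phi> y) = (LINT y|lborel. f y * (cut R y * convT ?\<eta> \<phi> y))"
      by (intro given_by_test[OF u] ct T) measurable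
    also have "\<dots> = (LINT y|lborel. (LINT x|lborel. ?H y x))"
      unfolding convT_def by (simp only: integral_mult_right_zero mult.assoc)
    also have "\<dots> = (LINT x|lborel. b x * \<phi> x)"
      using lborel_pair.Fubini_integral[OF iH] by (simp only: b)
    finally have cutT: "u (\<lambda>y. cut R y * convT ?\<eta> \<phi> y) = (LINT x|lborel. b x * \<phi> x)" .
    have 1: "norm (?lhs - (LINT x|lborel. b x * \<phi> x)) \<le> K * B' / R"
      unfolding cutT[symmetric] using KN[rule_format, OF T less_imp_le[OF B'(1)] R] B'(2) by blast
    have "norm ((LINT x|lborel. b x * \<phi> x) - ?rhs) = norm (LINT x|lborel. b x * \<phi> x - avg u ?\<eta> x * \<phi> x)"
      using ib ia by simp
    also have "\<dots> \<le> (LINT x|lborel. (K * B / R) * norm (\<phi> x))"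
    proof (rule Bochner_Integration.integral_norm_bound_integral)
      show "integrable lborel (\<lambda>x. b x * \<phi> x - avg u ?\<eta> x * \<phi> x)" using ib ia by simp
      show "integrable lborel (\<lambda>x. (K * B / R) * norm (\<phi> x))" by (intro integrable_mult_right integrable_norm i\<phi>)
      fix x
      show "norm (b x * \<phi> x - avg u ?\<eta> x * \<phi> x) \<le> (K * B / R) * norm (\<phi> x)"
      proof (cases "norm x \<le> r")
        case True
        have "norm (u (\<lambda>y. ?\<eta> (x - y)) - u (\<lambda>y. cut R y * ?\<eta> (x - y))) \<le> K * B / R"
          using KN[rule_format, OF schwartz_reflect[OF \<eta>] B(1) R, of x] B(2) True by blast
        then have "norm (b x - avg u ?\<eta> x) \<le> K * B / R"
          by (simp only: b_def avg_def norm_minus_commute)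
        from mult_right_mono[OF this norm_ge_zero[of "\<phi> x"]] show ?thesis
          by (simp add: norm_mult[symmetric] left_diff_distrib)
      next
        case False
        with r(2)[of x] show ?thesis by simp
      qed
    qed
    also have "\<dots> = (K * B / R) * ?I" by (rule integral_mult_right_zero)
    finally have 2: "norm ((LINT x|lborel. b x * \<phi> x) - ?rhs) \<le> (K * B / R) * ?I" .
    have "norm (?lhs - ?rhs) \<le> norm (?lhs - (LINT x|lborel. b x * \<phi> x)) + norm ((LINT x|lborel. b x * \<phi> x) - ?rhs)"
      using norm_triangle_ineq[of "?lhs - (LINT x|lborel. b x * \<phi> x)" "(LINT x|lborel. b x * \<phi> x) - ?rhs"] by simp
    with 1 2 show ?thesis by (simp add: add_divide_distrib)
  qed
  have "(\<lambda>n. (K * B' + K * B * ?I) / real (Suc n)) \<longlonglongrightarrow> 0"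
    using tendsto_mult_right_zero[OF LIMSEQ_inverse_real_of_nat, of "K * B' + K * B * ?I"] by (simp add: divide_inverse)
  moreover have "norm (?lhs - ?rhs) \<le> (K * B' + K * B * ?I) / real (Suc n)" for n
    by (rule main) simp
  ultimately have "norm (?lhs - ?rhs) \<le> 0"
    by (intro tendsto_lowerbound[where F = sequentially]) auto
  then show ?thesis by simp
qed

section \<open>Approximate identities\<close>

text \<open>The Jacobian in front makes this the dilation that preserves both the integral and the
  integral of the modulus, which gives bounds on the kernels independent of
  \<open>k\<close>.\<close>

lemma kern_dil:
  fixes \<psi> :: "real^'n \<Rightarrow> complex"
  assumes \<psi>: "\<psi> \<in> schwartz"
  defines "d \<equiv> \<lambda>k M. (\<chi> j. 2 powr (real k * M $ j)) :: real^'n"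
  shows "kern M \<psi> k = (\<lambda>x. of_real (jac (d k M)) * inv_fourier \<psi> (0 + dil (d k M) x))"
proof
  fix x
  let ?c = "(\<chi> j. 2 powr (- real k * M $ j)) :: real^'n"
  have c: "\<And>j. ?c $ j \<noteq> 0" by simp
  have "x = dil ?c (dil (d k M) x)"
    by (simp add: vec_eq_iff d_def mult.assoc[symmetric] powr_add[symmetric])
  then have "kern M \<psi> k x = inv_fourier (\<lambda>\<xi>. \<psi> (dil ?c \<xi>)) (dil ?c (dil (d k M) x))"
    by (simp add: kern_def dilate_eq_dil)
  also have "\<dots> = of_real (inverse (jac ?c)) * inv_fourier \<psi> (dil (d k M) x)"
    by (rule inv_fourier_dil[OF \<psi> c])
  also have "inverse (jac ?c) = jac (d k M)"
    by (simp add: jac_def d_def prod_inversef[symmetric] powr_minus[symmetric])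
  finally show "kern M \<psi> k x = of_real (jac (d k M)) * inv_fourier \<psi> (0 + dil (d k M) x)" by simp
qed

lemma nn_integral_kern:
  fixes \<psi> :: "real^'n \<Rightarrow> complex"
  assumes \<psi>: "\<psi> \<in> schwartz"
  shows "(\<integral>\<^sup>+x. norm (kern M \<psi> k x) \<partial>lborel) = (\<integral>\<^sup>+x. norm (inv_fourier \<psi> x) \<partial>lborel)"
proof -
  let ?d = "(\<chi> j. 2 powr (real k * M $ j)) :: real^'n"
  have d: "\<And>j. ?d $ j \<noteq> 0" by simp
  note [measurable] = schwartz_borel[OF inv_fourier_schwartz[OF \<psi>]]
  have j: "0 < jac ?d" by (rule jac_pos[OF d])
  have "(\<integral>\<^sup>+x. norm (kern M \<psi> k x) \<partial>lborel) =
      (\<integral>\<^sup>+x. ennreal (jac ?d) * ennreal (norm (inv_fourier \<psi> (0 + dil ?d x))) \<partial>lborel)"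
    unfolding kern_dil[OF \<psi>] using j by (simp add: norm_mult ennreal_mult)
  also have "\<dots> = ennreal (jac ?d) * (\<integral>\<^sup>+x. ennreal (norm (inv_fourier \<psi> (0 + dil ?d x))) \<partial>lborel)"
    by (rule nn_integral_cmult) measurable
  also have "\<dots> = (\<integral>\<^sup>+x. norm (inv_fourier \<psi> x) \<partial>lborel)"
    by (rule nn_integral_dil[OF d, symmetric]) measurable
  finally show ?thesis .
qed

lemma integral_kern:
  assumes "\<psi> \<in> schwartz" shows "(LINT x|lborel. kern M \<psi> k x) = \<psi> 0"
proof -
  have "(LINT x|lborel. kern M \<psi> k x) = dilate M k \<psi> 0"
    unfolding kern_def by (rule integral_inv_fourier[OF dilate_schwartz[OF assms]])
  moreover have "dil (\<chi> j. 2 powr (- real k * M $ j)) 0 = 0" by (simp add: vec_eq_iff)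
  ultimately show ?thesis by (simp add: dilate_eq_dil)
qed

text \<open>The Jacobian and the derivatives cost a fixed power of \<open>t = 2 ^ k\<close>. As
  every weight is at least 1, the dilated point has norm at least \<open>t * \<delta>\<close>, so
  the rapid decay of the undilated kernel repays any such power and one more.\<close>

lemma kern_tail:
  fixes \<psi> :: "real^'n \<Rightarrow> complex"
  assumes \<psi>: "\<psi> \<in> schwartz" and M: "\<And>j. 1 \<le> M $ j" and \<delta>: "0 < \<delta>"
  shows "\<exists>C\<ge>0. \<forall>k js z. length js \<le> L \<longrightarrow> \<delta> \<le> norm z \<longrightarrow>
    norm (partials js (kern M \<psi> k) z) \<le> C / 2 ^ k / (1 + norm z) ^ N"
proof -
  let ?\<eta> = "inv_fourier \<psi>"
  have \<eta>: "?\<eta> \<in> schwartz" using \<psi> by (rule inv_fourier_schwartz)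
  obtain m :: nat where m: "\<And>j. M $ j \<le> real m"
  proof -
    obtain m :: nat where "Max (range (\<lambda>j. M $ j)) \<le> real m" using real_arch_simple by blast
    then show ?thesis using that[of m] by simp
  qed
  \<comment> \<open>Powers of \<open>t\<close> lost: \<open>m\<close> for each of the
    \<open>CARD('n)\<close> factors of the Jacobian, and at most \<open>m\<close> for each of at
    most \<open>L\<close> derivatives, where \<open>m\<close> bounds the weights.\<close>
  define P where "P = m * CARD('n) + m * L"
  \<comment> \<open>One power more than is lost produces \<open>1 / 2 ^ k\<close>; \<open>N\<close>
    further ones produce the decay in \<open>z\<close>.\<close>
  define Q where "Q = Suc P + N"
  obtain C where C: "0 < C" "\<And>js x. length js \<le> L \<Longrightarrow> norm (partials js ?\<eta> x) \<le> C / (1 + norm x) ^ Q"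
    by (rule schwartz_bound[OF \<eta>, where L = L and N = Q]) (rule that)
  have "norm (partials js (kern M \<psi> k) z) \<le> (C / \<delta> ^ Suc P) / 2 ^ k / (1 + norm z) ^ N"
    if js: "length js \<le> L" and z: "\<delta> \<le> norm z" for k js z
  proof -
    let ?d = "(\<chi> j. 2 powr (real k * M $ j)) :: real^'n"
    define t where "t = (2::real) ^ k"
    have t1: "1 \<le> t" by (simp add: t_def)
    have dl: "t \<le> ?d $ j" for j
    proof -
      have "real k * 1 \<le> real k * M $ j" using M[of j] by (intro mult_left_mono) auto
      then have "2 powr real k \<le> 2 powr (real k * M $ j)" by (intro powr_mono) auto
      then show ?thesis by (simp add: t_def powr_realpow)
    qed
    have du: "?d $ j \<le> t ^ m" for j
    proof -
      have "real k * M $ j \<le> real (k * m)" using m[of j] by (simp add: mult_left_mono)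
      then have "2 powr (real k * M $ j) \<le> 2 powr real (k * m)" by (intro powr_mono) auto
      also have "\<dots> = t ^ m" by (subst powr_realpow) (simp_all add: t_def power_mult)
      finally show ?thesis by simp
    qed
    have d0: "0 \<le> ?d $ j" for j by simp
    have j: "\<bar>jac ?d\<bar> \<le> t ^ (m * CARD('n))"
    proof -
      have "jac ?d \<le> (\<Prod>j\<in>(UNIV::'n set). t ^ m)"
        unfolding jac_def using du d0 by (intro prod_mono) auto
      moreover have "0 \<le> jac ?d" by (auto simp: jac_def intro: prod_nonneg)
      ultimately show ?thesis by (simp add: power_mult)
    qed
    have pl: "\<bar>prod_list (map (($) ?d) js)\<bar> \<le> t ^ (m * L)"
    proof -
      have "\<bar>prod_list (map (($) ?d) js)\<bar> \<le> (t ^ m) ^ length js"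
      proof (induction js)
        case (Cons i ks)
        have "\<bar>?d $ i\<bar> \<le> t ^ m" using du[of i] d0[of i] by linarith
        then have "\<bar>?d $ i\<bar> * \<bar>prod_list (map (($) ?d) ks)\<bar> \<le> t ^ m * (t ^ m) ^ length ks"
          using t1 by (intro mult_mono Cons) auto
        then show ?case by (simp only: list.map prod_list.Cons abs_mult length_Cons power_Suc)
      qed simp
      also have "\<dots> \<le> (t ^ m) ^ L" using t1 js by (intro power_increasing) auto
      finally show ?thesis by (simp add: power_mult)
    qed
    have nz: "t * norm z \<le> norm (dil ?d z)"
    proof -
      have "norm (t *\<^sub>R z) \<le> norm (dil ?d z)"
      proof (rule norm_le_componentwise_cart)
        fix i
        show "norm ((t *\<^sub>R z) $ i) \<le> norm (dil ?d z $ i)"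
          using dl[of i] t1 by (simp add: abs_mult mult_right_mono)
      qed
      then show ?thesis using t1 by simp
    qed
    have low: "(t * \<delta>) ^ Suc P * (1 + norm z) ^ N \<le> (1 + norm (0 + dil ?d z)) ^ Q"
    proof -
      have a: "t * \<delta> \<le> 1 + norm (0 + dil ?d z)"
      proof -
        have "t * \<delta> \<le> t * norm z" using z t1 by (intro mult_left_mono) auto
        with nz show ?thesis unfolding add_0 by linarith
      qed
      have b: "1 + norm z \<le> 1 + norm (0 + dil ?d z)"
      proof -
        have "1 * norm z \<le> t * norm z" using t1 by (intro mult_right_mono) auto
        with nz show ?thesis unfolding add_0 by linarith
      qed
      show ?thesis unfolding Q_def power_add
        using t1 \<delta> by (intro mult_mono power_mono[OF a] power_mono[OF b]) auto
    qed
    have "norm (partials js (kern M \<psi> k) z) =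
        \<bar>jac ?d\<bar> * (\<bar>prod_list (map (($) ?d) js)\<bar> * norm (partials js ?\<eta> (0 + dil ?d z)))"
      unfolding kern_dil[OF \<psi>]
      by (simp only: partials_cmult[OF smooth_affine[OF schwartz_smooth[OF \<eta>]]]
          partials_affine[OF schwartz_smooth[OF \<eta>]] norm_mult norm_of_real)
    also have "\<dots> \<le> t ^ (m * CARD('n)) * (t ^ (m * L) * (C / (1 + norm (0 + dil ?d z)) ^ Q))"
      using t1 by (intro mult_mono j pl C(2) js) auto
    also have "\<dots> = t ^ P * (C / (1 + norm (0 + dil ?d z)) ^ Q)"
      by (simp add: P_def power_add)
    also have "\<dots> \<le> t ^ P * (C / ((t * \<delta>) ^ Suc P * (1 + norm z) ^ N))"
      using t1 \<delta> C(1) low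
      by (intro mult_left_mono divide_left_mono mult_pos_pos zero_less_power one_plus_norm_power_pos) auto
    also have "\<dots> = (C / \<delta> ^ Suc P) / t / (1 + norm z) ^ N"
      using t1 \<delta> by (simp add: power_mult_distrib field_simps)
    finally show ?thesis by (simp only: t_def)
  qed
  then show ?thesis using C(1) \<delta> by (intro exI[of _ "C / \<delta> ^ Suc P"]) auto
qed

text \<open>If \<open>norm x \<le> R / 2\<close> and \<open>norm y \<ge> R\<close>, then
  \<open>x - y\<close> has norm at least \<open>R / 2\<close>. Only the tail of the kernel is met,
  and \<open>kern_tail\<close> with \<open>\<delta> = R / 2\<close> applies. The constant may depend
  on \<open>R\<close>, which stays fixed while \<open>k\<close> grows.\<close>

lemma cut_complement_tail:
  fixes u :: "(real^'n \<Rightarrow> complex) \<Rightarrow> complex"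
  assumes u: "u \<in> tempered_distributions" and \<psi>: "\<psi> \<in> schwartz" and M: "\<And>j. 1 \<le> M $ j"
    and R: "1 \<le> R"
  shows "\<exists>E\<ge>0. \<forall>k x. norm x \<le> R / 2 \<longrightarrow>
    norm (u (\<lambda>y. (1 - cut R y) * kern M \<psi> k (x - y))) \<le> E / 2 ^ k"
proof -
  obtain C N where bnd: "tempered_bound u C N" by (rule tempered_bound_exists[OF u])
  obtain A where A: "0 < A" "\<And>R js y. 1 \<le> R \<Longrightarrow> length js \<le> N \<Longrightarrow> norm (partials js (cut R) (y::real^'n)) \<le> A"
    by (rule partials_cut_bound[where N = N]) (rule that)
  have R2: "0 < R / 2" and R0: "0 < R" using R by auto
  obtain D where D: "0 \<le> D" "\<forall>k js z. length js \<le> N \<longrightarrow> R / 2 \<le> norm z \<longrightarrow>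
    norm (partials js (kern M \<psi> k) z) \<le> D / 2 ^ k / (1 + norm z) ^ N"
    using kern_tail[OF \<psi> M R2] by blast
  have "norm (u (\<lambda>y. (1 - cut R y) * kern M \<psi> k (x - y))) \<le> (C * (2 ^ N * ((1 + A) * (D * (1 + R) ^ N)))) / 2 ^ k"
    if x: "norm x \<le> R / 2" for k x
  proof -
    let ?\<eta> = "kern M \<psi> k"
    have \<eta>: "?\<eta> \<in> schwartz" using \<psi> by (rule kern_schwartz)
    have w: "(\<lambda>y. ?\<eta> (x - y)) \<in> schwartz" using \<eta> by (rule schwartz_reflect)
    have S1: "(\<lambda>y. cut R y * ?\<eta> (x - y)) \<in> schwartz"
      by (intro schwartz_mult schwartz_slow_growth test_functions_schwartz cut_test_function R0 w)
    have S2: "(\<lambda>y. (1 - cut R y) * ?\<eta> (x - y)) \<in> schwartz"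
      using schwartz_diff[OF w S1] by (simp add: left_diff_distrib)
    have "norm (u (\<lambda>y. (1 - cut R y) * ?\<eta> (x - y))) \<le> C * (2 ^ N * ((1 + A) * (D / 2 ^ k * (1 + R) ^ N)))"
    proof (rule tempered_mult_bound[OF bnd _ schwartz_smooth[OF w] S2])
      show "smooth (\<lambda>y. 1 - cut R y)" by (intro smooth_diff smooth_const smooth_cut)
      fix js :: "'n list" and y :: "real^'n" assume js: "length js \<le> N"
      show "norm (partials js (\<lambda>y. 1 - cut R y) y) \<le> 1 + A"
        by (intro partials_one_minus_bound smooth_cut A(2) R js)
      assume "y \<in> closure {y. 1 - cut R y \<noteq> 0}"
      then have y: "R \<le> norm y" using one_minus_cut_support[OF R0] by blast
      have "norm y \<le> norm x + norm (x - y)" using norm_triangle_ineq4[of x "x - y"] by simp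
      with x y have xy: "R / 2 \<le> norm (x - y)" by linarith
      have "norm (partials js (\<lambda>y. ?\<eta> (x - y)) y) \<le> D / 2 ^ k / (1 + norm (x - y)) ^ N"
        using D(2)[rule_format, OF js xy] by (simp add: partials_reflect schwartz_smooth \<eta> norm_mult norm_power)
      also have "\<dots> \<le> D / 2 ^ k * (1 + norm x) ^ N / (1 + norm y) ^ N"
        by (rule decay_shift) (use D in simp)
      also have "\<dots> \<le> D / 2 ^ k * (1 + R) ^ N / (1 + norm y) ^ N"
        using x D R0 by (intro divide_right_mono mult_left_mono power_mono less_imp_le[OF one_plus_norm_power_pos]) auto
      finally show "norm (partials js (\<lambda>y. ?\<eta> (x - y)) y) \<le> D / 2 ^ k * (1 + R) ^ N / (1 + norm y) ^ N" .
    qed (use A D R0 in auto)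
    then show ?thesis by simp
  qed
  moreover have "0 \<le> C * (2 ^ N * ((1 + A) * (D * (1 + R) ^ N)))"
    using bnd A D R0 by (simp add: tempered_bound_def)
  ultimately show ?thesis by blast
qed

section \<open>Convolution of integrable functions with Schwartz kernels\<close>

definition conv :: "(real^'n \<Rightarrow> complex) \<Rightarrow> (real^'n \<Rightarrow> complex) \<Rightarrow> real^'n \<Rightarrow> complex" where
  "conv F \<eta> x = (LINT y|lborel. F y * \<eta> (x - y))"

lemma smooth_conv:
  assumes "integrable lborel F" "\<eta> \<in> schwartz"
  shows "smooth (conv F \<eta>)"
proof -
  have "conv F \<eta> = convT (\<lambda>z. \<eta> (0 - z)) F"
    by (auto simp: conv_def convT_def)
  then show ?thesis using smooth_convT[OF assms(1) schwartz_reflect[OF assms(2), of 0]] by (simp only:)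
qed

lemma integrable_reflect:
  fixes g :: "real^'n \<Rightarrow> complex"
  assumes "integrable lborel g"
  shows "integrable lborel (\<lambda>y. g (z - y))"
proof -
  note [measurable] = borel_measurable_integrable[OF assms]
  have "(\<integral>\<^sup>+y. ennreal (norm (g (z - y))) \<partial>lborel) = (\<integral>\<^sup>+y. ennreal (norm (g y)) \<partial>lborel)"
    by (rule nn_integral_reflect[of "\<lambda>y. ennreal (norm (g y))"]) measurable
  then show ?thesis using assms by (simp add: integrable_iff_bounded)
qed

lemma integrable_conv_integrand:
  assumes F: "integrable lborel F" and \<eta>: "\<eta> \<in> schwartz"
  shows "integrable lborel (\<lambda>y. F (x - y) * \<eta> y)"
  using integrable_mult_shift[OF integrable_reflect[OF F, of x] \<eta>, of 0] by simp

lemma conv_alt: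
  assumes F: "integrable lborel F" and \<eta>: "\<eta> \<in> schwartz"
  shows "conv F \<eta> x = (LINT y|lborel. F (x - y) * \<eta> y)"
proof -
  note [measurable] = borel_measurable_integrable[OF F] schwartz_borel[OF \<eta>]
  have "(LINT y|lborel. F (x - y) * \<eta> (x - (x - y))) = (LINT y|lborel. F y * \<eta> (x - y))"
    by (rule integral_reflect) measurable
  then show ?thesis by (simp add: conv_def)
qed

text \<open>Valid for every \<open>f\<close>: the Bochner integral of a non-integrable function is 0
  by convention.\<close>

lemma norm_integral_le_nn_integral:
  fixes f :: "'a \<Rightarrow> complex"
  shows "ennreal (norm (integral\<^sup>L M f)) \<le> (\<integral>\<^sup>+x. norm (f x) \<partial>M)"
  by (cases "integrable M f") (auto intro: integral_norm_bound_ennreal simp: not_integrable_integral_eq)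

text \<open>Young's inequality for two integrable functions. It controls the mixed terms in
  \<open>avg_product_tendsto\<close>.\<close>

lemma nn_integral_conv_le:
  fixes F \<eta> :: "real^'n \<Rightarrow> complex"
  assumes F: "integrable lborel F" and \<eta>: "\<eta> \<in> schwartz"
  shows "(\<integral>\<^sup>+x. norm (conv F \<eta> x) \<partial>lborel) \<le> (\<integral>\<^sup>+x. norm (F x) \<partial>lborel) * (\<integral>\<^sup>+x. norm (\<eta> x) \<partial>lborel)"
proof -
  note [measurable] = borel_measurable_integrable[OF F] schwartz_borel[OF \<eta>]
  have "(\<integral>\<^sup>+x. norm (conv F \<eta> x) \<partial>lborel) \<le> (\<integral>\<^sup>+x. (\<integral>\<^sup>+y. ennreal (norm (F y)) * ennreal (norm (\<eta> (x - y))) \<partial>lborel) \<partial>lborel)"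
    unfolding conv_def
    by (intro nn_integral_mono order_trans[OF norm_integral_le_nn_integral])
       (simp add: norm_mult ennreal_mult)
  also have "\<dots> = (\<integral>\<^sup>+y. (\<integral>\<^sup>+x. ennreal (norm (F y)) * ennreal (norm (\<eta> (x - y))) \<partial>lborel) \<partial>lborel)"
    by (rule lborel_pair.Fubini'[symmetric]) measurable
  also have "\<dots> = (\<integral>\<^sup>+y. ennreal (norm (F y)) * (\<integral>\<^sup>+x. ennreal (norm (\<eta> x)) \<partial>lborel) \<partial>lborel)"
  proof (rule nn_integral_cong)
    fix y :: "real^'n"
    have "(\<integral>\<^sup>+x. ennreal (norm (F y)) * ennreal (norm (\<eta> (x - y))) \<partial>lborel) =
        ennreal (norm (F y)) * (\<integral>\<^sup>+x. ennreal (norm (\<eta> (x - y))) \<partial>lborel)"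
      by (rule nn_integral_cmult) measurable
    also have "(\<integral>\<^sup>+x. ennreal (norm (\<eta> (x - y))) \<partial>lborel) = (\<integral>\<^sup>+x. ennreal (norm (\<eta> x)) \<partial>lborel)"
      by (rule nn_integral_translate[of "\<lambda>x. ennreal (norm (\<eta> x))"]) measurable
    finally show "(\<integral>\<^sup>+x. ennreal (norm (F y)) * ennreal (norm (\<eta> (x - y))) \<partial>lborel) =
        ennreal (norm (F y)) * (\<integral>\<^sup>+x. ennreal (norm (\<eta> x)) \<partial>lborel)" .
  qed
  also have "\<dots> = (\<integral>\<^sup>+x. norm (F x) \<partial>lborel) * (\<integral>\<^sup>+x. norm (\<eta> x) \<partial>lborel)"
    by (rule nn_integral_multc) measurable
  finally show ?thesis .
qed

text \<open>Both products of convolutions are double integrals over \<open>y\<close> and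
  \<open>z\<close> with the same weight \<open>\<eta> y * \<eta> z\<close>, so their difference is
  one too. Tonelli moves the integral over \<open>x\<close> inside, where the hypothesis, uniform in
  \<open>y\<close> and \<open>z\<close>, bounds it by \<open>\<epsilon>\<close>.\<close>

lemma nn_integral_conv_pair_diff:
  fixes F G F' G' \<eta> :: "real^'n \<Rightarrow> complex"
  assumes int: "integrable lborel F" "integrable lborel G" "integrable lborel F'" "integrable lborel G'"
    and \<eta>: "\<eta> \<in> schwartz"
    and le: "\<And>y z. (\<integral>\<^sup>+x. norm (F (x - y) * G (x - z) - F' (x - y) * G' (x - z)) \<partial>lborel) \<le> \<epsilon>"
  shows "(\<integral>\<^sup>+x. norm (conv F \<eta> x * conv G \<eta> x - conv F' \<eta> x * conv G' \<eta> x) \<partial>lborel)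
    \<le> \<epsilon> * ((\<integral>\<^sup>+x. norm (\<eta> x) \<partial>lborel) * (\<integral>\<^sup>+x. norm (\<eta> x) \<partial>lborel))"
proof -
  note [measurable] = int[THEN borel_measurable_integrable] schwartz_borel[OF \<eta>]
  let ?K = "\<lambda>x y z. F (x - y) * G (x - z) - F' (x - y) * G' (x - z)"
  let ?S = "\<integral>\<^sup>+x. norm (\<eta> x) \<partial>lborel"
  have pw: "ennreal (norm (conv F \<eta> x * conv G \<eta> x - conv F' \<eta> x * conv G' \<eta> x)) \<le>
      (\<integral>\<^sup>+y. (\<integral>\<^sup>+z. ennreal (norm (?K x y z)) * (ennreal (norm (\<eta> y)) * ennreal (norm (\<eta> z))) \<partial>lborel) \<partial>lborel)" for x
  proof -
    note ic = int[THEN integrable_conv_integrand, OF \<eta>]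
    have inner: "(LINT z|lborel. ?K x y z * (\<eta> y * \<eta> z)) =
        F (x - y) * \<eta> y * conv G \<eta> x - F' (x - y) * \<eta> y * conv G' \<eta> x" for y
    proof -
      have "?K x y z * (\<eta> y * \<eta> z) = (F (x - y) * \<eta> y) * (G (x - z) * \<eta> z) - (F' (x - y) * \<eta> y) * (G' (x - z) * \<eta> z)" for z
        by (simp add: algebra_simps)
      then show ?thesis using ic
        by (simp add: conv_alt[OF int(2) \<eta>] conv_alt[OF int(4) \<eta>])
    qed
    have eq: "conv F \<eta> x * conv G \<eta> x - conv F' \<eta> x * conv G' \<eta> x = (LINT y|lborel. (LINT z|lborel. ?K x y z * (\<eta> y * \<eta> z)))"
      unfolding inner using ic by (simp add: conv_alt[OF int(1) \<eta>] conv_alt[OF int(3) \<eta>])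
    have "(\<integral>\<^sup>+y. norm (LINT z|lborel. ?K x y z * (\<eta> y * \<eta> z)) \<partial>lborel) \<le>
        (\<integral>\<^sup>+y. (\<integral>\<^sup>+z. ennreal (norm (?K x y z)) * (ennreal (norm (\<eta> y)) * ennreal (norm (\<eta> z))) \<partial>lborel) \<partial>lborel)"
      by (intro nn_integral_mono order_trans[OF norm_integral_le_nn_integral])
         (simp add: norm_mult ennreal_mult)
    then show ?thesis
      unfolding eq by (rule order_trans[OF norm_integral_le_nn_integral])
  qed
  have "(\<integral>\<^sup>+x. norm (conv F \<eta> x * conv G \<eta> x - conv F' \<eta> x * conv G' \<eta> x) \<partial>lborel) \<le>
     (\<integral>\<^sup>+x. (\<integral>\<^sup>+y. (\<integral>\<^sup>+z. ennreal (norm (?K x y z)) * (ennreal (norm (\<eta> y)) * ennreal (norm (\<eta> z))) \<partial>lborel) \<partial>lborel) \<partial>lborel)"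
    by (intro nn_integral_mono pw)
  also have "\<dots> = (\<integral>\<^sup>+y. (\<integral>\<^sup>+x. (\<integral>\<^sup>+z. ennreal (norm (?K x y z)) * (ennreal (norm (\<eta> y)) * ennreal (norm (\<eta> z))) \<partial>lborel) \<partial>lborel) \<partial>lborel)"
    by (rule lborel_pair.Fubini'[symmetric]) measurable
  also have "\<dots> = (\<integral>\<^sup>+y. (\<integral>\<^sup>+z. (\<integral>\<^sup>+x. ennreal (norm (?K x y z)) * (ennreal (norm (\<eta> y)) * ennreal (norm (\<eta> z))) \<partial>lborel) \<partial>lborel) \<partial>lborel)"
    by (intro nn_integral_cong lborel_pair.Fubini'[symmetric]) measurable
  also have "\<dots> \<le> (\<integral>\<^sup>+y. (\<integral>\<^sup>+z. \<epsilon> * (ennreal (norm (\<eta> y)) * ennreal (norm (\<eta> z))) \<partial>lborel) \<partial>lborel)"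
  proof (intro nn_integral_mono)
    fix y z :: "real^'n"
    have "(\<integral>\<^sup>+x. ennreal (norm (?K x y z)) * (ennreal (norm (\<eta> y)) * ennreal (norm (\<eta> z))) \<partial>lborel) =
        (\<integral>\<^sup>+x. ennreal (norm (?K x y z)) \<partial>lborel) * (ennreal (norm (\<eta> y)) * ennreal (norm (\<eta> z)))"
      by (rule nn_integral_multc) measurable
    also have "\<dots> \<le> \<epsilon> * (ennreal (norm (\<eta> y)) * ennreal (norm (\<eta> z)))"
      by (intro mult_right_mono le) auto
    finally show "(\<integral>\<^sup>+x. ennreal (norm (?K x y z)) * (ennreal (norm (\<eta> y)) * ennreal (norm (\<eta> z))) \<partial>lborel)
        \<le> \<epsilon> * (ennreal (norm (\<eta> y)) * ennreal (norm (\<eta> z)))" .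
  qed
  also have "\<dots> = \<epsilon> * (?S * ?S)"
    by (simp add: nn_integral_cmult nn_integral_multc)
  finally show ?thesis .
qed

text \<open>The kernels are complex-valued, hence the bound \<open>S\<close> on the integral of the
  modulus in addition to total integral 1. The tail estimate carries an integrable weight so that it
  can be integrated over the far region.\<close>

definition approx_id :: "(nat \<Rightarrow> real^'n \<Rightarrow> complex) \<Rightarrow> real \<Rightarrow> bool" where
  "approx_id \<eta> S \<longleftrightarrow> 0 \<le> S \<and> (\<forall>k. \<eta> k \<in> schwartz \<and> (\<integral>\<^sup>+x. norm (\<eta> k x) \<partial>lborel) \<le> ennreal S \<and>
     (LINT x|lborel. \<eta> k x) = 1) \<and>
     (\<forall>\<delta>>0. \<exists>C. \<forall>k z. \<delta> \<le> norm z \<longrightarrow> norm (\<eta> k z) \<le> C / 2 ^ k / (1 + norm z) ^ (2 * CARD('n)))"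

lemma kern_approx_id:
  assumes \<psi>: "\<psi> \<in> schwartz" and "\<psi> 0 = 1" and M: "\<And>j. 1 \<le> M $ j"
  shows "approx_id (kern M \<psi>) (LINT x|lborel. norm (inv_fourier \<psi> x))"
proof -
  let ?S = "LINT x|lborel. norm (inv_fourier \<psi> x)"
  have "(\<integral>\<^sup>+x. norm (kern M \<psi> k x) \<partial>lborel) = ennreal ?S" for k
    unfolding nn_integral_kern[OF \<psi>]
    by (intro nn_integral_eq_integral integrable_norm schwartz_integrable inv_fourier_schwartz \<psi>) auto
  moreover have "\<exists>C. \<forall>k z. \<delta> \<le> norm z \<longrightarrow> norm (kern M \<psi> k z) \<le> C / 2 ^ k / (1 + norm z) ^ (2 * CARD('a))"
    if \<delta>: "0 < \<delta>" for \<delta>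
  proof -
    obtain C where "\<forall>k js z. length js \<le> 0 \<longrightarrow> \<delta> \<le> norm z \<longrightarrow>
        norm (partials js (kern M \<psi> k) z) \<le> C / 2 ^ k / (1 + norm z) ^ (2 * CARD('a))"
      using kern_tail[OF \<psi> M \<delta>] by blast
    then have "norm (kern M \<psi> k z) \<le> C / 2 ^ k / (1 + norm z) ^ (2 * CARD('a))" if "\<delta> \<le> norm z" for k z
      using that by (metis le0 list.size(3) partials.simps(1))
    then show ?thesis by blast
  qed
  ultimately show ?thesis
    using assms by (simp add: approx_id_def kern_schwartz integral_kern)
qed

definition compactly_supported :: "(real^'n \<Rightarrow> complex) \<Rightarrow> bool" where
  "compactly_supported F \<longleftrightarrow> continuous_on UNIV F \<and> (\<exists>R. \<forall>x. norm x > R \<longrightarrow> F x = 0)"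

lemma integrable_bounded_support:
  fixes F :: "real^'n \<Rightarrow> complex"
  assumes "F \<in> borel_measurable borel" "\<And>x. norm (F x) \<le> B" "\<And>x. norm x > R \<Longrightarrow> F x = 0"
  shows "integrable lborel F"
proof -
  have "loc_int (\<lambda>x::real^'n. 1)"
    unfolding loc_int_def by (intro conjI allI integrable_scaleR_left integrable_real_indicator)
      (use emeasure_lborel_cball_finite in auto)
  from loc_int_mult[OF this assms] show ?thesis by simp
qed

lemma compactly_supported_bounded:
  assumes "compactly_supported F"
  obtains B where "0 < B" "\<And>x. norm (F x) \<le> B"
proof -
  obtain R where R: "\<And>x. norm x > R \<Longrightarrow> F x = 0" and F: "continuous_on UNIV F"
    using assms by (auto simp: compactly_supported_def)
  have "compact (F ` cball 0 R)"
    using F by (intro compact_continuous_image) (auto intro: continuous_on_subset)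
  then obtain B where B: "\<And>x. x \<in> cball 0 R \<Longrightarrow> norm (F x) \<le> B"
    by (meson bounded_iff compact_imp_bounded imageI)
  have "norm (F x) \<le> max 1 B" for x
  proof (cases "norm x \<le> R")
    case True
    with B[of x] show ?thesis by simp
  next
    case False
    with R[of x] show ?thesis by simp
  qed
  then show ?thesis by (intro that[of "max 1 B"]) auto
qed

lemma compactly_supported_integrable:
  assumes "compactly_supported F" shows "integrable lborel F"
proof -
  obtain B where B: "0 < B" "\<And>x. norm (F x) \<le> B" by (rule compactly_supported_bounded[OF assms]) (rule that)
  obtain R where R: "\<And>x. norm x > R \<Longrightarrow> F x = 0" using assms by (auto simp: compactly_supported_def)
  show ?thesis
    using assms by (intro integrable_bounded_support[OF _ B(2) R])
      (auto simp: compactly_supported_def intro: borel_measurable_continuous_onI)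
qed

lemma compactly_supported_uniformly_continuous:
  assumes F: "compactly_supported F" and e: "0 < e"
  obtains \<delta> where "0 < \<delta>" "\<And>x y. norm y < \<delta> \<Longrightarrow> norm (F (x - y) - F x) \<le> e"
proof -
  obtain R where R: "\<And>x. norm x > R \<Longrightarrow> F x = 0" and c: "continuous_on UNIV F"
    using F by (auto simp: compactly_supported_def)
  have "uniformly_continuous_on (cball 0 (R + 2)) F"
    by (intro compact_uniformly_continuous compact_cball continuous_on_subset[OF c]) auto
  then obtain d where d: "0 < d" "\<And>x x'. x \<in> cball 0 (R + 2) \<Longrightarrow> x' \<in> cball 0 (R + 2) \<Longrightarrow> dist x' x < d \<Longrightarrow> dist (F x') (F x) < e"
    using e unfolding uniformly_continuous_on_def by metis
  \<comment> \<open>For shifts shorter than 1: if \<open>norm x \<le> R + 1\<close>, both points lie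
    in the ball of radius \<open>R + 2\<close>; otherwise both values are 0.\<close>
  have "norm (F (x - y) - F x) \<le> e" if y: "norm y < min d 1" for x y
  proof (cases "norm x \<le> R + 1")
    case True
    have "norm (x - y) \<le> R + 2" using norm_triangle_ineq4[of x y] y True by simp
    then have "x - y \<in> cball 0 (R + 2)" "x \<in> cball 0 (R + 2)" using True by (simp_all only: mem_cball_0)
    moreover have "dist (x - y) x < d" using y by (simp add: dist_norm)
    ultimately have "dist (F (x - y)) (F x) < e" by (intro d(2))
    then show ?thesis by (simp add: dist_norm)
  next
    case False
    have "norm (x - y) > R" using norm_triangle_ineq2[of x y] y False by simp
    then show ?thesis using R[of x] R[of "x - y"] False e by simp
  qed
  then show ?thesis using d(1) by (intro that[of "min d 1"]) auto
qed

text \<open>Since the kernel has integral 1, the error is the average of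
  \<open>F (x - y) - F x\<close>. Shifts below \<open>\<delta>\<close> are handled by uniform
  continuity and the bound \<open>S\<close>, the others by the tail estimate and the boundedness of
  \<open>F\<close>.\<close>

lemma conv_uniform_limit:
  fixes \<eta> :: "nat \<Rightarrow> real^'n \<Rightarrow> complex"
  assumes \<eta>: "approx_id \<eta> S" and F: "compactly_supported F" and \<epsilon>: "0 < \<epsilon>"
  shows "eventually (\<lambda>k. \<forall>x. norm (conv F (\<eta> k) x - F x) \<le> \<epsilon>) sequentially"
proof -
  let ?L = "2 * CARD('n)"
  let ?I = "LINT x::real^'n|lborel. 1 / (1 + norm x) ^ ?L"
  have S: "0 \<le> S" and \<eta>S: "\<And>k. \<eta> k \<in> schwartz" and \<eta>1: "\<And>k. (LINT x|lborel. \<eta> k x) = 1"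
    and \<eta>n: "\<And>k. (\<integral>\<^sup>+x. norm (\<eta> k x) \<partial>lborel) \<le> ennreal S"
    using \<eta> by (auto simp: approx_id_def)
  have iF: "integrable lborel F" using F by (rule compactly_supported_integrable)
  obtain B where B: "0 < B" "\<And>x. norm (F x) \<le> B" by (rule compactly_supported_bounded[OF F]) (rule that)
  \<comment> \<open>Gives \<open>e * S \<le> \<epsilon> / 2\<close>; the summand 1 keeps the
    denominator positive on the basis of \<open>0 \<le> S\<close> alone.\<close>
  define e where "e = \<epsilon> / (2 * (S + 1))"
  have e: "0 < e" using \<epsilon> S by (simp add: e_def)
  obtain \<delta> where \<delta>: "0 < \<delta>" "\<And>x y. norm y < \<delta> \<Longrightarrow> norm (F (x - y) - F x) \<le> e"
    by (rule compactly_supported_uniformly_continuous[OF F e]) (rule that)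
  obtain C where C: "\<And>k z. \<delta> \<le> norm z \<Longrightarrow> norm (\<eta> k z) \<le> C / 2 ^ k / (1 + norm z) ^ ?L"
    using \<eta> \<delta>(1) unfolding approx_id_def by blast
  have bound: "norm (conv F (\<eta> k) x - F x) \<le> e * S + 2 * B * (\<bar>C\<bar> / 2 ^ k) * ?I" for k x
  proof -
    have ik: "integrable lborel (\<eta> k)" by (rule schwartz_integrable[OF \<eta>S])
    have "conv F (\<eta> k) x - F x = (LINT y|lborel. F (x - y) * \<eta> k y - F x * \<eta> k y)"
      using integrable_conv_integrand[OF iF \<eta>S] ik \<eta>1[of k] by (simp add: conv_alt[OF iF \<eta>S])
    also have "norm \<dots> \<le> (LINT y|lborel. e * norm (\<eta> k y) + (2 * B * (\<bar>C\<bar> / 2 ^ k)) * (1 / (1 + norm y) ^ ?L))"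
    proof (rule Bochner_Integration.integral_norm_bound_integral)
      show "integrable lborel (\<lambda>y. F (x - y) * \<eta> k y - F x * \<eta> k y)"
        using integrable_conv_integrand[OF iF \<eta>S] ik by simp
      show "integrable lborel (\<lambda>y. e * norm (\<eta> k y) + (2 * B * (\<bar>C\<bar> / 2 ^ k)) * (1 / (1 + norm y) ^ ?L))"
        by (intro Bochner_Integration.integrable_add integrable_mult_right integrable_norm ik integrable_decay)
      fix y
      have n: "norm (F (x - y) * \<eta> k y - F x * \<eta> k y) = norm (F (x - y) - F x) * norm (\<eta> k y)"
        by (simp add: norm_mult[symmetric] left_diff_distrib)
      have pos: "0 \<le> (2 * B * (\<bar>C\<bar> / 2 ^ k)) * (1 / (1 + norm y) ^ ?L)" "0 \<le> e * norm (\<eta> k y)"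
        using B e by auto
      show "norm (F (x - y) * \<eta> k y - F x * \<eta> k y) \<le> e * norm (\<eta> k y) + (2 * B * (\<bar>C\<bar> / 2 ^ k)) * (1 / (1 + norm y) ^ ?L)"
      proof (cases "norm y < \<delta>")
        case True
        from mult_right_mono[OF \<delta>(2)[OF True, of x] norm_ge_zero[of "\<eta> k y"]] pos n show ?thesis by linarith
      next
        case False
        have "C / 2 ^ k / (1 + norm y) ^ ?L \<le> \<bar>C\<bar> / 2 ^ k / (1 + norm y) ^ ?L"
          by (intro divide_right_mono less_imp_le[OF one_plus_norm_power_pos]) auto
        then have "norm (\<eta> k y) \<le> \<bar>C\<bar> / 2 ^ k * (1 / (1 + norm y) ^ ?L)"
          using C[of y k] False by simp
        moreover have "norm (F (x - y) - F x) \<le> 2 * B"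
          using norm_triangle_ineq4[of "F (x - y)" "F x"] B(2)[of x] B(2)[of "x - y"] by linarith
        ultimately have "norm (F (x - y) - F x) * norm (\<eta> k y) \<le> (2 * B) * (\<bar>C\<bar> / 2 ^ k * (1 / (1 + norm y) ^ ?L))"
          using B by (intro mult_mono) auto
        then show ?thesis using pos n by simp
      qed
    qed
    also have "\<dots> = e * (LINT y|lborel. norm (\<eta> k y)) + (2 * B * (\<bar>C\<bar> / 2 ^ k)) * ?I"
    proof -
      have "integrable lborel (\<lambda>y. e * norm (\<eta> k y))"
        by (intro integrable_mult_right integrable_norm ik)
      moreover have "integrable lborel (\<lambda>y::real^'n. (2 * B * (\<bar>C\<bar> / 2 ^ k)) * (1 / (1 + norm y) ^ ?L))"
        by (intro integrable_mult_right integrable_decay)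
      ultimately show ?thesis
        by (simp only: Bochner_Integration.integral_add integral_mult_right_zero)
    qed
    also have "(LINT y|lborel. norm (\<eta> k y)) \<le> S"
    proof -
      have eq: "ennreal (LINT y|lborel. norm (\<eta> k y)) = (\<integral>\<^sup>+x. norm (\<eta> k x) \<partial>lborel)"
        by (rule nn_integral_eq_integral[symmetric]) (auto intro: integrable_norm ik)
      have "ennreal (LINT y|lborel. norm (\<eta> k y)) \<le> ennreal S" unfolding eq by (rule \<eta>n)
      then show ?thesis by (simp only: ennreal_le_iff[OF S])
    qed
    finally show ?thesis using e by simp
  qed
  have eS: "e * S \<le> \<epsilon> / 2"
    using S \<epsilon> by (simp add: e_def field_simps)
  have "(\<lambda>k. (2 * B * \<bar>C\<bar> * ?I) * inverse (2 ^ k)) \<longlonglongrightarrow> (2 * B * \<bar>C\<bar> * ?I) * 0"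
    by (intro tendsto_intros LIMSEQ_inverse_realpow_zero) auto
  then have "eventually (\<lambda>k. (2 * B * \<bar>C\<bar> * ?I) * inverse (2 ^ k) < \<epsilon> / 2) sequentially"
    using \<epsilon> by (intro order_tendstoD(2)) auto
  then show ?thesis
  proof eventually_elim
    case (elim k)
    have "2 * B * (\<bar>C\<bar> / 2 ^ k) * ?I = (2 * B * \<bar>C\<bar> * ?I) * inverse (2 ^ k)"
      by (simp add: divide_inverse mult_ac)
    with elim eS bound[of k] show ?case by (smt (verit) field_sum_of_halves)
  qed
qed

section \<open>Convergence of products of mollified functions\<close>

text \<open>The pair is approximated jointly, in the form that
  \<open>nn_integral_conv_pair_diff\<close> consumes. A bounded factor may have no continuous
  approximation in the essential supremum norm, whereas its product with the shifted other factor
  can still be approximated in \<open>L\<^sub>1\<close>.\<close>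

definition good_pair :: "(real^'n \<Rightarrow> complex) \<Rightarrow> (real^'n \<Rightarrow> complex) \<Rightarrow> bool" where
  "good_pair F G \<longleftrightarrow> (\<forall>\<epsilon>>0. \<exists>F' G'. compactly_supported F' \<and> compactly_supported G' \<and>
     (\<forall>y z. (\<integral>\<^sup>+x. norm (F (x - y) * G (x - z) - F' (x - y) * G' (x - z)) \<partial>lborel) \<le> ennreal \<epsilon>))"

lemma good_pairD:
  assumes "good_pair F G" "0 < \<epsilon>"
  obtains F' G' where "compactly_supported F'" "compactly_supported G'"
    "\<And>y z. (\<integral>\<^sup>+x. norm (F (x - y) * G (x - z) - F' (x - y) * G' (x - z)) \<partial>lborel) \<le> ennreal \<epsilon>"
proof -
  have "\<exists>F' G'. compactly_supported F' \<and> compactly_supported G' \<and>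
     (\<forall>y z. (\<integral>\<^sup>+x. norm (F (x - y) * G (x - z) - F' (x - y) * G' (x - z)) \<partial>lborel) \<le> ennreal \<epsilon>)"
    using assms unfolding good_pair_def by (elim allE impE)
  then show ?thesis by (elim exE conjE) (rule that, assumption, assumption, erule allE, erule allE, assumption)
qed

lemma compactly_supported_mult:
  "compactly_supported F \<Longrightarrow> compactly_supported G \<Longrightarrow> compactly_supported (\<lambda>x. F x * G x)"
  by (auto simp: compactly_supported_def intro!: continuous_on_mult) 

text \<open>Without shifts and with tolerance 1, \<open>F * G\<close> differs by an integrable
  function from a continuous one of compact support.\<close>

lemma good_pair_integrable:
  assumes gp: "good_pair F G" and F: "F \<in> borel_measurable borel" and G: "G \<in> borel_measurable borel"
  shows "integrable lborel (\<lambda>x. F x * G x)"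
proof -
  obtain F' G' where c: "compactly_supported F'" "compactly_supported G'"
    and le: "\<And>y z. (\<integral>\<^sup>+x. norm (F (x - y) * G (x - z) - F' (x - y) * G' (x - z)) \<partial>lborel) \<le> ennreal 1"
    by (rule good_pairD[OF gp zero_less_one]) (rule that)
  have i: "integrable lborel (\<lambda>x. F' x * G' x)"
    by (intro compactly_supported_integrable compactly_supported_mult c)
  note [measurable] = F G borel_measurable_integrable[OF compactly_supported_integrable[OF c(1)]]
    borel_measurable_integrable[OF compactly_supported_integrable[OF c(2)]]
  have "integrable lborel (\<lambda>x. F x * G x - F' x * G' x)"
  proof (rule integrableI_bounded)
    have "(\<integral>\<^sup>+x. norm (F x * G x - F' x * G' x) \<partial>lborel) \<le> ennreal 1"
      using le[of 0 0] by simp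
    also have "\<dots> < \<infinity>" by simp
    finally show "(\<integral>\<^sup>+x. norm (F x * G x - F' x * G' x) \<partial>lborel) < \<infinity>" .
  qed measurable
  from Bochner_Integration.integrable_add[OF this i] show ?thesis by simp
qed

lemma norm_weighted_integral_le:
  fixes h \<phi> :: "real^'n \<Rightarrow> complex"
  assumes h: "h \<in> borel_measurable borel" and c: "(\<integral>\<^sup>+x. norm (h x) \<partial>lborel) \<le> ennreal c" "0 \<le> c"
    and \<Phi>: "\<And>x. norm (\<phi> x) \<le> \<Phi>"
  shows "norm (LINT x|lborel. h x * \<phi> x) \<le> \<Phi> * c"
proof -
  note [measurable] = h
  have \<Phi>0: "0 \<le> \<Phi>" using \<Phi>[of 0] norm_ge_zero[of "\<phi> 0"] by linarith
  have "ennreal (norm (LINT x|lborel. h x * \<phi> x)) \<le> (\<integral>\<^sup>+x. norm (h x * \<phi> x) \<partial>lborel)"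
    by (rule norm_integral_le_nn_integral)
  also have "\<dots> \<le> (\<integral>\<^sup>+x. ennreal \<Phi> * ennreal (norm (h x)) \<partial>lborel)"
  proof (intro nn_integral_mono)
    fix x
    from mult_right_mono[OF \<Phi>[of x] norm_ge_zero[of "h x"]]
    show "ennreal (norm (h x * \<phi> x)) \<le> ennreal \<Phi> * ennreal (norm (h x))"
      using \<Phi>0 by (simp add: ennreal_mult[symmetric] norm_mult mult.commute ennreal_leI)
  qed
  also have "\<dots> = ennreal \<Phi> * (\<integral>\<^sup>+x. norm (h x) \<partial>lborel)" by (rule nn_integral_cmult) measurable
  also have "\<dots> \<le> ennreal \<Phi> * ennreal c" by (intro mult_left_mono c) simp
  also have "\<dots> = ennreal (\<Phi> * c)" using \<Phi>0 c by (simp add: ennreal_mult)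
  finally show ?thesis using \<Phi>0 c(2) by (subst (asm) ennreal_le_iff) auto
qed

lemma norm_add3_le: "norm (a + b + c) \<le> norm a + norm b + norm (c :: complex)"
  using norm_triangle_ineq[of "a + b" c] norm_triangle_ineq[of a b] by linarith

lemma product_close:
  fixes a b a' b' :: complex
  assumes "norm (a - a') \<le> e" "norm (b - b') \<le> e" "norm a' \<le> B" "norm b' \<le> B" "e \<le> 1"
  shows "norm (a * b - a' * b') \<le> (2 * B + 1) * e"
proof -
  have e: "0 \<le> e" using assms(1) norm_ge_zero order_trans by blast
  have B: "0 \<le> B" using assms(3) norm_ge_zero order_trans by blast
  have "a * b - a' * b' = (a - a') * (b - b') + (a - a') * b' + a' * (b - b')"
    by (simp add: algebra_simps)
  then have "norm (a * b - a' * b') \<le> norm ((a - a') * (b - b')) + norm ((a - a') * b') + norm (a' * (b - b'))"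
    by (simp only: norm_add3_le)
  also have "\<dots> \<le> e * 1 + e * B + B * e"
    unfolding norm_mult using assms e B by (intro add_mono mult_mono) auto
  finally show ?thesis by (simp add: algebra_simps)
qed

text \<open>Three errors: replacing \<open>F\<close>, \<open>G\<close> by the approximants inside
  the convolutions (uniformly in \<open>k\<close>), the uniform convergence for the approximants,
  and replacing them in the limit. The approximants are fixed before \<open>k\<close> is
  chosen.\<close>

theorem conv_pair_tendsto:
  fixes F G \<phi> :: "real^'n \<Rightarrow> complex"
  assumes \<eta>: "approx_id \<eta> S" and F: "integrable lborel F" and G: "integrable lborel G"
    and gp: "good_pair F G" and \<phi>: "\<phi> \<in> test_functions"
  shows "(\<lambda>k. LINT x|lborel. conv F (\<eta> k) x * conv G (\<eta> k) x * \<phi> x) \<longlonglongrightarrow> (LINT x|lborel. F x * G x * \<phi> x)"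
proof -
  have S: "0 \<le> S" and \<eta>S: "\<And>k. \<eta> k \<in> schwartz" and \<eta>n: "\<And>k. (\<integral>\<^sup>+x. norm (\<eta> k x) \<partial>lborel) \<le> ennreal S"
    using \<eta> by (auto simp: approx_id_def)
  have \<phi>S: "\<phi> \<in> schwartz" using \<phi> by (rule test_functions_schwartz)
  obtain \<Phi> where \<Phi>: "0 < \<Phi>" "\<And>x. norm (\<phi> x) \<le> \<Phi>"
    by (rule norm_bounded_schwartz[OF \<phi>S]) (rule that)
  note [measurable] = borel_measurable_integrable[OF F] borel_measurable_integrable[OF G] schwartz_borel[OF \<phi>S]
  have i\<phi>: "integrable lborel \<phi>" using \<phi>S by (rule schwartz_integrable)
  have ik: "integrable lborel (\<lambda>x. conv F1 (\<eta> k) x * conv G1 (\<eta> k) x * \<phi> x)"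
    if "integrable lborel F1" "integrable lborel G1" for F1 G1 k
    by (intro schwartz_integrable test_functions_schwartz test_functions_mult smooth_mult smooth_conv that \<eta>S \<phi>)
  have i0: "integrable lborel (\<lambda>x. h x * \<phi> x)" if "integrable lborel h" for h
    using integrable_mult_shift[OF that \<phi>S, of 0] by simp
  show ?thesis
  proof (rule LIMSEQ_I, goal_cases)
    case (1 \<epsilon>)
    then have \<epsilon>: "0 < \<epsilon>" .
    let ?I = "LINT x|lborel. norm (\<phi> x)"
    have I0: "0 \<le> ?I" by (intro Bochner_Integration.integral_nonneg) auto
    \<comment> \<open>Lets the two replacement errors, bounded by
      \<open>\<Phi> * (e * (S * S))\<close> and \<open>\<Phi> * e\<close>, add up to
      \<open>\<epsilon> / 4\<close>.\<close>
    define e where "e = \<epsilon> / (4 * \<Phi> * (S * S + 1))"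
    have pos: "0 < 4 * \<Phi> * (S * S + 1)" using \<Phi>(1) S by (intro mult_pos_pos add_nonneg_pos) auto
    have e0: "0 < e" unfolding e_def using \<epsilon> pos by (rule divide_pos_pos)
    have eS: "\<Phi> * (e * (S * S)) + \<Phi> * e = \<epsilon> / 4"
    proof -
      have "\<Phi> * (e * (S * S)) + \<Phi> * e = (\<Phi> * (S * S + 1)) * e" by (simp add: algebra_simps)
      also have "\<dots> = \<epsilon> / 4" using pos by (simp add: e_def field_simps)
      finally show ?thesis .
    qed
    obtain F' G' where c: "compactly_supported F'" "compactly_supported G'"
      and le: "\<And>y z. (\<integral>\<^sup>+x. norm (F (x - y) * G (x - z) - F' (x - y) * G' (x - z)) \<partial>lborel) \<le> ennreal e"
      by (rule good_pairD[OF gp e0]) (rule that)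
    note iF' = compactly_supported_integrable[OF c(1)] and iG' = compactly_supported_integrable[OF c(2)]
    note [measurable] = borel_measurable_integrable[OF iF'] borel_measurable_integrable[OF iG']
    have iFG': "integrable lborel (\<lambda>x. F' x * G' x)"
      by (intro compactly_supported_integrable compactly_supported_mult c)
    have iFG: "integrable lborel (\<lambda>x. F x * G x)" by (intro good_pair_integrable gp) measurable
    obtain B1 where B1: "0 < B1" "\<And>x. norm (F' x) \<le> B1" by (rule compactly_supported_bounded[OF c(1)]) (rule that)
    obtain B2 where B2: "0 < B2" "\<And>x. norm (G' x) \<le> B2" by (rule compactly_supported_bounded[OF c(2)]) (rule that)
    define B where "B = max B1 B2"
    have B: "norm (F' x) \<le> B" "norm (G' x) \<le> B" "0 < B" for x
      using B1(2)[of x] B2(2)[of x] B1(1) by (auto simp: B_def)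
    \<comment> \<open>The bound 1 is demanded by \<open>product_close\<close>; the other term makes
      the middle error at most \<open>\<epsilon> / 4\<close>, with \<open>?I + 1\<close> guarding
      against division by 0.\<close>
    define d where "d = min 1 (\<epsilon> / (4 * ((2 * B + 1) * (?I + 1))))"
    have pos2: "0 < 4 * ((2 * B + 1) * (?I + 1))" using B(3) I0 by (intro mult_pos_pos add_pos_pos add_nonneg_pos) auto
    have d: "0 < d" "d \<le> 1" using \<epsilon> pos2 by (auto simp: d_def)
    have dI: "(2 * B + 1) * d * ?I \<le> \<epsilon> / 4"
    proof -
      have "(2 * B + 1) * d * ?I \<le> ((2 * B + 1) * (?I + 1)) * d"
        using B(3) d I0 by (simp add: algebra_simps)
      also have "\<dots> \<le> ((2 * B + 1) * (?I + 1)) * (\<epsilon> / (4 * ((2 * B + 1) * (?I + 1))))"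
        using pos2 by (intro mult_left_mono) (auto simp: d_def)
      also have "\<dots> = \<epsilon> / 4" using pos2 by (simp add: field_simps)
      finally show ?thesis .
    qed
    have "eventually (\<lambda>k. (\<forall>x. norm (conv F' (\<eta> k) x - F' x) \<le> d) \<and> (\<forall>x. norm (conv G' (\<eta> k) x - G' x) \<le> d)) sequentially"
      by (intro eventually_conj conv_uniform_limit[OF \<eta>] c d)
    then obtain K where K: "\<And>k x. K \<le> k \<Longrightarrow> norm (conv F' (\<eta> k) x - F' x) \<le> d"
      "\<And>k x. K \<le> k \<Longrightarrow> norm (conv G' (\<eta> k) x - G' x) \<le> d"
      unfolding eventually_sequentially by blast
    have "norm ((LINT x|lborel. conv F (\<eta> k) x * conv G (\<eta> k) x * \<phi> x) - (LINT x|lborel. F x * G x * \<phi> x)) < \<epsilon>"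
      if k: "K \<le> k" for k
    proof -
      let ?X = "LINT x|lborel. conv F (\<eta> k) x * conv G (\<eta> k) x * \<phi> x"
      let ?X' = "LINT x|lborel. conv F' (\<eta> k) x * conv G' (\<eta> k) x * \<phi> x"
      let ?Y = "LINT x|lborel. F x * G x * \<phi> x" and ?Y' = "LINT x|lborel. F' x * G' x * \<phi> x"
      note [measurable] = smooth_borel[OF smooth_conv[OF F \<eta>S[of k]]] smooth_borel[OF smooth_conv[OF G \<eta>S[of k]]]
        smooth_borel[OF smooth_conv[OF iF' \<eta>S[of k]]] smooth_borel[OF smooth_conv[OF iG' \<eta>S[of k]]]
      have "(\<integral>\<^sup>+x. norm (conv F (\<eta> k) x * conv G (\<eta> k) x - conv F' (\<eta> k) x * conv G' (\<eta> k) x) \<partial>lborel)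
          \<le> ennreal e * ((\<integral>\<^sup>+x. norm (\<eta> k x) \<partial>lborel) * (\<integral>\<^sup>+x. norm (\<eta> k x) \<partial>lborel))"
        by (rule nn_integral_conv_pair_diff[OF F G iF' iG' \<eta>S le])
      also have "\<dots> \<le> ennreal e * (ennreal S * ennreal S)"
        by (intro mult_mono \<eta>n) auto
      also have "\<dots> = ennreal (e * (S * S))" using e0 S by (simp add: ennreal_mult)
      finally have "norm (LINT x|lborel. (conv F (\<eta> k) x * conv G (\<eta> k) x - conv F' (\<eta> k) x * conv G' (\<eta> k) x) * \<phi> x)
          \<le> \<Phi> * (e * (S * S))"
        using e0 S \<Phi>(2) by (intro norm_weighted_integral_le) auto
      then have 1: "norm (?X - ?X') \<le> \<Phi> * (e * (S * S))"
        using ik[OF F G, of k] ik[OF iF' iG', of k] by (simp add: left_diff_distrib)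
      have "norm (LINT x|lborel. (F x * G x - F' x * G' x) * \<phi> x) \<le> \<Phi> * e"
        using e0 \<Phi>(2) le[of 0 0] by (intro norm_weighted_integral_le) auto
      then have 2: "norm (?Y - ?Y') \<le> \<Phi> * e"
        using i0[OF iFG] i0[OF iFG'] by (simp add: left_diff_distrib)
      have "norm (?X' - ?Y') = norm (LINT x|lborel. (conv F' (\<eta> k) x * conv G' (\<eta> k) x - F' x * G' x) * \<phi> x)"
        using ik[OF iF' iG', of k] i0[OF iFG'] by (simp add: left_diff_distrib)
      also have "\<dots> \<le> (LINT x|lborel. ((2 * B + 1) * d) * norm (\<phi> x))"
      proof (rule Bochner_Integration.integral_norm_bound_integral)
        show "integrable lborel (\<lambda>x. (conv F' (\<eta> k) x * conv G' (\<eta> k) x - F' x * G' x) * \<phi> x)"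
          using ik[OF iF' iG', of k] i0[OF iFG'] by (simp add: left_diff_distrib)
        show "integrable lborel (\<lambda>x. ((2 * B + 1) * d) * norm (\<phi> x))"
          by (intro integrable_mult_right integrable_norm i\<phi>)
        fix x
        show "norm ((conv F' (\<eta> k) x * conv G' (\<eta> k) x - F' x * G' x) * \<phi> x) \<le> ((2 * B + 1) * d) * norm (\<phi> x)"
          unfolding norm_mult by (intro mult_right_mono product_close K k B d) simp
      qed
      also have "\<dots> = (2 * B + 1) * d * ?I" by (rule integral_mult_right_zero)
      finally have 3: "norm (?X' - ?Y') \<le> \<epsilon> / 4" using dI by linarith
      have "?X - ?Y = (?X - ?X') + (?X' - ?Y') + (?Y' - ?Y)" by simp
      then have "norm (?X - ?Y) \<le> norm (?X - ?X') + norm (?X' - ?Y') + norm (?Y' - ?Y)"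
        by (simp only: norm_add3_le)
      then have "norm (?X - ?Y) \<le> norm (?X - ?X') + norm (?X' - ?Y') + norm (?Y - ?Y')"
        by (simp only: norm_minus_commute)
      with 1 2 3 eS \<epsilon> show ?thesis by linarith
    qed
    then show ?case by blast
  qed
qed

text \<open>A measurable function is almost everywhere a limit of continuous ones. Composing these
  with the projection onto the disc of radius \<open>B\<close>, which is continuous and fixes the
  values of \<open>F\<close>, gives a common bound; multiplying by \<open>cut R\<close> gives a
  common support. Dominated convergence then applies.\<close>

lemma approx_compactly_supported:
  fixes F :: "real^'n \<Rightarrow> complex"
  assumes F: "F \<in> borel_measurable borel" and B: "\<And>x. norm (F x) \<le> B"
    and R: "0 < R" "\<And>x. norm x > R \<Longrightarrow> F x = 0" and \<epsilon>: "0 < \<epsilon>"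
  obtains F' where "compactly_supported F'" "\<And>x. norm (F' x) \<le> B"
    "(\<integral>\<^sup>+x. norm (F x - F' x) \<partial>lborel) \<le> ennreal \<epsilon>"
proof -
  have B0: "0 \<le> B" using B[of 0] norm_ge_zero[of "F 0"] by linarith
  have "F measurable_on UNIV"
    using F by (intro lebesgue_measurable_imp_measurable_on measurable_completion) auto
  then obtain N g where N: "negligible N" and g: "\<And>n. continuous_on UNIV (g n)"
    and lim: "\<And>x. x \<notin> N \<Longrightarrow> (\<lambda>n. g n x) \<longlonglongrightarrow> F x"
    unfolding measurable_on_def by auto
  let ?D = "cball (0::complex) B"
  have D: "convex ?D" "closed ?D" "?D \<noteq> {}" using B0 by auto
  have cp: "isCont (closest_point ?D) w" for w by (rule continuous_at_closest_point[OF D])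
  define h where "h n x = cut R x * closest_point ?D (g n x)" for n x
  have cutc: "continuous_on UNIV (cut R :: real^'n \<Rightarrow> complex)" by (rule smooth_continuous_on[OF smooth_cut])
  have hc: "continuous_on UNIV (h n)" for n
    unfolding h_def[abs_def]
    by (intro continuous_on_mult cutc continuous_on_compose2[OF continuous_on_closest_point[OF D, of UNIV] g]) auto
  have hs: "h n x = 0" if "norm x \<ge> 2 * R" for n x
    using cut_eq_0[OF R(1) that] by (simp add: h_def)
  have hB: "norm (h n x) \<le> B" for n x
  proof -
    have "closest_point ?D (g n x) \<in> ?D" by (rule closest_point_in_set[OF D(2,3)])
    then have "norm (closest_point ?D (g n x)) \<le> B" by simp
    then have "norm (cut R x) * norm (closest_point ?D (g n x)) \<le> 1 * B"
      by (intro mult_mono norm_cut_le) auto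
    then show ?thesis by (simp add: h_def norm_mult)
  qed
  have hcs: "compactly_supported (h n)" for n
    unfolding compactly_supported_def using hc[of n] hs[of _ n] by (auto intro!: exI[of _ "2 * R"])
  have hlim: "(\<lambda>n. h n x) \<longlonglongrightarrow> F x" if "x \<notin> N" for x
  proof -
    have "(\<lambda>n. closest_point ?D (g n x)) \<longlonglongrightarrow> closest_point ?D (F x)"
      by (rule isCont_tendsto_compose[OF cp lim[OF that]])
    moreover have "closest_point ?D (F x) = F x" using B[of x] by (intro closest_point_self) simp
    ultimately have "(\<lambda>n. h n x) \<longlonglongrightarrow> cut R x * F x" unfolding h_def by (intro tendsto_intros) simp
    moreover have "cut R x * F x = F x"
      using cut_eq_1[OF R(1), of x] R(2)[of x] by (cases "norm x \<le> R") auto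
    ultimately show ?thesis by simp
  qed
  have "AE x in lebesgue. x \<notin> N" using N by (intro AE_not_in) (simp add: negligible_iff_null_sets)
  then have AE: "AE x in lborel. (\<lambda>n. h n x) \<longlonglongrightarrow> F x"
    unfolding AE_completion_iff using hlim by auto
  have "(\<lambda>n. (\<integral>\<^sup>+x. norm (F x - h n x) \<partial>lborel)) \<longlonglongrightarrow> 0"
  proof (rule nn_integral_dominated_convergence_norm[where w = "\<lambda>x. B * indicator (cball 0 (2 * R)) x"])
    show "AE x in lborel. norm (h j x) \<le> B * indicator (cball 0 (2 * R)) x" for j
    proof (intro AE_I2)
      fix x
      show "norm (h j x) \<le> B * indicator (cball 0 (2 * R)) x"
        using hB[of j x] hs[of x j] by (cases "norm x \<le> 2 * R") auto
    qed
    have "(\<integral>\<^sup>+x. ennreal (B * indicator (cball (0::real^'n) (2 * R)) x) \<partial>lborel) = ennreal B * emeasure lborel (cball (0::real^'n) (2 * R))"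
      using B0 by (simp add: ennreal_mult ennreal_indicator nn_integral_cmult_indicator)
    also have "\<dots> < \<infinity>" using emeasure_lborel_cball_finite[of "0::real^'n" "2 * R"] by (simp add: ennreal_mult_less_top)
    finally show "(\<integral>\<^sup>+x. ennreal (B * indicator (cball (0::real^'n) (2 * R)) x) \<partial>lborel) < \<infinity>" .
    show "h i \<in> borel_measurable lborel" for i
      using borel_measurable_continuous_onI[OF hc[of i]] by simp
    show "(\<lambda>x::real^'n. B * indicator (cball 0 (2 * R)) x) \<in> borel_measurable lborel"
      by (intro borel_measurable_times borel_measurable_const borel_measurable_indicator) simp
  qed (use F AE in auto)
  then have "eventually (\<lambda>n. (\<integral>\<^sup>+x. norm (F x - h n x) \<partial>lborel) < ennreal \<epsilon>) sequentially"
    using \<epsilon> by (intro order_tendstoD(2)) auto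
  then obtain n where "(\<integral>\<^sup>+x. norm (F x - h n x) \<partial>lborel) < ennreal \<epsilon>"
    unfolding eventually_sequentially by auto
  then show ?thesis by (intro that[of "h n"] hcs hB) auto
qed

section \<open>Truncation of unbounded functions\<close>

definition trunc :: "nat \<Rightarrow> (real^'n \<Rightarrow> complex) \<Rightarrow> real^'n \<Rightarrow> complex" where
  "trunc N F x = (if norm (F x) \<le> real N then F x else 0)"

text \<open>The part of \<open>F\<close> with large values is negligible against every translate of
  \<open>G\<close>. The notion is one-sided because the argument depends on which of the two
  exponents is infinite; both orders are combined in \<open>good_pair_of_trunc\<close>.\<close>

definition trunc_ok :: "(real^'n \<Rightarrow> complex) \<Rightarrow> (real^'n \<Rightarrow> complex) \<Rightarrow> bool" where
  "trunc_ok F G \<longleftrightarrow> (\<forall>\<epsilon>>0. \<exists>N. \<forall>s. (\<integral>\<^sup>+x. norm (F x - trunc N F x) * norm (G (x - s)) \<partial>lborel) \<le> ennreal \<epsilon>)"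

lemma trunc_measurable [measurable]:
  assumes [measurable]: "F \<in> borel_measurable borel"
  shows "trunc N F \<in> borel_measurable borel"
  unfolding trunc_def[abs_def] by measurable

lemma norm_trunc_le: "norm (trunc N F x) \<le> real N" "norm (trunc N F x) \<le> norm (F x)"
  by (auto simp: trunc_def)

text \<open>Truncation replaces large values by 0, so the difference is either 0 or
  \<open>F x\<close>. This supplies the majorant for dominated convergence.\<close>

lemma norm_diff_trunc_le: "norm (F x - trunc N F x) \<le> norm (F x)"
  by (auto simp: trunc_def)

lemma trunc_tendsto: "eventually (\<lambda>N. F x - trunc N F x = 0) sequentially"
proof -
  obtain m :: nat where "norm (F x) \<le> real m" using real_arch_simple by blast
  then show ?thesis by (auto simp: trunc_def eventually_sequentially intro!: exI[of _ m])
qed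

lemma trunc_powr_tendsto:
  fixes F :: "real^'n \<Rightarrow> complex"
  assumes F[measurable]: "F \<in> borel_measurable borel" and p: "0 < p"
    and fin: "(\<integral>\<^sup>+x. ennreal (norm (F x) powr p) \<partial>lborel) < \<infinity>"
  shows "(\<lambda>N. \<integral>\<^sup>+x. ennreal (norm (F x - trunc N F x) powr p) \<partial>lborel) \<longlonglongrightarrow> 0"
proof -
  have "(\<lambda>N. \<integral>\<^sup>+x. ennreal (norm (F x - trunc N F x) powr p) \<partial>lborel) \<longlonglongrightarrow> (\<integral>\<^sup>+x. 0 \<partial>(lborel :: (real^'n) measure))"
  proof (rule nn_integral_dominated_convergence[OF _ _ _ _ fin])
    show "AE x in lborel. ennreal (norm (F x - trunc N F x) powr p) \<le> ennreal (norm (F x) powr p)" for N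
      using p by (intro AE_I2 ennreal_leI powr_mono2 norm_diff_trunc_le) auto
    show "AE x in lborel. (\<lambda>N. ennreal (norm (F x - trunc N F x) powr p)) \<longlonglongrightarrow> 0"
    proof (intro AE_I2 tendsto_eventually)
      fix x
      show "eventually (\<lambda>N. ennreal (norm (F x - trunc N F x) powr p) = 0) sequentially"
        using trunc_tendsto[of F x] by eventually_elim simp
    qed
  qed measurable
  then show ?thesis by simp
qed

lemma trunc_ok_left_bounded:
  fixes F G :: "real^'n \<Rightarrow> complex"
  assumes "AE x in lborel. norm (F x) \<le> C"
  shows "trunc_ok F G"
  unfolding trunc_ok_def
proof (intro allI impI exI)
  fix \<epsilon> :: real and s :: "real^'n" assume "0 < \<epsilon>"
  have "AE x in lborel. ennreal (norm (F x - trunc (nat \<lceil>C\<rceil>) F x) * norm (G (x - s))) = 0"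
    using assms by eventually_elim (auto simp: trunc_def, linarith)
  then have "(\<integral>\<^sup>+x. ennreal (norm (F x - trunc (nat \<lceil>C\<rceil>) F x) * norm (G (x - s))) \<partial>lborel) = (\<integral>\<^sup>+x. 0 \<partial>(lborel :: (real^'n) measure))"
    by (rule nn_integral_cong_AE)
  then show "(\<integral>\<^sup>+x. ennreal (norm (F x - trunc (nat \<lceil>C\<rceil>) F x) * norm (G (x - s))) \<partial>lborel) \<le> ennreal \<epsilon>"
    by simp
qed

lemma trunc_ok_right_bounded:
  fixes F G :: "real^'n \<Rightarrow> complex"
  assumes F: "integrable lborel F" and G[measurable]: "G \<in> borel_measurable borel"
    and C: "AE x in lborel. norm (G x) \<le> C"
  shows "trunc_ok F G"
  unfolding trunc_ok_def
proof (intro allI impI)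
  fix \<epsilon> :: real assume \<epsilon>: "0 < \<epsilon>"
  note [measurable] = borel_measurable_integrable[OF F]
  define c where "c = \<bar>C\<bar> + 1"
  have c: "0 < c" by (simp add: c_def)
  have "(\<integral>\<^sup>+x. ennreal (norm (F x) powr 1) \<partial>lborel) < \<infinity>"
    using F by (simp add: integrable_iff_bounded)
  from trunc_powr_tendsto[OF _ _ this]
  have "(\<lambda>N. \<integral>\<^sup>+x. ennreal (norm (F x - trunc N F x)) \<partial>lborel) \<longlonglongrightarrow> 0" by simp
  then have "eventually (\<lambda>N. (\<integral>\<^sup>+x. ennreal (norm (F x - trunc N F x)) \<partial>lborel) < ennreal (\<epsilon> / c)) sequentially"
    using \<epsilon> c by (intro order_tendstoD(2)) auto
  then obtain N where N: "(\<integral>\<^sup>+x. ennreal (norm (F x - trunc N F x)) \<partial>lborel) < ennreal (\<epsilon> / c)"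
    unfolding eventually_sequentially by auto
  have "(\<integral>\<^sup>+x. ennreal (norm (F x - trunc N F x) * norm (G (x - s))) \<partial>lborel) \<le> ennreal \<epsilon>" for s
  proof -
    let ?g = "\<lambda>x. ennreal (norm (F x - trunc N F x) * norm (G (x - s)))"
    let ?k = "\<lambda>x. ennreal (norm (F x - trunc N F x))"
    \<comment> \<open>The shift is moved from \<open>G\<close> to \<open>F\<close>, because the
      bound on \<open>G\<close> is given almost everywhere in the unshifted variable.\<close>
    have "(\<integral>\<^sup>+x. ?g x \<partial>lborel) = (\<integral>\<^sup>+x. ?g (x - (- s)) \<partial>lborel)"
      by (rule nn_integral_translate[symmetric]) measurable
    also have "\<dots> \<le> (\<integral>\<^sup>+x. ennreal c * ?k (x - (- s)) \<partial>lborel)"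
    proof (rule nn_integral_mono_AE)
      show "AE x in lborel. ?g (x - (- s)) \<le> ennreal c * ?k (x - (- s))"
        using C
      proof eventually_elim
        case (elim x)
        then have "norm (G x) \<le> c" by (simp add: c_def)
        from mult_left_mono[OF this norm_ge_zero[of "F (x - (- s)) - trunc N F (x - (- s))"]] c
        show ?case by (simp add: ennreal_mult[symmetric] mult.commute ennreal_leI)
      qed
    qed
    also have "\<dots> = ennreal c * (\<integral>\<^sup>+x. ?k (x - (- s)) \<partial>lborel)" by (rule nn_integral_cmult) measurable
    also have "(\<integral>\<^sup>+x. ?k (x - (- s)) \<partial>lborel) = (\<integral>\<^sup>+x. ?k x \<partial>lborel)"
      by (rule nn_integral_translate) measurable
    also have "ennreal c * \<dots> \<le> ennreal c * ennreal (\<epsilon> / c)" using N by (intro mult_left_mono) auto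
    also have "\<dots> = ennreal \<epsilon>" using c \<epsilon> by (simp add: ennreal_mult[symmetric])
    finally show ?thesis .
  qed
  then show "\<exists>N. \<forall>s. (\<integral>\<^sup>+x. ennreal (norm (F x - trunc N F x) * norm (G (x - s))) \<partial>lborel) \<le> ennreal \<epsilon>" by blast
qed

text \<open>Young's inequality with a parameter: \<open>a * b \<le> \<delta>\<close> to the power
  \<open>- p\<close> times \<open>a powr p\<close>, plus \<open>\<delta> powr q * b powr q\<close>.
  First \<open>\<delta>\<close> makes the term with \<open>G\<close> small, for all shifts at once
  by translation invariance; then the level \<open>N\<close> makes the term with \<open>F\<close>
  small for this \<open>\<delta>\<close>.\<close>

lemma trunc_ok_conjugate:
  fixes F G :: "real^'n \<Rightarrow> complex"
  assumes [measurable]: "F \<in> borel_measurable borel" "G \<in> borel_measurable borel"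
    and pq: "1 < p" "1 < q" "1 / p + 1 / q = 1"
    and Fp: "(\<integral>\<^sup>+x. ennreal (norm (F x) powr p) \<partial>lborel) < \<infinity>"
    and Gq: "(\<integral>\<^sup>+x. ennreal (norm (G x) powr q) \<partial>lborel) < \<infinity>"
  shows "trunc_ok F G"
  unfolding trunc_ok_def
proof (intro allI impI)
  fix \<epsilon> :: real assume \<epsilon>: "0 < \<epsilon>"
  define g where "g = enn2real (\<integral>\<^sup>+x. ennreal (norm (G x) powr q) \<partial>lborel)"
  have g: "(\<integral>\<^sup>+x. ennreal (norm (G x) powr q) \<partial>lborel) = ennreal g" "0 \<le> g"
    using Gq by (auto simp: g_def)
  \<comment> \<open>The solution of \<open>\<delta> powr q * (g + 1) = \<epsilon> / 2\<close>;
    adding 1 avoids division by 0.\<close>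
  define \<delta> where "\<delta> = (\<epsilon> / (2 * (g + 1))) powr (1 / q)"
  have \<delta>: "0 < \<delta>" using \<epsilon> g by (simp add: \<delta>_def)
  have \<delta>q: "\<delta> powr q = \<epsilon> / (2 * (g + 1))"
    using pq \<epsilon> g by (simp add: \<delta>_def powr_powr)
  have \<delta>g: "\<delta> powr q * g \<le> \<epsilon> / 2"
    unfolding \<delta>q using \<epsilon> g by (simp add: field_simps)
  have "eventually (\<lambda>N. (\<integral>\<^sup>+x. ennreal (norm (F x - trunc N F x) powr p) \<partial>lborel) < ennreal (\<delta> powr p * (\<epsilon> / 2))) sequentially"
    using trunc_powr_tendsto[OF _ _ Fp] pq \<delta> \<epsilon> by (intro order_tendstoD(2)) auto
  then obtain N where N: "(\<integral>\<^sup>+x. ennreal (norm (F x - trunc N F x) powr p) \<partial>lborel) < ennreal (\<delta> powr p * (\<epsilon> / 2))"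
    unfolding eventually_sequentially by auto
  have "(\<integral>\<^sup>+x. ennreal (norm (F x - trunc N F x) * norm (G (x - s))) \<partial>lborel) \<le> ennreal \<epsilon>" for s
  proof -
    have Y: "a * b \<le> inverse (\<delta> powr p) * a powr p + \<delta> powr q * b powr q" if "0 \<le> a" "0 \<le> b" for a b
    proof -
      have "a * b = (a / \<delta>) * (\<delta> * b)" using \<delta> by simp
      also have "\<dots> \<le> (a / \<delta>) powr p / p + (\<delta> * b) powr q / q"
        using that \<delta> by (intro Youngs_inequality pq) auto
      also have "\<dots> \<le> (a / \<delta>) powr p + (\<delta> * b) powr q"
        using pq by (intro add_mono) (auto simp: divide_le_eq mult_le_cancel_left1)
      also have "\<dots> = inverse (\<delta> powr p) * a powr p + \<delta> powr q * b powr q"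
        using that \<delta> by (simp add: powr_divide powr_mult) (simp add: divide_inverse mult.commute)
      finally show ?thesis .
    qed
    have "(\<integral>\<^sup>+x. ennreal (norm (F x - trunc N F x) * norm (G (x - s))) \<partial>lborel) \<le>
      (\<integral>\<^sup>+x. ennreal (inverse (\<delta> powr p)) * ennreal (norm (F x - trunc N F x) powr p) +
         ennreal (\<delta> powr q) * ennreal (norm (G (x - s)) powr q) \<partial>lborel)"
      using Y by (intro nn_integral_mono)
        (simp add: ennreal_mult[symmetric] ennreal_plus[symmetric] ennreal_leI del: ennreal_plus)
    also have "\<dots> = ennreal (inverse (\<delta> powr p)) * (\<integral>\<^sup>+x. ennreal (norm (F x - trunc N F x) powr p) \<partial>lborel) +
        ennreal (\<delta> powr q) * (\<integral>\<^sup>+x. ennreal (norm (G (x - s)) powr q) \<partial>lborel)"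
      by (simp add: nn_integral_add nn_integral_cmult)
    also have "(\<integral>\<^sup>+x. ennreal (norm (G (x - s)) powr q) \<partial>lborel) = ennreal g"
      unfolding g(1)[symmetric] by (rule nn_integral_translate) measurable
    also have "ennreal (inverse (\<delta> powr p)) * (\<integral>\<^sup>+x. ennreal (norm (F x - trunc N F x) powr p) \<partial>lborel) +
        ennreal (\<delta> powr q) * ennreal g \<le>
        ennreal (inverse (\<delta> powr p)) * ennreal (\<delta> powr p * (\<epsilon> / 2)) + ennreal (\<epsilon> / 2)"
      using N \<delta>g g(2) by (intro add_mono mult_left_mono) (auto simp: ennreal_mult[symmetric] ennreal_leI)
    also have "ennreal (inverse (\<delta> powr p)) * ennreal (\<delta> powr p * (\<epsilon> / 2)) = ennreal (\<epsilon> / 2)"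
    proof -
      have "inverse (\<delta> powr p) * (\<delta> powr p * (\<epsilon> / 2)) = \<epsilon> / 2"
        unfolding mult.assoc[symmetric] using \<delta> by simp
      then show ?thesis using \<epsilon> by (subst ennreal_mult[symmetric]) auto
    qed
    also have "ennreal (\<epsilon> / 2) + ennreal (\<epsilon> / 2) = ennreal \<epsilon>"
      using \<epsilon> by (simp add: ennreal_plus[symmetric] del: ennreal_plus)
    finally show ?thesis .
  qed
  then show "\<exists>N. \<forall>s. (\<integral>\<^sup>+x. ennreal (norm (F x - trunc N F x) * norm (G (x - s))) \<partial>lborel) \<le> ennreal \<epsilon>" by blast
qed

text \<open>Telescoping through the truncations \<open>a1\<close>, \<open>b1\<close>. In the first
  two terms a truncation error meets a possibly unbounded factor, the situation of
  \<open>trunc_ok\<close>; in the last two an approximation error meets a bounded factor.\<close>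

lemma norm_product_diff_le:
  fixes a b a1 b1 a' b' :: complex
  shows "norm (a * b - a' * b') \<le> norm (a - a1) * norm b + norm a1 * norm (b - b1) +
    norm (a1 - a') * norm b1 + norm a' * norm (b1 - b')"
proof -
  have "a * b - a' * b' = (a - a1) * b + a1 * (b - b1) + (a1 - a') * b1 + a' * (b1 - b')"
    by (simp add: algebra_simps)
  then have "norm (a * b - a' * b') \<le> norm ((a - a1) * b) + norm (a1 * (b - b1)) + norm ((a1 - a') * b1) + norm (a' * (b1 - b'))"
    using norm_triangle_ineq[of "(a - a1) * b + a1 * (b - b1) + (a1 - a') * b1" "a' * (b1 - b')"]
      norm_add3_le[of "(a - a1) * b" "a1 * (b - b1)" "(a1 - a') * b1"] by simp
  then show ?thesis by (simp only: norm_mult)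
qed

theorem good_pair_of_trunc:
  fixes F G :: "real^'n \<Rightarrow> complex"
  assumes F[measurable]: "F \<in> borel_measurable borel" and G[measurable]: "G \<in> borel_measurable borel"
    and R: "0 < R" "\<And>x. norm x > R \<Longrightarrow> F x = 0" "\<And>x. norm x > R \<Longrightarrow> G x = 0"
    and FG: "trunc_ok F G" and GF: "trunc_ok G F"
  shows "good_pair F G"
  unfolding good_pair_def
proof (intro allI impI)
  fix \<epsilon> :: real assume \<epsilon>: "0 < \<epsilon>"
  then have e4: "0 < \<epsilon> / 4" by simp
  obtain m where m: "\<And>s. (\<integral>\<^sup>+x. norm (F x - trunc m F x) * norm (G (x - s)) \<partial>lborel) \<le> ennreal (\<epsilon> / 4)"
    using FG e4 unfolding trunc_ok_def by blast
  obtain n where n: "\<And>s. (\<integral>\<^sup>+x. norm (G x - trunc n G x) * norm (F (x - s)) \<partial>lborel) \<le> ennreal (\<epsilon> / 4)"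
    using GF e4 unfolding trunc_ok_def by blast
  let ?F1 = "trunc m F" and ?G1 = "trunc n G"
  have s1: "norm x > R \<Longrightarrow> ?F1 x = 0" "norm x > R \<Longrightarrow> ?G1 x = 0" for x
    using R by (auto simp: trunc_def)
  \<comment> \<open>The error of \<open>F'\<close> is multiplied by the truncation level
    \<open>n\<close> of \<open>G\<close>, and that of \<open>G'\<close> by the level
    \<open>m\<close> of \<open>F\<close>; hence the crossed denominators, with 1 added since a level
    may be 0.\<close>
  have d: "0 < \<epsilon> / (4 * (real n + 1))" "0 < \<epsilon> / (4 * (real m + 1))" using \<epsilon> by auto
  obtain F' where F': "compactly_supported F'" "\<And>x. norm (F' x) \<le> real m"
    "(\<integral>\<^sup>+x. norm (?F1 x - F' x) \<partial>lborel) \<le> ennreal (\<epsilon> / (4 * (real n + 1)))"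
    by (rule approx_compactly_supported[OF trunc_measurable[OF F] norm_trunc_le(1) R(1) s1(1) d(1)]) (assumption, rule that)
  obtain G' where G': "compactly_supported G'" "\<And>x. norm (G' x) \<le> real n"
    "(\<integral>\<^sup>+x. norm (?G1 x - G' x) \<partial>lborel) \<le> ennreal (\<epsilon> / (4 * (real m + 1)))"
    by (rule approx_compactly_supported[OF trunc_measurable[OF G] norm_trunc_le(1) R(1) s1(2) d(2)]) (assumption, rule that)
  note [measurable] = borel_measurable_integrable[OF compactly_supported_integrable[OF F'(1)]]
    borel_measurable_integrable[OF compactly_supported_integrable[OF G'(1)]]
  have "(\<integral>\<^sup>+x. norm (F (x - y) * G (x - z) - F' (x - y) * G' (x - z)) \<partial>lborel) \<le> ennreal \<epsilon>" for y z
  proof -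
    \<comment> \<open>Each term is written as a function of \<open>x - y\<close> or
      \<open>x - z\<close> alone, the other shift becoming \<open>z - y\<close> or
      \<open>y - z\<close>. Translation invariance then removes the outer shift, and the uniformity
      in \<open>trunc_ok\<close> takes care of the inner one.\<close>
    let ?t1 = "\<lambda>x. ennreal (norm (F x - ?F1 x) * norm (G (x - (z - y))))"
    let ?t2 = "\<lambda>x. ennreal (norm (G x - ?G1 x) * norm (F (x - (y - z))))"
    let ?t3 = "\<lambda>x. ennreal (norm (?F1 x - F' x))"
    let ?t4 = "\<lambda>x. ennreal (norm (?G1 x - G' x))"
    have "(\<integral>\<^sup>+x. norm (F (x - y) * G (x - z) - F' (x - y) * G' (x - z)) \<partial>lborel) \<le>
        (\<integral>\<^sup>+x. ?t1 (x - y) + ?t2 (x - z) + ennreal (real n) * ?t3 (x - y) + ennreal (real m) * ?t4 (x - z) \<partial>lborel)"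
    proof (rule nn_integral_mono)
      fix x
      have "norm (F (x - y) * G (x - z) - F' (x - y) * G' (x - z)) \<le>
          norm (F (x - y) - ?F1 (x - y)) * norm (G (x - z)) + norm (?F1 (x - y)) * norm (G (x - z) - ?G1 (x - z)) +
          norm (?F1 (x - y) - F' (x - y)) * norm (?G1 (x - z)) + norm (F' (x - y)) * norm (?G1 (x - z) - G' (x - z))"
        by (rule norm_product_diff_le)
      also have "\<dots> \<le> norm (F (x - y) - ?F1 (x - y)) * norm (G (x - z)) + norm (F (x - y)) * norm (G (x - z) - ?G1 (x - z)) +
          norm (?F1 (x - y) - F' (x - y)) * real n + real m * norm (?G1 (x - z) - G' (x - z))"
        by (intro add_mono mult_mono order_refl norm_trunc_le F') auto
      finally have "norm (F (x - y) * G (x - z) - F' (x - y) * G' (x - z)) \<le>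
          norm (F (x - y) - ?F1 (x - y)) * norm (G (x - z)) + norm (G (x - z) - ?G1 (x - z)) * norm (F (x - y)) +
          real n * norm (?F1 (x - y) - F' (x - y)) + real m * norm (?G1 (x - z) - G' (x - z))"
        by (simp only: mult.commute)
      from ennreal_leI[OF this]
      show "ennreal (norm (F (x - y) * G (x - z) - F' (x - y) * G' (x - z))) \<le>
          ?t1 (x - y) + ?t2 (x - z) + ennreal (real n) * ?t3 (x - y) + ennreal (real m) * ?t4 (x - z)"
        by (simp add: ennreal_mult)
    qed
    also have "\<dots> = (\<integral>\<^sup>+x. ?t1 (x - y) \<partial>lborel) + (\<integral>\<^sup>+x. ?t2 (x - z) \<partial>lborel) +
        ennreal (real n) * (\<integral>\<^sup>+x. ?t3 (x - y) \<partial>lborel) + ennreal (real m) * (\<integral>\<^sup>+x. ?t4 (x - z) \<partial>lborel)"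
      by (simp add: nn_integral_add nn_integral_cmult)
    also have "(\<integral>\<^sup>+x. ?t1 (x - y) \<partial>lborel) = (\<integral>\<^sup>+x. ?t1 x \<partial>lborel)"
      by (rule nn_integral_translate) measurable
    also have "(\<integral>\<^sup>+x. ?t2 (x - z) \<partial>lborel) = (\<integral>\<^sup>+x. ?t2 x \<partial>lborel)"
      by (rule nn_integral_translate) measurable
    also have "(\<integral>\<^sup>+x. ?t3 (x - y) \<partial>lborel) = (\<integral>\<^sup>+x. ?t3 x \<partial>lborel)"
      by (rule nn_integral_translate) measurable
    also have "(\<integral>\<^sup>+x. ?t4 (x - z) \<partial>lborel) = (\<integral>\<^sup>+x. ?t4 x \<partial>lborel)"
      by (rule nn_integral_translate) measurable
    also have "(\<integral>\<^sup>+x. ?t1 x \<partial>lborel) + (\<integral>\<^sup>+x. ?t2 x \<partial>lborel) +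
        ennreal (real n) * (\<integral>\<^sup>+x. ?t3 x \<partial>lborel) + ennreal (real m) * (\<integral>\<^sup>+x. ?t4 x \<partial>lborel) \<le>
        ennreal (\<epsilon> / 4) + ennreal (\<epsilon> / 4) + ennreal (real n) * ennreal (\<epsilon> / (4 * (real n + 1))) +
        ennreal (real m) * ennreal (\<epsilon> / (4 * (real m + 1)))"
      by (intro add_mono mult_left_mono m n F'(3) G'(3)) auto
    also have "\<dots> \<le> ennreal (\<epsilon> / 4) + ennreal (\<epsilon> / 4) + ennreal (\<epsilon> / 4) + ennreal (\<epsilon> / 4)"
    proof -
      have "real k * (\<epsilon> / (4 * (real k + 1))) \<le> \<epsilon> / 4" for k
        using \<epsilon> by (simp add: field_simps)
      then have "ennreal (real k) * ennreal (\<epsilon> / (4 * (real k + 1))) \<le> ennreal (\<epsilon> / 4)" for k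
        using \<epsilon> by (simp add: ennreal_mult[symmetric] ennreal_leI)
      then show ?thesis by (intro add_mono order_refl)
    qed
    also have "\<dots> = ennreal \<epsilon>"
      using \<epsilon> by (simp add: ennreal_plus[symmetric] del: ennreal_plus)
    finally show ?thesis .
  qed
  with F'(1) G'(1)
  show "\<exists>F' G'. compactly_supported F' \<and> compactly_supported G' \<and>
     (\<forall>y z. (\<integral>\<^sup>+x. norm (F (x - y) * G (x - z) - F' (x - y) * G' (x - z)) \<partial>lborel) \<le> ennreal \<epsilon>)" by blast
qed

section \<open>Regular distributions and uniqueness\<close>

lemma smooth_loc_int:
  fixes a :: "real^'n \<Rightarrow> complex"
  assumes a: "smooth a" shows "loc_int a"
  unfolding loc_int_def
proof (intro conjI allI)
  show m: "a \<in> borel_measurable borel" using a by (rule smooth_borel)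
  fix R :: real
  have "compact (a ` cball 0 R)"
    by (intro compact_continuous_image smooth_continuous_on a compact_cball)
  then obtain B where B: "\<And>x. x \<in> cball 0 R \<Longrightarrow> norm (a x) \<le> B"
    by (meson bounded_iff compact_imp_bounded imageI)
  show "integrable lborel (\<lambda>x. indicator (cball 0 R) x *\<^sub>R a x)"
  proof (rule integrable_bounded_support[where B = "\<bar>B\<bar>" and R = R])
    show "(\<lambda>x. indicator (cball 0 R) x *\<^sub>R a x) \<in> borel_measurable borel"
      by (intro borel_measurable_scaleR borel_measurable_indicator m) simp
    fix x
    show "norm (indicator (cball 0 R) x *\<^sub>R a x) \<le> \<bar>B\<bar>" using B[of x] by (auto simp: indicator_def)
  qed (auto simp: indicator_def)
qed

lemma norm_le_C_seminorm:
  assumes \<phi>: "\<phi> \<in> test_functions"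
  shows "norm (\<phi> x) \<le> C_seminorm 0 \<phi>"
proof -
  obtain B where B: "0 < B" "\<And>x. norm (\<phi> x) \<le> B"
    by (rule norm_bounded_schwartz[OF test_functions_schwartz[OF \<phi>]]) (rule that)
  have "bdd_above (range (\<lambda>x. norm (\<phi> x)))" using B(2) by (auto intro!: bdd_aboveI[of _ B])
  then have "norm (\<phi> x) \<le> (SUP x. norm (\<phi> x))" by (rule cSUP_upper[rotated]) simp
  moreover have "{js :: 'a list. length js \<le> 0} = {[]}" by auto
  ultimately show ?thesis by (simp add: C_seminorm_def)
qed

lemma test_functions_add:
  assumes "\<phi> \<in> test_functions" "\<theta> \<in> test_functions"
  shows "(\<lambda>x. \<phi> x + \<theta> x) \<in> test_functions"
proof -
  obtain R1 where R1: "0 < R1" "\<And>x. norm x > R1 \<Longrightarrow> \<phi> x = 0" by (rule test_function_support[OF assms(1)]) (rule that)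
  obtain R2 where R2: "0 < R2" "\<And>x. norm x > R2 \<Longrightarrow> \<theta> x = 0" by (rule test_function_support[OF assms(2)]) (rule that)
  show ?thesis
    by (rule test_functionsI[of _ "max R1 R2"])
      (use assms R1 R2 in \<open>auto simp: test_functions_def intro: smooth_add\<close>)
qed

lemma test_functions_cmult: "\<phi> \<in> test_functions \<Longrightarrow> (\<lambda>x. c * \<phi> x) \<in> test_functions"
  by (rule test_functions_mult[OF smooth_const])

text \<open>On a compact set the seminorm of order 0 is enough: the constant is the integral of the
  modulus of \<open>f\<close> over a ball that contains the set.\<close>

lemma regular_distr_in_distributions:
  fixes f :: "real^'n \<Rightarrow> complex"
  assumes f: "loc_int f" shows "regular_distr f \<in> distributions"
proof -
  note fb = loc_int_borel[OF f]
  have eq: "regular_distr f \<phi> = (LINT x|lborel. f x * \<phi> x)" if "\<phi> \<in> test_functions" for \<phi>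
    using regular_distr_borel[OF fb that] .
  have int: "integrable lborel (\<lambda>x. f x * \<phi> x)" if "\<phi> \<in> test_functions" for \<phi>
    using loc_int_test[OF f that] .
  have lin: "linear_functional_on test_functions (regular_distr f)"
    unfolding linear_functional_on_def
  proof (intro conjI ballI allI)
    fix \<phi> \<theta> :: "real^'n \<Rightarrow> complex" assume T: "\<phi> \<in> test_functions" "\<theta> \<in> test_functions"
    show "regular_distr f (\<lambda>x. \<phi> x + \<theta> x) = regular_distr f \<phi> + regular_distr f \<theta>"
      using int[OF T(1)] int[OF T(2)] by (simp add: eq T test_functions_add distrib_left)
  next
    fix c and \<phi> :: "real^'n \<Rightarrow> complex" assume T: "\<phi> \<in> test_functions"
    have "f x * (c * \<phi> x) = c * (f x * \<phi> x)" for x by simp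
    then show "regular_distr f (\<lambda>x. c * \<phi> x) = c * regular_distr f \<phi>"
      by (simp only: eq[OF T] eq[OF test_functions_cmult[OF T]] integral_mult_right_zero)
  qed
  have bound: "\<exists>C N. \<forall>\<phi>\<in>test_functions. closure {x. \<phi> x \<noteq> 0} \<subseteq> K \<longrightarrow> norm (regular_distr f \<phi>) \<le> C * C_seminorm N \<phi>"
    if K: "compact K" for K
  proof -
    obtain R where R: "K \<subseteq> cball 0 R"
      using compact_imp_bounded[OF K] by (force simp: bounded_iff subset_iff)
    let ?f = "\<lambda>x. indicator (cball 0 R) x *\<^sub>R f x"
    have i: "integrable lborel ?f" using f by (simp add: loc_int_def)
    have "norm (regular_distr f \<phi>) \<le> (LINT x|lborel. norm (?f x)) * C_seminorm 0 \<phi>"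
      if \<phi>: "\<phi> \<in> test_functions" and supp: "closure {x. \<phi> x \<noteq> 0} \<subseteq> K" for \<phi>
    proof -
      have "norm (LINT x|lborel. f x * \<phi> x) \<le> (LINT x|lborel. norm (?f x) * C_seminorm 0 \<phi>)"
      proof (rule Bochner_Integration.integral_norm_bound_integral)
        show "integrable lborel (\<lambda>x. f x * \<phi> x)" using int[OF \<phi>] .
        show "integrable lborel (\<lambda>x. norm (?f x) * C_seminorm 0 \<phi>)"
          by (intro integrable_mult_left integrable_norm i)
        fix x
        show "norm (f x * \<phi> x) \<le> norm (?f x) * C_seminorm 0 \<phi>"
        proof (cases "\<phi> x = 0")
          case False
          have "x \<in> closure {x. \<phi> x \<noteq> 0}" by (rule subsetD[OF closure_subset]) (use False in simp)
          then have "x \<in> cball 0 R" using supp R by blast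
          then show ?thesis using norm_le_C_seminorm[OF \<phi>, of x]
            by (simp add: norm_mult mult_left_mono)
        next
          case True
          have "0 \<le> C_seminorm 0 \<phi>" using norm_le_C_seminorm[OF \<phi>, of x] norm_ge_zero order_trans by blast
          then show ?thesis using True by simp
        qed
      qed
      also have "\<dots> = (LINT x|lborel. norm (?f x)) * C_seminorm 0 \<phi>" by (rule integral_mult_left_zero)
      finally show ?thesis by (simp add: eq[OF \<phi>])
    qed
    then show ?thesis by blast
  qed
  show ?thesis
    using lin bound by (auto simp: distributions_def regular_distr_def)
qed

text \<open>The test function is \<open>cnj (d x0)\<close> times a bump at \<open>x0\<close>. Near
  \<open>x0\<close> the real part of \<open>d x * cnj (d x0)\<close> is at least half its value at
  \<open>x0\<close>, so the integral would have positive real part if \<open>d x0\<close> were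
  nonzero.\<close>

lemma smooth_eq_zero_if_orthogonal:
  fixes d :: "real^'n \<Rightarrow> complex"
  assumes d: "smooth d" and orth: "\<And>\<phi>. \<phi> \<in> test_functions \<Longrightarrow> (LINT x|lborel. d x * \<phi> x) = 0"
  shows "d x0 = 0"
proof (rule ccontr)
  assume nz: "d x0 \<noteq> 0"
  have "isCont d x0" using smooth_differentiable[OF d] differentiable_imp_continuous_within by blast
  then obtain r where r: "0 < r" "\<And>x. dist x x0 < r \<Longrightarrow> dist (d x) (d x0) < norm (d x0) / 2"
    using nz unfolding continuous_at_eps_delta by (metis half_gt_zero zero_less_norm_iff)
  \<comment> \<open>The bump is 1 up to distance \<open>\<epsilon>\<close> and vanishes from
    \<open>2 * \<epsilon>\<close> on, which is less than \<open>r\<close>.\<close>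
  define \<epsilon> where "\<epsilon> = r / 3"
  have \<epsilon>: "0 < \<epsilon>" using r by (simp add: \<epsilon>_def)
  define b where "b x = bump ((- inverse \<epsilon>) *\<^sub>R x0 + dil (\<chi> j. inverse \<epsilon>) x)" for x
  have bx: "b x = bump (inverse \<epsilon> *\<^sub>R (x - x0))" for x
    by (simp add: b_def dil_const algebra_simps)
  have nx: "norm (inverse \<epsilon> *\<^sub>R (x - x0)) = norm (x - x0) / \<epsilon>" for x
    unfolding norm_scaleR using \<epsilon> by (simp add: divide_inverse mult.commute)
  have b0: "b x = 0" if "2 * \<epsilon> \<le> norm (x - x0)" for x
    unfolding bx using that \<epsilon> by (intro bump_eq_0) (simp only: nx pos_le_divide_eq)
  have b1: "b x = 1" if "norm (x - x0) \<le> \<epsilon>" for x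
    unfolding bx using that \<epsilon> by (intro bump_eq_1) (simp only: nx pos_divide_le_eq mult_1)
  define \<phi> where "\<phi> x = cnj (d x0) * b x" for x
  have "b \<in> test_functions"
  proof (rule test_functionsI[of _ "norm x0 + 2 * \<epsilon>"])
    show "smooth b" unfolding b_def[abs_def] by (intro smooth_affine smooth_bump)
    fix x :: "real^'n" assume "norm x > norm x0 + 2 * \<epsilon>"
    then show "b x = 0" using norm_triangle_ineq2[of x x0] by (intro b0) linarith
  qed
  then have \<phi>: "\<phi> \<in> test_functions" unfolding \<phi>_def[abs_def] by (rule test_functions_cmult)
  let ?c = "(norm (d x0))\<^sup>2 / 2"
  have c: "0 < ?c" using nz by simp
  have Re_le: "?c \<le> Re (d x * cnj (d x0))" if "norm (x - x0) < r" for x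
  proof -
    have "norm (d x - d x0) < norm (d x0) / 2" using r(2)[of x] that by (simp add: dist_norm)
    then have "norm ((d x - d x0) * cnj (d x0)) \<le> norm (d x0) / 2 * norm (d x0)"
      unfolding norm_mult by (intro mult_mono) auto
    then have "\<bar>Re ((d x - d x0) * cnj (d x0))\<bar> \<le> ?c"
      using abs_Re_le_cmod[of "(d x - d x0) * cnj (d x0)"] by (simp add: power2_eq_square)
    moreover have "Re (d x * cnj (d x0)) = Re ((d x - d x0) * cnj (d x0)) + (norm (d x0))\<^sup>2"
    proof -
      have "Re (d x0 * cnj (d x0)) = (norm (d x0))\<^sup>2"
        by (simp only: complex_norm_square[symmetric] Re_complex_of_real)
      then show ?thesis by (simp only: left_diff_distrib minus_complex.sel)
    qed
    ultimately show ?thesis by linarith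
  qed
  have int: "integrable lborel (\<lambda>x. d x * \<phi> x)" by (rule loc_int_test[OF smooth_loc_int[OF d] \<phi>])
  have "?c * measure lborel (cball x0 \<epsilon>) = (LINT x|lborel. indicator (cball x0 \<epsilon>) x *\<^sub>R ?c)"
    by simp
  also have "\<dots> \<le> (LINT x|lborel. Re (d x * \<phi> x))"
  proof (rule integral_mono)
    show "integrable lborel (\<lambda>x. indicator (cball x0 \<epsilon>) x *\<^sub>R ?c)"
      using emeasure_lborel_cball_finite[of x0 \<epsilon>] by (intro integrable_scaleR_left integrable_real_indicator) auto
    show "integrable lborel (\<lambda>x. Re (d x * \<phi> x))"
      by (rule integrable_bounded_linear[OF bounded_linear_Re int])
    fix x
    have e: "Re (d x * \<phi> x) = Re (d x * cnj (d x0)) * bump_profile (inverse \<epsilon> *\<^sub>R (x - x0))"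
      unfolding \<phi>_def bx bump_def mult.assoc[symmetric] by simp
    show "indicator (cball x0 \<epsilon>) x *\<^sub>R ?c \<le> Re (d x * \<phi> x)"
    proof (cases "norm (x - x0) \<le> \<epsilon>")
      case True
      then have "Re (d x * \<phi> x) = Re (d x * cnj (d x0))" using b1[OF True] by (simp add: \<phi>_def)
      moreover have "norm (x - x0) < r" using True r(1) by (simp add: \<epsilon>_def)
      moreover have "indicator (cball x0 \<epsilon>) x *\<^sub>R ?c = ?c"
        using True by (simp add: dist_norm norm_minus_commute)
      ultimately show ?thesis using Re_le[of x] by argo
    next
      case False
      then have i: "indicator (cball x0 \<epsilon>) x = (0::real)" by (simp add: dist_norm norm_minus_commute)
      have "0 \<le> Re (d x * \<phi> x)"
      proof (cases "2 * \<epsilon> \<le> norm (x - x0)")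
        case True
        then show ?thesis using b0[OF True] by (simp add: \<phi>_def)
      next
        case False
        then have "norm (x - x0) < r" using r(1) by (simp add: \<epsilon>_def)
        then have "0 \<le> Re (d x * cnj (d x0))" using Re_le[of x] c by linarith
        then show ?thesis unfolding e by (intro mult_nonneg_nonneg bump_profile_bounds)
      qed
      then show ?thesis using i by simp
    qed
  qed
  also have "\<dots> = Re (LINT x|lborel. d x * \<phi> x)"
    by (rule integral_bounded_linear[OF bounded_linear_Re int])
  also have "\<dots> = 0" using orth[OF \<phi>] by simp
  finally have "?c * measure lborel (cball x0 \<epsilon>) \<le> 0" .
  moreover have "0 < measure lborel (cball x0 \<epsilon>)" using content_cball_pos[OF \<epsilon>, of x0] by simp
  ultimately show False using c by (simp add: mult_le_0_iff)
qed

lemma smooth_regular_distr_inject: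
  assumes a: "smooth a" and b: "smooth b" and eq: "regular_distr a = regular_distr b"
  shows "a = b"
proof
  fix x
  have "(LINT x|lborel. (a x - b x) * \<phi> x) = 0" if \<phi>: "\<phi> \<in> test_functions" for \<phi>
  proof -
    have "(LINT x|lborel. a x * \<phi> x) = (LINT x|lborel. b x * \<phi> x)"
      using fun_cong[OF eq, of \<phi>] by (simp only: regular_distr_borel[OF smooth_borel[OF a] \<phi>] regular_distr_borel[OF smooth_borel[OF b] \<phi>])
    then show ?thesis
      using loc_int_test[OF smooth_loc_int[OF a] \<phi>] loc_int_test[OF smooth_loc_int[OF b] \<phi>]
      by (simp add: left_diff_distrib)
  qed
  from smooth_eq_zero_if_orthogonal[OF smooth_diff[OF a b] this, of x] show "a x = b x" by simp
qed

text \<open>The smooth representatives are existentially quantified in the predicate, so they must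
  be identified before the limits can be compared. Equality on test functions then extends to
  equality of the functionals by extensionality.\<close>

lemma lowpass_product_tendsto_unique:
  fixes w w' :: "(real^'n \<Rightarrow> complex) \<Rightarrow> complex"
  assumes "lowpass_product_tendsto M \<psi> u v w" "lowpass_product_tendsto M \<psi> u v w'"
  shows "w = w'"
proof -
  obtain a b where ab: "\<And>k. smooth (a k) \<and> given_by (lowpass M \<psi> k u) (a k) \<and> smooth (b k) \<and> given_by (lowpass M \<psi> k v) (b k)"
    and t: "tendsto_distr (\<lambda>k. regular_distr (\<lambda>x. a k x * b k x)) w"
    using assms(1) unfolding lowpass_product_tendsto_def by blast
  obtain a' b' where ab': "\<And>k. smooth (a' k) \<and> given_by (lowpass M \<psi> k u) (a' k) \<and> smooth (b' k) \<and> given_by (lowpass M \<psi> k v) (b' k)"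
    and t': "tendsto_distr (\<lambda>k. regular_distr (\<lambda>x. a' k x * b' k x)) w'"
    using assms(2) unfolding lowpass_product_tendsto_def by blast
  have "a k = a' k" for k
    by (rule smooth_regular_distr_inject) (use ab[of k] ab'[of k] in \<open>auto simp: given_by_def\<close>)
  moreover have "b k = b' k" for k
    by (rule smooth_regular_distr_inject) (use ab[of k] ab'[of k] in \<open>auto simp: given_by_def\<close>)
  ultimately have t': "tendsto_distr (\<lambda>k. regular_distr (\<lambda>x. a k x * b k x)) w'" using t' by simp
  show ?thesis
  proof (rule extensionalityI[where A = test_functions])
    show "w \<in> extensional test_functions" "w' \<in> extensional test_functions"
      using t t' by (auto simp: tendsto_distr_def distributions_def)
    fix \<phi> :: "real^'n \<Rightarrow> complex" assume \<phi>: "\<phi> \<in> test_functions"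
    show "w \<phi> = w' \<phi>"
      by (rule LIMSEQ_unique[of "\<lambda>k. regular_distr (\<lambda>x. a k x * b k x) \<phi>"])
         (use t t' \<phi> in \<open>auto simp: tendsto_distr_def\<close>)
  qed
qed

text \<open>The hypotheses speak of Lebesgue measurability, while the Fubini arguments run over
  Borel functions; real and imaginary parts are changed on null sets.\<close>

lemma borel_representative:
  fixes f :: "real^'n \<Rightarrow> complex"
  assumes f: "f \<in> borel_measurable lebesgue"
  obtains f' where "f' \<in> borel_measurable borel" "AE x in lborel. f x = f' x"
proof -
  have "(\<lambda>x. Re (f x)) \<in> borel_measurable (completion lborel)" "(\<lambda>x. Im (f x)) \<in> borel_measurable (completion lborel)"
    using f by measurable
  from this[THEN completion_ex_borel_measurable_real]
  obtain g h where g: "g \<in> borel_measurable lborel" "AE x in lborel. Re (f x) = g x"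
    and h: "h \<in> borel_measurable lborel" "AE x in lborel. Im (f x) = h x"
    by blast
  note [measurable] = g(1) h(1)
  show ?thesis
  proof
    show "(\<lambda>x. of_real (g x) + \<i> * of_real (h x)) \<in> borel_measurable borel"
      using g(1) h(1) by simp
    show "AE x in lborel. f x = of_real (g x) + \<i> * of_real (h x)"
      using g(2) h(2) by eventually_elim (simp add: complex_eq_iff)
  qed
qed

lemma regular_distr_cong_AE:
  assumes "f \<in> borel_measurable lebesgue" "f' \<in> borel_measurable lebesgue" "AE x in lborel. f x = f' x"
  shows "regular_distr f = regular_distr f'"
  unfolding regular_distr_def
proof (rule restrict_ext)
  fix \<phi> :: "real^'a \<Rightarrow> complex" assume \<phi>: "\<phi> \<in> test_functions"
  have [measurable]: "\<phi> \<in> borel_measurable lebesgue"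
    using schwartz_borel[OF test_functions_schwartz[OF \<phi>]] by (intro measurable_completion) simp
  note [measurable] = assms(1,2)
  show "(LINT x|lebesgue. f x * \<phi> x) = (LINT x|lebesgue. f' x * \<phi> x)"
  proof (rule integral_cong_AE)
    show "AE x in lebesgue. f x * \<phi> x = f' x * \<phi> x"
      unfolding AE_completion_iff using assms(3) by eventually_elim simp
  qed measurable
qed

section \<open>Local Lebesgue spaces\<close>

text \<open>The local condition on balls about 0 and with respect to Borel-Lebesgue measure. By
  \<open>Lp_loc_iff\<close> this captures the local space, and almost everywhere changes of the
  function are easy to follow.\<close>

definition Lp_ball :: "ennreal \<Rightarrow> (real^'n \<Rightarrow> complex) \<Rightarrow> real \<Rightarrow> bool" where
  "Lp_ball p f R \<longleftrightarrow> (if p = \<infinity> then \<exists>C. AE x in lborel. norm x \<le> R \<longrightarrow> norm (f x) \<le> C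
     else (\<integral>\<^sup>+x. ennreal (norm (f x) powr enn2real p) * indicator (cball 0 R) x \<partial>lborel) < \<infinity>)"

lemma Lp_loc_iff: "f \<in> Lp_loc p \<longleftrightarrow> f \<in> borel_measurable lebesgue \<and> (\<forall>R. Lp_ball p f R)"
proof
  assume L: "f \<in> Lp_loc p"
  note L' = L[unfolded Lp_loc_def mem_Collect_eq AE_completion_iff nn_integral_completion]
  have K: "if p = \<infinity> then \<exists>C. AE x in lborel. x \<in> K \<longrightarrow> norm (f x) \<le> C
      else (\<integral>\<^sup>+x\<in>K. ennreal (norm (f x) powr enn2real p) \<partial>lborel) < \<infinity>" if "compact K" for K
    by (rule L'[THEN conjunct2, rule_format, OF that])
  have "Lp_ball p f R" for R
    using K[OF compact_cball[of 0 R]] by (cases "p = \<infinity>") (simp_all add: Lp_ball_def)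
  then show "f \<in> borel_measurable lebesgue \<and> (\<forall>R. Lp_ball p f R)" using L by (simp add: Lp_loc_def)
next
  assume A: "f \<in> borel_measurable lebesgue \<and> (\<forall>R. Lp_ball p f R)"
  have "if p = \<infinity> then \<exists>C. AE x in lborel. x \<in> K \<longrightarrow> norm (f x) \<le> C
      else (\<integral>\<^sup>+x\<in>K. ennreal (norm (f x) powr enn2real p) \<partial>lborel) < \<infinity>" if K: "compact K" for K
  proof -
    obtain R where R: "K \<subseteq> cball 0 R"
      using compact_imp_bounded[OF K] by (force simp: bounded_iff subset_iff)
    have b: "Lp_ball p f R" using A by simp
    show ?thesis
    proof (cases "p = \<infinity>")
      case True
      with b obtain C where "AE x in lborel. norm x \<le> R \<longrightarrow> norm (f x) \<le> C" by (auto simp: Lp_ball_def)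
      then have "AE x in lborel. x \<in> K \<longrightarrow> norm (f x) \<le> C"
        by eventually_elim (use R in auto)
      with True show ?thesis by auto
    next
      case False
      have "(\<integral>\<^sup>+x\<in>K. ennreal (norm (f x) powr enn2real p) \<partial>lborel) \<le>
          (\<integral>\<^sup>+x. ennreal (norm (f x) powr enn2real p) * indicator (cball 0 R) x \<partial>lborel)"
        using R by (intro nn_integral_mono mult_left_mono) (auto simp: indicator_def)
      with b False show ?thesis by (auto simp: Lp_ball_def intro: le_less_trans)
    qed
  qed
  then show "f \<in> Lp_loc p"
    unfolding Lp_loc_def AE_completion_iff nn_integral_completion mem_Collect_eq using A by blast
qed

lemma Lp_ball_cong_AE:
  assumes eq: "AE x in lborel. f x = f' x" and L: "Lp_ball p f R"
  shows "Lp_ball p f' R"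
proof (cases "p = \<infinity>")
  case True
  with L obtain C where "AE x in lborel. norm x \<le> R \<longrightarrow> norm (f x) \<le> C" by (auto simp: Lp_ball_def)
  with eq have "AE x in lborel. norm x \<le> R \<longrightarrow> norm (f' x) \<le> C" by eventually_elim simp
  with True show ?thesis by (auto simp: Lp_ball_def)
next
  case False
  have "(\<integral>\<^sup>+x. ennreal (norm (f x) powr enn2real p) * indicator (cball 0 R) x \<partial>lborel) =
      (\<integral>\<^sup>+x. ennreal (norm (f' x) powr enn2real p) * indicator (cball 0 R) x \<partial>lborel)"
    by (rule nn_integral_cong_AE) (use eq in eventually_elim, simp)
  with False L show ?thesis by (simp add: Lp_ball_def)
qed

lemma powr_le_one_plus:
  fixes a s P :: real
  assumes "0 \<le> a" "0 < s" "s \<le> P"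
  shows "a powr s \<le> 1 + a powr P"
proof (cases "a \<le> 1")
  case True
  then have "a powr s \<le> 1" using assms by (intro powr_le1) auto
  then show ?thesis using powr_ge_zero[of a P] by linarith
next
  case False
  then have "a powr s \<le> a powr P" using assms by (intro powr_mono) auto
  then show ?thesis by simp
qed

text \<open>On a ball, which has finite measure, a smaller exponent gives a weaker condition:
  \<open>a powr s \<le> 1 + a powr P\<close> for \<open>0 < s \<le> P\<close>. This allows the
  second exponent to be lowered to the conjugate of the first.\<close>

lemma Lp_ball_lower:
  fixes f :: "real^'n \<Rightarrow> complex"
  assumes f[measurable]: "f \<in> borel_measurable borel" and L: "Lp_ball p f R" "p \<noteq> \<infinity>"
    and s: "0 < s" "s \<le> enn2real p"
  shows "(\<integral>\<^sup>+x. ennreal (norm (f x) powr s) * indicator (cball 0 R) x \<partial>lborel) < \<infinity>"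
proof -
  have i[measurable]: "(indicator (cball 0 R) :: real^'n \<Rightarrow> ennreal) \<in> borel_measurable borel"
    by (intro borel_measurable_indicator) simp
  have "(\<integral>\<^sup>+x. ennreal (norm (f x) powr s) * indicator (cball 0 R) x \<partial>lborel) \<le>
      (\<integral>\<^sup>+x. indicator (cball 0 R) x + ennreal (norm (f x) powr enn2real p) * indicator (cball 0 R) x \<partial>lborel)"
  proof (rule nn_integral_mono)
    fix x
    have "ennreal (norm (f x) powr s) \<le> 1 + ennreal (norm (f x) powr enn2real p)"
      using powr_le_one_plus[OF norm_ge_zero[of "f x"] s]
      by (simp add: ennreal_1[symmetric] ennreal_plus[symmetric] ennreal_leI del: ennreal_1 ennreal_plus)
    then show "ennreal (norm (f x) powr s) * indicator (cball 0 R) x \<le>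
        indicator (cball 0 R) x + ennreal (norm (f x) powr enn2real p) * indicator (cball 0 R) x"
      by (simp add: indicator_def)
  qed
  also have "\<dots> = emeasure lborel (cball (0::real^'n) R) + (\<integral>\<^sup>+x. ennreal (norm (f x) powr enn2real p) * indicator (cball 0 R) x \<partial>lborel)"
    by (subst nn_integral_add) auto
  also have "\<dots> < \<infinity>"
    using L emeasure_lborel_cball_finite[of "0::real^'n" R] by (simp add: Lp_ball_def)
  finally show ?thesis .
qed

lemma Lp_ball_loc_int:
  fixes f :: "real^'n \<Rightarrow> complex"
  assumes f[measurable]: "f \<in> borel_measurable borel" and L: "\<And>R. Lp_ball p f R"
    and p: "p \<noteq> \<infinity> \<Longrightarrow> 1 \<le> enn2real p"
  shows "loc_int f"
  unfolding loc_int_def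
proof (intro conjI allI f)
  fix R
  have m: "(\<lambda>x. indicator (cball 0 R) x *\<^sub>R f x) \<in> borel_measurable borel"
    by (intro borel_measurable_scaleR borel_measurable_indicator f) simp
  show "integrable lborel (\<lambda>x. indicator (cball 0 R) x *\<^sub>R f x)"
  proof (cases "p = \<infinity>")
    case True
    then obtain C where C: "AE x in lborel. norm x \<le> R \<longrightarrow> norm (f x) \<le> C" using L[of R] by (auto simp: Lp_ball_def)
    show ?thesis
    proof (rule Bochner_Integration.integrable_bound)
      show "integrable lborel (\<lambda>x::real^'n. indicator (cball 0 R) x *\<^sub>R \<bar>C\<bar>)"
        using emeasure_lborel_cball_finite[of "0::real^'n" R] by (intro integrable_scaleR_left integrable_real_indicator) auto
      show "AE x in lborel. norm (indicator (cball 0 R) x *\<^sub>R f x) \<le> norm (indicator (cball 0 R) x *\<^sub>R \<bar>C\<bar>)"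
        using C by eventually_elim (auto simp: indicator_def)
    qed (use m in simp)
  next
    case False
    have "(\<integral>\<^sup>+x. ennreal (norm (f x) powr 1) * indicator (cball 0 R) x \<partial>lborel) < \<infinity>"
      by (rule Lp_ball_lower[OF f L False]) (use p False in auto)
    moreover have "ennreal (norm (indicator (cball 0 R) x *\<^sub>R f x)) = ennreal (norm (f x) powr 1) * indicator (cball 0 R) x" for x
      by (simp add: indicator_def)
    ultimately show ?thesis using m by (simp add: integrable_iff_bounded)
  qed
qed

lemma cut_powr_finite:
  fixes f :: "real^'n \<Rightarrow> complex"
  assumes R: "0 < R" and s: "0 < s"
    and fin: "(\<integral>\<^sup>+x. ennreal (norm (f x) powr s) * indicator (cball 0 (2 * R)) x \<partial>lborel) < \<infinity>"
  shows "(\<integral>\<^sup>+x. ennreal (norm (f x * cut R x) powr s) \<partial>lborel) < \<infinity>"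
proof -
  have "(\<integral>\<^sup>+x. ennreal (norm (f x * cut R x) powr s) \<partial>lborel) \<le>
      (\<integral>\<^sup>+x. ennreal (norm (f x) powr s) * indicator (cball 0 (2 * R)) x \<partial>lborel)"
  proof (rule nn_integral_mono)
    fix x
    show "ennreal (norm (f x * cut R x) powr s) \<le> ennreal (norm (f x) powr s) * indicator (cball 0 (2 * R)) x"
    proof (cases "norm x \<le> 2 * R")
      case True
      have "norm (f x * cut R x) \<le> norm (f x) * 1" unfolding norm_mult by (intro mult_left_mono norm_cut_le) simp
      then have "norm (f x * cut R x) powr s \<le> norm (f x) powr s" using s by (intro powr_mono2) auto
      then show ?thesis using True by (simp add: ennreal_leI)
    next
      case False
      then have "cut R x = 0" by (intro cut_eq_0 R) simp
      then show ?thesis by simp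
    qed
  qed
  with fin show ?thesis by (rule le_less_trans[rotated])
qed

lemma cut_bounded:
  assumes R: "0 < R" and L: "Lp_ball \<infinity> f (2 * R)"
  obtains C where "AE x in lborel. norm (f x * cut R x) \<le> C"
proof -
  obtain C where C: "AE x in lborel. norm x \<le> 2 * R \<longrightarrow> norm (f x) \<le> C" using L by (auto simp: Lp_ball_def)
  have "AE x in lborel. norm (f x * cut R x) \<le> \<bar>C\<bar>"
    using C
  proof eventually_elim
    case (elim x)
    show ?case
    proof (cases "norm x \<le> 2 * R")
      case True
      have "norm (f x * cut R x) \<le> norm (f x) * 1" unfolding norm_mult by (intro mult_left_mono norm_cut_le) simp
      with True elim show ?thesis by linarith
    next
      case False
      then have "cut R x = 0" by (intro cut_eq_0 R) simp
      then show ?thesis by simp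
    qed
  qed
  then show ?thesis by (rule that)
qed

lemma finite_exponent:
  assumes "0 < p" "p \<noteq> (\<infinity> :: ennreal)"
  shows "0 < enn2real p" "1 / p = ennreal (1 / enn2real p)" "p = ennreal (enn2real p)"
proof -
  show p: "p = ennreal (enn2real p)" using assms by (simp add: less_top)
  show pos: "0 < enn2real p" using assms by (simp add: enn2real_positive_iff less_top)
  have "1 / ennreal (enn2real p) = ennreal (1 / enn2real p)"
    using divide_ennreal[of 1 "enn2real p"] pos by simp
  then show "1 / p = ennreal (1 / enn2real p)" using p by simp
qed

lemma exponent_ge_1:
  assumes "0 < p" "p \<noteq> (\<infinity> :: ennreal)" "1 / p \<le> 1"
  shows "1 \<le> enn2real p"
proof -
  have "ennreal (1 / enn2real p) \<le> ennreal 1"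
    using assms finite_exponent(2)[OF assms(1,2)] by simp
  then have "1 / enn2real p \<le> 1" by (subst (asm) ennreal_le_iff) auto
  then show ?thesis using finite_exponent(1)[OF assms(1,2)] by (simp add: divide_le_eq)
qed

text \<open>Three cases. An essentially bounded left factor is not changed by a high truncation; a
  bounded right factor meets an integrable left one; and for two finite exponents the right one is
  lowered to the conjugate of the left one.\<close>

lemma trunc_ok_Lp:
  fixes f g :: "real^'n \<Rightarrow> complex"
  assumes f[measurable]: "f \<in> borel_measurable borel" and g[measurable]: "g \<in> borel_measurable borel"
    and Lf: "\<And>R. Lp_ball p f R" and Lg: "\<And>R. Lp_ball q g R"
    and p: "0 < p" and q: "0 < q" and pq: "1 / p + 1 / q \<le> 1" and R: "0 < R"
  shows "trunc_ok (\<lambda>x. f x * cut R x) (\<lambda>x. g x * cut R x)"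
proof -
  have [measurable]: "(cut R :: real^'n \<Rightarrow> complex) \<in> borel_measurable borel" by (rule smooth_borel[OF smooth_cut])
  have p1: "1 / p \<le> 1" and q1: "1 / q \<le> 1"
    using pq by (meson add_increasing add_increasing2 order_refl order_trans zero_le)+
  have cutint: "integrable lborel (\<lambda>x. f x * cut R x)"
    by (intro loc_int_test[OF Lp_ball_loc_int[OF f Lf]] cut_test_function R exponent_ge_1 p p1)
  show ?thesis
  proof (cases "p = \<infinity>")
    case True
    obtain C where "AE x in lborel. norm (f x * cut R x) \<le> C"
      by (rule cut_bounded[OF R, of f]) (use Lf[of "2 * R"] True in simp)
    then show ?thesis by (rule trunc_ok_left_bounded)
  next
    case pf: False
    show ?thesis
    proof (cases "q = \<infinity>")
      case True
      obtain C where "AE x in lborel. norm (g x * cut R x) \<le> C"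
        by (rule cut_bounded[OF R, of g]) (use Lg[of "2 * R"] True in simp)
      then show ?thesis by (intro trunc_ok_right_bounded cutint) measurable
    next
      case qf: False
      define P where "P = enn2real p"
      define Q where "Q = enn2real q"
      have P: "0 < P" "1 / p = ennreal (1 / P)" and Q: "0 < Q" "1 / q = ennreal (1 / Q)"
        using finite_exponent[OF p pf] finite_exponent[OF q qf] by (auto simp: P_def Q_def)
      have "ennreal (1 / P + 1 / Q) \<le> ennreal 1"
        using pq P Q by (simp add: ennreal_plus)
      then have PQ: "1 / P + 1 / Q \<le> 1" by (subst (asm) ennreal_le_iff) auto
      moreover have "0 < 1 / Q" using Q(1) by simp
      ultimately have "1 / P < 1" by linarith
      then have P1: "1 < P" using P(1) by (simp add: divide_less_eq)
      \<comment> \<open>The exponent conjugate to \<open>P\<close>. It exists because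
        \<open>1 / Q > 0\<close> forces \<open>P > 1\<close>, and \<open>s \<le> Q\<close> because
        the reciprocals of \<open>P\<close> and \<open>Q\<close> sum to at most 1.\<close>
      define s where "s = P / (P - 1)"
      have s: "1 < s" "1 / P + 1 / s = 1" using P1 by (auto simp: s_def field_simps)
      have "1 / Q \<le> 1 / s" using PQ s by linarith
      then have sQ: "s \<le> Q" using Q(1) s(1) by (simp add: field_simps)
      show ?thesis
      proof (rule trunc_ok_conjugate[where p = P and q = s])
        show "(\<integral>\<^sup>+x. ennreal (norm (f x * cut R x) powr P) \<partial>lborel) < \<infinity>"
          using P1 by (intro cut_powr_finite[OF R] Lp_ball_lower[OF f Lf pf]) (auto simp: P_def)
        show "(\<integral>\<^sup>+x. ennreal (norm (g x * cut R x) powr s) \<partial>lborel) < \<infinity>"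
          using s(1) sQ by (intro cut_powr_finite[OF R] Lp_ball_lower[OF g Lg qf]) (auto simp: Q_def)
      qed (use P1 s in measurable)
    qed
  qed
qed

lemma good_pair_Lp:
  fixes f g :: "real^'n \<Rightarrow> complex"
  assumes f[measurable]: "f \<in> borel_measurable borel" and g[measurable]: "g \<in> borel_measurable borel"
    and Lf: "\<And>R. Lp_ball p f R" and Lg: "\<And>R. Lp_ball q g R"
    and p: "0 < p" and q: "0 < q" and pq: "1 / p + 1 / q \<le> 1" and R: "0 < R"
  shows "good_pair (\<lambda>x. f x * cut R x) (\<lambda>x. g x * cut R x)"
proof -
  have [measurable]: "(cut R :: real^'n \<Rightarrow> complex) \<in> borel_measurable borel" by (rule smooth_borel[OF smooth_cut])
  have qp: "1 / q + 1 / p \<le> 1" using pq by (simp add: add.commute)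
  show ?thesis
  proof (rule good_pair_of_trunc[where R = "2 * R"])
    show "trunc_ok (\<lambda>x. f x * cut R x) (\<lambda>x. g x * cut R x)"
      by (rule trunc_ok_Lp[OF f g Lf Lg p q pq R])
    show "trunc_ok (\<lambda>x. g x * cut R x) (\<lambda>x. f x * cut R x)"
      by (rule trunc_ok_Lp[OF g f Lg Lf q p qp R])
  qed (use R in \<open>auto simp: cut_eq_0\<close>)
qed

lemma Lp_ball_mult_bounded:
  fixes f g :: "real^'n \<Rightarrow> complex"
  assumes g[measurable]: "g \<in> borel_measurable borel"
    and Lf: "Lp_ball \<infinity> f R" and Lg: "Lp_ball q g R"
  shows "Lp_ball q (\<lambda>x. f x * g x) R"
proof -
  obtain C where C: "AE x in lborel. norm x \<le> R \<longrightarrow> norm (f x) \<le> C" using Lf by (auto simp: Lp_ball_def)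
  show ?thesis
  proof (cases "q = \<infinity>")
    case True
    then obtain D where D: "AE x in lborel. norm x \<le> R \<longrightarrow> norm (g x) \<le> D" using Lg by (auto simp: Lp_ball_def)
    have "AE x in lborel. norm x \<le> R \<longrightarrow> norm (f x * g x) \<le> \<bar>C\<bar> * \<bar>D\<bar>"
      using C D
    proof eventually_elim
      case (elim x)
      show ?case
      proof
        assume "norm x \<le> R"
        with elim show "norm (f x * g x) \<le> \<bar>C\<bar> * \<bar>D\<bar>"
          unfolding norm_mult by (intro mult_mono) auto
      qed
    qed
    with True show ?thesis by (auto simp: Lp_ball_def)
  next
    case False
    let ?Q = "enn2real q"
    have i[measurable]: "(indicator (cball 0 R) :: real^'n \<Rightarrow> ennreal) \<in> borel_measurable borel"
      by (intro borel_measurable_indicator) simp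
    have "(\<integral>\<^sup>+x. ennreal (norm (f x * g x) powr ?Q) * indicator (cball 0 R) x \<partial>lborel) \<le>
        (\<integral>\<^sup>+x. ennreal (\<bar>C\<bar> powr ?Q) * (ennreal (norm (g x) powr ?Q) * indicator (cball 0 R) x) \<partial>lborel)"
    proof (rule nn_integral_mono_AE)
      show "AE x in lborel. ennreal (norm (f x * g x) powr ?Q) * indicator (cball 0 R) x \<le>
          ennreal (\<bar>C\<bar> powr ?Q) * (ennreal (norm (g x) powr ?Q) * indicator (cball 0 R) x)"
        using C
      proof eventually_elim
        case (elim x)
        show ?case
        proof (cases "norm x \<le> R")
          case True
          with elim have "norm (f x) powr ?Q \<le> \<bar>C\<bar> powr ?Q" by (intro powr_mono2) auto
          then have "norm (f x * g x) powr ?Q \<le> \<bar>C\<bar> powr ?Q * norm (g x) powr ?Q"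
            by (simp add: norm_mult powr_mult mult_right_mono)
          then show ?thesis using True by (simp add: ennreal_mult[symmetric] ennreal_leI)
        qed simp
      qed
    qed
    also have "\<dots> = ennreal (\<bar>C\<bar> powr ?Q) * (\<integral>\<^sup>+x. ennreal (norm (g x) powr ?Q) * indicator (cball 0 R) x \<partial>lborel)"
      by (rule nn_integral_cmult) measurable
    also have "\<dots> < \<infinity>" using Lg False by (simp add: Lp_ball_def ennreal_mult_less_top)
    finally show ?thesis using False by (simp add: Lp_ball_def)
  qed
qed

text \<open>For finite exponents: Young's inequality for the powers \<open>t\<close> of
  \<open>norm (f x)\<close> and \<open>norm (g x)\<close>, where \<open>r = t\<close>. The exponents
  \<open>P / t\<close> and \<open>Q / t\<close> are conjugate and exceed 1 for every
  \<open>t\<close> that occurs, including values below 1.\<close>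

lemma Lp_ball_mult:
  fixes f g :: "real^'n \<Rightarrow> complex"
  assumes f[measurable]: "f \<in> borel_measurable borel" and g[measurable]: "g \<in> borel_measurable borel"
    and Lf: "Lp_ball p f R" and Lg: "Lp_ball q g R"
    and p: "0 < p" and q: "0 < q" and r: "1 / r = 1 / p + 1 / q"
  shows "Lp_ball r (\<lambda>x. f x * g x) R"
proof -
  \<comment> \<open>In the extended nonnegative reals \<open>x \<mapsto> 1 / x\<close> is an
    involution that exchanges 0 and infinity, so \<open>r\<close> is determined and the infinite
    exponents are included.\<close>
  have rr: "r = 1 / (1 / p + 1 / q)" unfolding r[symmetric] by simp
  consider "p = \<infinity>" | "q = \<infinity>" | "p \<noteq> \<infinity>" "q \<noteq> \<infinity>" by blast
  then show ?thesis
  proof cases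
    case 1
    then have "r = q" using rr by simp
    with 1 Lf Lg show ?thesis by (auto intro: Lp_ball_mult_bounded[OF g])
  next
    case 2
    then have "r = p" using rr by simp
    with 2 Lf Lg have "Lp_ball r (\<lambda>x. g x * f x) R" by (auto intro: Lp_ball_mult_bounded[OF f])
    then show ?thesis by (simp add: mult.commute)
  next
    case 3
    define P where "P = enn2real p"
    define Q where "Q = enn2real q"
    have P: "0 < P" "1 / p = ennreal (1 / P)" and Q: "0 < Q" "1 / q = ennreal (1 / Q)"
      using finite_exponent[OF p 3(1)] finite_exponent[OF q 3(2)] by (auto simp: P_def Q_def)
    define t where "t = 1 / (1 / P + 1 / Q)"
    have t: "0 < t" "1 / t = 1 / P + 1 / Q" using P(1) Q(1) by (auto simp: t_def add_pos_pos)
    have "r = 1 / ennreal (1 / t)" unfolding rr P(2) Q(2) t(2) using P(1) Q(1) by (simp add: ennreal_plus)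
    also have "\<dots> = ennreal t" using divide_ennreal[of 1 "1 / t"] t(1) by simp
    finally have rt: "r = ennreal t" .
    have tP: "t / P + t / Q = 1"
    proof -
      have "t / P + t / Q = t * (1 / P + 1 / Q)" by (simp add: distrib_left)
      then show ?thesis using t by (metis divide_self_if less_irrefl times_divide_eq_right mult.right_neutral)
    qed
    have tP1: "1 < P / t" "1 < Q / t"
    proof -
      have "0 < t / P" "0 < t / Q" using t P Q by auto
      then have "t / P < 1" "t / Q < 1" using tP by linarith+
      then show "1 < P / t" "1 < Q / t" using t(1) P(1) Q(1) by (auto simp: field_simps)
    qed
    have Y: "norm (f x * g x) powr t \<le> norm (f x) powr P + norm (g x) powr Q" for x
    proof -
      have "norm (f x * g x) powr t = norm (f x) powr t * norm (g x) powr t"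
        by (simp add: norm_mult powr_mult)
      also have "\<dots> \<le> (norm (f x) powr t) powr (P / t) / (P / t) + (norm (g x) powr t) powr (Q / t) / (Q / t)"
        using tP1 tP by (intro Youngs_inequality) auto
      also have "\<dots> = norm (f x) powr P / (P / t) + norm (g x) powr Q / (Q / t)"
        using t(1) by (simp add: powr_powr)
      also have "\<dots> \<le> norm (f x) powr P + norm (g x) powr Q"
      proof -
        have le: "a / b \<le> a" if "0 \<le> a" "1 < b" for a b :: real
          using that by (simp add: divide_le_eq mult_le_cancel_left1)
        show ?thesis by (intro add_mono le tP1) auto
      qed
      finally show ?thesis .
    qed
    have i[measurable]: "(indicator (cball 0 R) :: real^'n \<Rightarrow> ennreal) \<in> borel_measurable borel"
      by (intro borel_measurable_indicator) simp
    have "(\<integral>\<^sup>+x. ennreal (norm (f x * g x) powr t) * indicator (cball 0 R) x \<partial>lborel) \<le>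
        (\<integral>\<^sup>+x. ennreal (norm (f x) powr P) * indicator (cball 0 R) x + ennreal (norm (g x) powr Q) * indicator (cball 0 R) x \<partial>lborel)"
    proof (rule nn_integral_mono)
      fix x
      have "ennreal (norm (f x * g x) powr t) \<le> ennreal (norm (f x) powr P) + ennreal (norm (g x) powr Q)"
        using Y[of x] by (simp add: ennreal_plus[symmetric] ennreal_leI del: ennreal_plus)
      then show "ennreal (norm (f x * g x) powr t) * indicator (cball 0 R) x \<le>
          ennreal (norm (f x) powr P) * indicator (cball 0 R) x + ennreal (norm (g x) powr Q) * indicator (cball 0 R) x"
        by (simp add: indicator_def)
    qed
    also have "\<dots> = (\<integral>\<^sup>+x. ennreal (norm (f x) powr P) * indicator (cball 0 R) x \<partial>lborel) +
        (\<integral>\<^sup>+x. ennreal (norm (g x) powr Q) * indicator (cball 0 R) x \<partial>lborel)"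
      by (rule nn_integral_add) measurable
    also have "\<dots> < \<infinity>" using Lf Lg 3 by (simp add: Lp_ball_def P_def Q_def)
    finally show ?thesis using rt t(1) by (simp add: Lp_ball_def)
  qed
qed

section \<open>Convergence of the low-pass products\<close>

lemma integrable_of_nn_integral_le:
  fixes h :: "real^'n \<Rightarrow> complex"
  assumes h: "h \<in> borel_measurable borel" and le: "(\<integral>\<^sup>+x. norm (h x) \<partial>lborel) \<le> ennreal c" and c: "0 \<le> c"
  shows "integrable lborel h" "(LINT x|lborel. norm (h x)) \<le> c"
proof -
  show i: "integrable lborel h"
    using h le by (auto simp: integrable_iff_bounded intro: le_less_trans)
  have "ennreal (LINT x|lborel. norm (h x)) = (\<integral>\<^sup>+x. norm (h x) \<partial>lborel)"
    by (rule nn_integral_eq_integral[symmetric]) (auto intro: i)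
  then have "ennreal (LINT x|lborel. norm (h x)) \<le> ennreal c" using le by simp
  then show "(LINT x|lborel. norm (h x)) \<le> c" by (simp only: ennreal_le_iff[OF c])
qed

text \<open>The kernel times \<open>cut R\<close> is a test function, so there \<open>u\<close> is
  integration against \<open>f\<close>, and the result is an honest convolution. The rest stays an
  application of \<open>u\<close>.\<close>

lemma avg_decomposition:
  fixes f \<eta> :: "real^'n \<Rightarrow> complex"
  assumes u: "given_by u f" and f: "f \<in> borel_measurable borel" and \<eta>: "\<eta> \<in> schwartz" and R: "0 < R"
  shows "avg u \<eta> x = conv (\<lambda>y. f y * cut R y) \<eta> x + u (\<lambda>y. (1 - cut R y) * \<eta> (x - y))"
proof -
  have ut: "u \<in> tempered_distributions" using u by (simp add: given_by_def)
  have w: "(\<lambda>y. \<eta> (x - y)) \<in> schwartz" using \<eta> by (rule schwartz_reflect)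
  have T: "(\<lambda>y. cut R y * \<eta> (x - y)) \<in> test_functions"
    using test_functions_mult[OF schwartz_smooth[OF w] cut_test_function[OF R]] by (simp add: mult.commute)
  have "u (\<lambda>y. cut R y * \<eta> (x - y)) = conv (\<lambda>y. f y * cut R y) \<eta> x"
    using given_by_test[OF u f T] by (simp add: conv_def mult.assoc)
  moreover have "u (\<lambda>y. (1 - cut R y) * \<eta> (x - y)) = u (\<lambda>y. \<eta> (x - y)) - u (\<lambda>y. cut R y * \<eta> (x - y))"
    using tempered_diff[OF ut w test_functions_schwartz[OF T]] by (simp add: left_diff_distrib)
  ultimately show ?thesis by (simp add: avg_def)
qed

text \<open>With \<open>avg u = a + e\<close> and \<open>avg v = b + e'\<close>, the product differs
  from \<open>a * b\<close> by \<open>e * b + e' * a + e * e'\<close>. The errors are of order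
  \<open>1 / 2 ^ k\<close> uniformly on the support of \<open>\<phi>\<close>, and the convolutions
  \<open>a\<close>, \<open>b\<close> are bounded in \<open>L\<^sub>1\<close> independently of
  \<open>k\<close>, so the difference vanishes in the limit. What remains is
  \<open>conv_pair_tendsto\<close>.\<close>

lemma avg_product_tendsto:
  fixes f g \<psi> \<phi> :: "real^'n \<Rightarrow> complex"
  assumes u: "given_by u f" and v: "given_by v g"
    and f: "f \<in> borel_measurable borel" and g: "g \<in> borel_measurable borel"
    and fi: "loc_int f" and gi: "loc_int g"
    and gp: "\<And>R. 0 < R \<Longrightarrow> good_pair (\<lambda>x. f x * cut R x) (\<lambda>x. g x * cut R x)"
    and \<psi>: "\<psi> \<in> schwartz" "\<psi> 0 = 1" and M: "\<And>j. 1 \<le> M $ j" and \<phi>: "\<phi> \<in> test_functions"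
  shows "(\<lambda>k. LINT x|lborel. avg u (kern M \<psi> k) x * avg v (kern M \<psi> k) x * \<phi> x) \<longlonglongrightarrow> (LINT x|lborel. f x * g x * \<phi> x)"
proof -
  let ?\<eta> = "kern M \<psi>"
  have ut: "u \<in> tempered_distributions" and vt: "v \<in> tempered_distributions"
    using u v by (simp_all add: given_by_def)
  have \<phi>S: "\<phi> \<in> schwartz" using \<phi> by (rule test_functions_schwartz)
  obtain r where r: "0 < r" "\<And>x. norm x > r \<Longrightarrow> \<phi> x = 0" by (rule test_function_support[OF \<phi>]) (rule that)
  obtain \<Phi> where \<Phi>: "0 < \<Phi>" "\<And>x. norm (\<phi> x) \<le> \<Phi>" by (rule norm_bounded_schwartz[OF \<phi>S]) (rule that)
  \<comment> \<open>The support of \<open>\<phi>\<close> lies in the ball of radius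
    \<open>R / 2\<close>, as \<open>cut_complement_tail\<close> demands, and there
    \<open>cut R\<close> equals 1; the bounds on cut-offs ask for \<open>R \<ge> 1\<close>.\<close>
  define R where "R = max 1 (2 * r)"
  have R: "1 \<le> R" "0 < R" "r \<le> R / 2" "r \<le> R" using r(1) by (auto simp: R_def)
  define F where "F x = f x * cut R x" for x
  define G where "G x = g x * cut R x" for x
  have iF: "integrable lborel F" unfolding F_def[abs_def] by (intro loc_int_test fi cut_test_function R)
  have iG: "integrable lborel G" unfolding G_def[abs_def] by (intro loc_int_test gi cut_test_function R)
  define e where "e k x = u (\<lambda>y. (1 - cut R y) * ?\<eta> k (x - y))" for k x
  define e' where "e' k x = v (\<lambda>y. (1 - cut R y) * ?\<eta> k (x - y))" for k x
  obtain E where E: "0 \<le> E" "\<forall>k x. norm x \<le> R / 2 \<longrightarrow> norm (u (\<lambda>y. (1 - cut R y) * ?\<eta> k (x - y))) \<le> E / 2 ^ k"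
    using cut_complement_tail[OF ut \<psi>(1) M R(1)] by blast
  obtain E' where E': "0 \<le> E'" "\<forall>k x. norm x \<le> R / 2 \<longrightarrow> norm (v (\<lambda>y. (1 - cut R y) * ?\<eta> k (x - y))) \<le> E' / 2 ^ k"
    using cut_complement_tail[OF vt \<psi>(1) M R(1)] by blast
  define S where "S = (LINT x|lborel. norm (inv_fourier \<psi> x))"
  have ai: "approx_id ?\<eta> S" unfolding S_def by (rule kern_approx_id[OF \<psi> M])
  have S0: "0 \<le> S" and \<eta>n: "\<And>k. (\<integral>\<^sup>+x. norm (?\<eta> k x) \<partial>lborel) \<le> ennreal S" using ai by (auto simp: approx_id_def)
  have \<eta>S: "?\<eta> k \<in> schwartz" for k by (rule kern_schwartz[OF \<psi>(1)])
  have sa: "smooth (avg u (?\<eta> k))" "smooth (avg v (?\<eta> k))" for k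
    unfolding kern_def by (intro smooth_avg_inv_fourier ut vt dilate_schwartz \<psi>)+
  have sc: "smooth (conv F (?\<eta> k))" "smooth (conv G (?\<eta> k))" for k
    by (intro smooth_conv iF iG \<eta>S)+
  have conv1: "integrable lborel (conv H (?\<eta> k))" "(LINT x|lborel. norm (conv H (?\<eta> k) x)) \<le> (LINT x|lborel. norm (H x)) * S"
    if H: "integrable lborel H" for H k
  proof -
    have "(\<integral>\<^sup>+x. norm (conv H (?\<eta> k) x) \<partial>lborel) \<le> (\<integral>\<^sup>+x. norm (H x) \<partial>lborel) * (\<integral>\<^sup>+x. norm (?\<eta> k x) \<partial>lborel)"
      by (rule nn_integral_conv_le[OF H \<eta>S])
    also have "\<dots> \<le> (\<integral>\<^sup>+x. norm (H x) \<partial>lborel) * ennreal S" by (intro mult_left_mono \<eta>n) simp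
    also have "(\<integral>\<^sup>+x. norm (H x) \<partial>lborel) = ennreal (LINT x|lborel. norm (H x))"
      by (rule nn_integral_eq_integral) (auto intro: H)
    also have "ennreal (LINT x|lborel. norm (H x)) * ennreal S = ennreal ((LINT x|lborel. norm (H x)) * S)"
      using S0 by (simp add: ennreal_mult)
    finally have le: "(\<integral>\<^sup>+x. norm (conv H (?\<eta> k) x) \<partial>lborel) \<le> ennreal ((LINT x|lborel. norm (H x)) * S)" .
    have "0 \<le> (LINT x|lborel. norm (H x)) * S" using S0 by (intro mult_nonneg_nonneg Bochner_Integration.integral_nonneg) auto
    from integrable_of_nn_integral_le[OF smooth_borel[OF smooth_conv[OF H \<eta>S]] le this]
    show "integrable lborel (conv H (?\<eta> k))" "(LINT x|lborel. norm (conv H (?\<eta> k) x)) \<le> (LINT x|lborel. norm (H x)) * S" .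
  qed
  let ?nF = "(LINT x|lborel. norm (F x)) * S" and ?nG = "(LINT x|lborel. norm (G x)) * S" and ?I = "LINT x|lborel. norm (\<phi> x)"
  let ?X = "\<lambda>k. LINT x|lborel. avg u (?\<eta> k) x * avg v (?\<eta> k) x * \<phi> x"
  let ?Y = "\<lambda>k. LINT x|lborel. conv F (?\<eta> k) x * conv G (?\<eta> k) x * \<phi> x"
  have i\<phi>: "integrable lborel \<phi>" by (rule schwartz_integrable[OF \<phi>S])
  have diff: "norm (?X k - ?Y k) \<le> (\<Phi> * E * ?nG + \<Phi> * E' * ?nF + E * E' * ?I) / 2 ^ k" for k
  proof -
    have iX: "integrable lborel (\<lambda>x. avg u (?\<eta> k) x * avg v (?\<eta> k) x * \<phi> x)"
      by (intro schwartz_integrable test_functions_schwartz test_functions_mult smooth_mult sa \<phi>)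
    have iY: "integrable lborel (\<lambda>x. conv F (?\<eta> k) x * conv G (?\<eta> k) x * \<phi> x)"
      by (intro schwartz_integrable test_functions_schwartz test_functions_mult smooth_mult sc \<phi>)
    let ?Z = "\<lambda>x. (\<Phi> * (E / 2 ^ k)) * norm (conv G (?\<eta> k) x) + (\<Phi> * (E' / 2 ^ k)) * norm (conv F (?\<eta> k) x) +
        (E / 2 ^ k * E') * norm (\<phi> x)"
    have iZ: "integrable lborel (\<lambda>x. (\<Phi> * (E / 2 ^ k)) * norm (conv G (?\<eta> k) x))"
      "integrable lborel (\<lambda>x. (\<Phi> * (E' / 2 ^ k)) * norm (conv F (?\<eta> k) x))"
      "integrable lborel (\<lambda>x. (E / 2 ^ k * E') * norm (\<phi> x))"
      by (intro integrable_mult_right integrable_norm conv1 iF iG i\<phi>)+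
    have "norm (?X k - ?Y k) = norm (LINT x|lborel. avg u (?\<eta> k) x * avg v (?\<eta> k) x * \<phi> x - conv F (?\<eta> k) x * conv G (?\<eta> k) x * \<phi> x)"
      using iX iY by simp
    also have "\<dots> \<le> (LINT x|lborel. ?Z x)"
    proof (rule Bochner_Integration.integral_norm_bound_integral)
      show "integrable lborel (\<lambda>x. avg u (?\<eta> k) x * avg v (?\<eta> k) x * \<phi> x - conv F (?\<eta> k) x * conv G (?\<eta> k) x * \<phi> x)"
        using iX iY by simp
      show "integrable lborel ?Z" by (intro Bochner_Integration.integrable_add iZ)
      fix x
      show "norm (avg u (?\<eta> k) x * avg v (?\<eta> k) x * \<phi> x - conv F (?\<eta> k) x * conv G (?\<eta> k) x * \<phi> x) \<le> ?Z x"
      proof (cases "norm x \<le> r")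
        case True
        let ?a = "conv F (?\<eta> k) x" and ?b = "conv G (?\<eta> k) x"
        have xR: "norm x \<le> R / 2" using True R by linarith
        have ne: "norm (e k x) \<le> E / 2 ^ k" using E(2) xR by (simp add: e_def)
        have ne': "norm (e' k x) \<le> E' / 2 ^ k" using E'(2) xR by (simp add: e'_def)
        \<comment> \<open>In the term \<open>e * e'\<close> one factor \<open>1 / 2 ^ k\<close>
          suffices, so the second error is bounded by its constant; all three terms then share the
          same denominator.\<close>
        have "E' / 2 ^ k \<le> E' / 1" using E' by (intro divide_left_mono) auto
        with ne' have ne'': "norm (e' k x) \<le> E'" by simp
        have "avg u (?\<eta> k) x = ?a + e k x" "avg v (?\<eta> k) x = ?b + e' k x"
          unfolding F_def[abs_def] G_def[abs_def] e_def e'_def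
          by (rule avg_decomposition[OF u f \<eta>S R(2)], rule avg_decomposition[OF v g \<eta>S R(2)])
        then have "avg u (?\<eta> k) x * avg v (?\<eta> k) x * \<phi> x - ?a * ?b * \<phi> x =
            (\<phi> x * e k x) * ?b + (\<phi> x * e' k x) * ?a + (e k x * e' k x) * \<phi> x"
          by (simp add: algebra_simps)
        then have "norm (avg u (?\<eta> k) x * avg v (?\<eta> k) x * \<phi> x - ?a * ?b * \<phi> x) \<le>
            norm ((\<phi> x * e k x) * ?b) + norm ((\<phi> x * e' k x) * ?a) + norm ((e k x * e' k x) * \<phi> x)"
          by (simp only: norm_add3_le)
        also have "\<dots> \<le> ?Z x"
          unfolding norm_mult using \<Phi> E E' ne ne' ne''
          by (intro add_mono mult_right_mono mult_mono) auto
        finally show ?thesis .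
      next
        case False
        then have "\<phi> x = 0" using r(2) by simp
        then show ?thesis using \<Phi>(1) E(1) E'(1) by simp
      qed
    qed
    also have "\<dots> = (\<Phi> * (E / 2 ^ k)) * (LINT x|lborel. norm (conv G (?\<eta> k) x)) +
        (\<Phi> * (E' / 2 ^ k)) * (LINT x|lborel. norm (conv F (?\<eta> k) x)) + (E / 2 ^ k * E') * ?I"
      by (simp only: Bochner_Integration.integral_add[OF Bochner_Integration.integrable_add[OF iZ(1,2)] iZ(3)]
          Bochner_Integration.integral_add[OF iZ(1,2)] integral_mult_right_zero)
    also have "\<dots> \<le> (\<Phi> * (E / 2 ^ k)) * ?nG + (\<Phi> * (E' / 2 ^ k)) * ?nF + (E / 2 ^ k * E') * ?I"
      using \<Phi>(1) E(1) E'(1) by (intro add_mono mult_left_mono conv1 iF iG) auto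
    also have "\<dots> = (\<Phi> * E * ?nG + \<Phi> * E' * ?nF + E * E' * ?I) / 2 ^ k"
      by (simp add: add_divide_distrib)
    finally show ?thesis .
  qed
  have "(\<lambda>k. ?X k - ?Y k) \<longlonglongrightarrow> 0"
  proof (rule Lim_null_comparison)
    show "eventually (\<lambda>k. norm (?X k - ?Y k) \<le> (\<Phi> * E * ?nG + \<Phi> * E' * ?nF + E * E' * ?I) * inverse (2 ^ k)) sequentially"
      using diff by (simp add: divide_inverse)
    have "(\<lambda>k. (\<Phi> * E * ?nG + \<Phi> * E' * ?nF + E * E' * ?I) * inverse (2 ^ k)) \<longlonglongrightarrow> (\<Phi> * E * ?nG + \<Phi> * E' * ?nF + E * E' * ?I) * 0"
      by (intro tendsto_mult tendsto_const LIMSEQ_inverse_realpow_zero) simp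
    then show "(\<lambda>k. (\<Phi> * E * ?nG + \<Phi> * E' * ?nF + E * E' * ?I) * inverse (2 ^ k)) \<longlonglongrightarrow> 0" by simp
  qed
  moreover have "?Y \<longlonglongrightarrow> (LINT x|lborel. F x * G x * \<phi> x)"
    by (rule conv_pair_tendsto[OF ai iF iG _ \<phi>]) (use gp[OF R(2)] in \<open>simp add: F_def[abs_def] G_def[abs_def]\<close>)
  ultimately have "(\<lambda>k. (?X k - ?Y k) + ?Y k) \<longlonglongrightarrow> 0 + (LINT x|lborel. F x * G x * \<phi> x)"
    by (rule tendsto_add)
  moreover have "F x * G x * \<phi> x = f x * g x * \<phi> x" for x
    using cut_eq_1[OF R(2), of x] r(2)[of x] R(4) by (cases "norm x \<le> r") (auto simp: F_def G_def)
  ultimately show ?thesis by simp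
qed

lemma lowpass_given_by_avg:
  assumes u: "given_by u f" and f: "loc_int f" and \<psi>: "\<psi> \<in> schwartz"
  shows "smooth (avg u (kern M \<psi> k))" "given_by (lowpass M \<psi> k u) (avg u (kern M \<psi> k))"
proof -
  have ut: "u \<in> tempered_distributions" using u by (simp add: given_by_def)
  show sm: "smooth (avg u (kern M \<psi> k))"
    unfolding kern_def by (intro smooth_avg_inv_fourier ut dilate_schwartz \<psi>)
  have "restrict (lowpass M \<psi> k u) test_functions = regular_distr (avg u (kern M \<psi> k))"
  proof (rule extensionalityI[where A = test_functions])
    fix \<phi> :: "real^'a \<Rightarrow> complex" assume \<phi>: "\<phi> \<in> test_functions"
    have "lowpass M \<psi> k u \<phi> = u (convT (kern M \<psi> k) \<phi>)"
      by (intro lowpass_eq_convT \<psi> test_functions_schwartz \<phi>)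
    also have "\<dots> = (LINT x|lborel. avg u (kern M \<psi> k) x * \<phi> x)"
      unfolding kern_def by (rule tempered_convT_exchange[OF u f dilate_schwartz[OF \<psi>] \<phi>])
    finally show "restrict (lowpass M \<psi> k u) test_functions \<phi> = regular_distr (avg u (kern M \<psi> k)) \<phi>"
      using \<phi> by (simp add: regular_distr_borel[OF smooth_borel[OF sm]])
  qed (simp_all add: regular_distr_def)
  then show "given_by (lowpass M \<psi> k u) (avg u (kern M \<psi> k))"
    using lowpass_tempered[OF ut \<psi>] by (simp add: given_by_def)
qed

theorem lowpass_product_tendsto_Lp:
  fixes f g \<psi> :: "real^'n \<Rightarrow> complex"
  assumes \<psi>: "\<psi> \<in> schwartz" "\<psi> 0 = 1" and M: "weight M"
    and p: "0 < p" and q: "0 < q" and pq: "1 / p + 1 / q \<le> 1"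
    and f: "f \<in> borel_measurable borel" "\<And>R. Lp_ball p f R" and u: "given_by u f"
    and g: "g \<in> borel_measurable borel" "\<And>R. Lp_ball q g R" and v: "given_by v g"
  shows "lowpass_product_tendsto M \<psi> u v (regular_distr (\<lambda>x. f x * g x))"
proof -
  have p1: "1 / p \<le> 1" and q1: "1 / q \<le> 1"
    using pq by (meson add_increasing add_increasing2 order_refl order_trans zero_le)+
  have M1: "1 \<le> M $ j" for j using M by (simp add: weight_def)
  have fi: "loc_int f" by (intro Lp_ball_loc_int[OF f] exponent_ge_1 p p1)
  have gi: "loc_int g" by (intro Lp_ball_loc_int[OF g] exponent_ge_1 q q1)
  have gp: "good_pair (\<lambda>x. f x * cut R x) (\<lambda>x. g x * cut R x)" if "0 < R" for R
    by (rule good_pair_Lp[OF f(1) g(1) f(2) g(2) p q pq that])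
  have fgm: "(\<lambda>x. f x * g x) \<in> borel_measurable borel" using f(1) g(1) by (rule borel_measurable_times)
  \<comment> \<open>Local integrability of the product is inherited from the cut-off functions,
    which form a good pair and coincide with \<open>f\<close> and \<open>g\<close> on the ball
    considered.\<close>
  have fgi: "loc_int (\<lambda>x. f x * g x)"
    unfolding loc_int_def
  proof (intro conjI allI fgm)
    fix R :: real
    define R' where "R' = max 1 R"
    have R': "0 < R'" "R \<le> R'" by (auto simp: R'_def)
    have cm: "(cut R' :: real^'n \<Rightarrow> complex) \<in> borel_measurable borel" by (rule smooth_borel[OF smooth_cut])
    have "integrable lborel (\<lambda>x. (f x * cut R' x) * (g x * cut R' x))"
      by (intro good_pair_integrable gp R' borel_measurable_times f(1) g(1) cm)
    then show "integrable lborel (\<lambda>x. indicator (cball 0 R) x *\<^sub>R (f x * g x))"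
    proof (rule Bochner_Integration.integrable_bound)
      show "(\<lambda>x. indicator (cball 0 R) x *\<^sub>R (f x * g x)) \<in> borel_measurable lborel"
        using fgm by (intro borel_measurable_scaleR borel_measurable_indicator) auto
      show "AE x in lborel. norm (indicator (cball 0 R) x *\<^sub>R (f x * g x)) \<le> norm ((f x * cut R' x) * (g x * cut R' x))"
      proof (intro AE_I2)
        fix x
        show "norm (indicator (cball 0 R) x *\<^sub>R (f x * g x)) \<le> norm ((f x * cut R' x) * (g x * cut R' x))"
          using cut_eq_1[OF R'(1), of x] R'(2) by (cases "norm x \<le> R") auto
      qed
    qed
  qed
  let ?a = "\<lambda>k. avg u (kern M \<psi> k)" and ?b = "\<lambda>k. avg v (kern M \<psi> k)"
  have sa: "smooth (?a k)" "given_by (lowpass M \<psi> k u) (?a k)" for k by (rule lowpass_given_by_avg[OF u fi \<psi>(1)])+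
  have sb: "smooth (?b k)" "given_by (lowpass M \<psi> k v) (?b k)" for k by (rule lowpass_given_by_avg[OF v gi \<psi>(1)])+
  have sab: "smooth (\<lambda>x. ?a k x * ?b k x)" for k by (intro smooth_mult sa sb)
  have "tendsto_distr (\<lambda>k. regular_distr (\<lambda>x. ?a k x * ?b k x)) (regular_distr (\<lambda>x. f x * g x))"
    unfolding tendsto_distr_def
  proof (intro conjI allI ballI)
    show "regular_distr (\<lambda>x. ?a k x * ?b k x) \<in> distributions" for k
      by (intro regular_distr_in_distributions smooth_loc_int sab)
    show "regular_distr (\<lambda>x. f x * g x) \<in> distributions" by (intro regular_distr_in_distributions fgi)
    fix \<phi> :: "real^'n \<Rightarrow> complex" assume \<phi>: "\<phi> \<in> test_functions"
    show "(\<lambda>k. regular_distr (\<lambda>x. ?a k x * ?b k x) \<phi>) \<longlonglongrightarrow> regular_distr (\<lambda>x. f x * g x) \<phi>"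
      unfolding regular_distr_borel[OF smooth_borel[OF sab] \<phi>] regular_distr_borel[OF fgm \<phi>]
      by (rule avg_product_tendsto[OF u v f(1) g(1) fi gi gp \<psi> M1 \<phi>])
  qed
  then show ?thesis
    unfolding lowpass_product_tendsto_def using sa sb by (intro exI[of _ ?a] exI[of _ ?b]) blast
qed

text \<open>A cut-off must exist for \<open>product\<close> to be meaningful: the condition in its
  definite description is universally quantified over cut-offs, and uniqueness of \<open>w\<close>
  is drawn from a single one.\<close>

lemma cutoff_bump: "cutoff bump"
proof -
  have "eventually (\<lambda>\<xi>. \<xi> \<in> ball 0 1) (nhds (0 :: real^'a))"
    by (intro eventually_nhds_in_open) auto
  then have "eventually (\<lambda>\<xi>. bump \<xi> = 1) (nhds (0 :: real^'a))"
    by eventually_elim (simp add: bump_eq_1)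
  then show ?thesis by (simp add: cutoff_def bump_test_function)
qed

theorem proposition3p8:
  fixes \<psi> f g :: "real^'n \<Rightarrow> complex"
    and M :: "real^'n"
    and p q r :: ennreal
    and u v :: "(real^'n \<Rightarrow> complex) \<Rightarrow> complex"
  assumes "\<psi> \<in> schwartz" and "\<psi> 0 = 1"
    and "weight M"
    and "0 < p" and "0 < q"
    and "1 / r = 1 / p + 1 / q" and "1 / p + 1 / q \<le> 1"
    and "f \<in> Lp_loc p" and "given_by u f"
    and "g \<in> Lp_loc q" and "given_by v g"
  shows "lowpass_product_tendsto M \<psi> u v (regular_distr (\<lambda>x. f x * g x))
    \<and> product_defined M u v
    \<and> product M u v = regular_distr (\<lambda>x. f x * g x)
    \<and> (\<lambda>x. f x * g x) \<in> Lp_loc r"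
proof -
  have fm: "f \<in> borel_measurable lebesgue" and gm: "g \<in> borel_measurable lebesgue"
    and Lf: "\<And>R. Lp_ball p f R" and Lg: "\<And>R. Lp_ball q g R"
    using assms by (auto simp: Lp_loc_iff)
  \<comment> \<open>Passage to Borel representatives: membership in the local spaces,
    \<open>given_by\<close> and the regular distribution of the product are all insensitive to
    changes on null sets.\<close>
  obtain f' where f': "f' \<in> borel_measurable borel" "AE x in lborel. f x = f' x"
    by (rule borel_representative[OF fm])
  obtain g' where g': "g' \<in> borel_measurable borel" "AE x in lborel. g x = g' x"
    by (rule borel_representative[OF gm])
  have fm': "f' \<in> borel_measurable lebesgue" and gm': "g' \<in> borel_measurable lebesgue"
    using f'(1) g'(1) by (auto intro: measurable_completion)
  have Lf': "Lp_ball p f' R" and Lg': "Lp_ball q g' R" for R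
    using Lp_ball_cong_AE[OF f'(2) Lf] Lp_ball_cong_AE[OF g'(2) Lg] by auto
  have u': "given_by u f'" and v': "given_by v g'"
    using assms regular_distr_cong_AE[OF fm fm' f'(2)] regular_distr_cong_AE[OF gm gm' g'(2)]
    by (auto simp: given_by_def)
  have fgm: "(\<lambda>x. f x * g x) \<in> borel_measurable lebesgue" "(\<lambda>x. f' x * g' x) \<in> borel_measurable lebesgue"
    using fm gm fm' gm' by (auto intro: borel_measurable_times)
  have fgae: "AE x in lborel. f x * g x = f' x * g' x" using f'(2) g'(2) by eventually_elim simp
  have reg: "regular_distr (\<lambda>x. f x * g x) = regular_distr (\<lambda>x. f' x * g' x)"
    by (rule regular_distr_cong_AE[OF fgm fgae])
  let ?w = "regular_distr (\<lambda>x. f x * g x)"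
  have lim: "lowpass_product_tendsto M \<theta> u v ?w" if "\<theta> \<in> schwartz" "\<theta> 0 = 1" for \<theta>
    unfolding reg
    by (rule lowpass_product_tendsto_Lp[OF that assms(3-5,7) f'(1) Lf' u' g'(1) Lg' v'])
  have all: "\<forall>\<theta>. cutoff \<theta> \<longrightarrow> lowpass_product_tendsto M \<theta> u v ?w"
    using lim by (auto simp: cutoff_def test_functions_schwartz dest: eventually_nhds_x_imp_x)
  have uniq: "w = ?w" if "\<forall>\<theta>. cutoff \<theta> \<longrightarrow> lowpass_product_tendsto M \<theta> u v w" for w
    using that all cutoff_bump lowpass_product_tendsto_unique by blast
  have "product M u v = ?w"
    unfolding product_def by (rule the_equality, rule all, rule uniq)
  moreover have "product_defined M u v" unfolding product_defined_def using all by blast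
  moreover have "(\<lambda>x. f x * g x) \<in> Lp_loc r"
    unfolding Lp_loc_iff
  proof (intro conjI allI fgm)
    fix R
    have "Lp_ball r (\<lambda>x. f' x * g' x) R"
      by (rule Lp_ball_mult[OF f'(1) g'(1) Lf' Lg' assms(4,5,6)])
    then show "Lp_ball r (\<lambda>x. f x * g x) R"
      by (rule Lp_ball_cong_AE[rotated]) (use fgae in eventually_elim, simp)
  qed
  ultimately show ?thesis using lim[OF assms(1,2)] by blast
qed

end
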